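(* Let $n\ge2$, $a>-(n-2)^2/4$, and let $B^n$ be the open unit ball of $\mathbb{R}^n$. Suppose that for some $s$ there is a constant $C$ independent of $u_0$ such that $$\int_{B^n}|u^*(x)|^2\,dx\le C\|u_0\|^2_{H^s(\mathbb{R}^n)}\quad\text{for all }u_0\in H^s(\mathbb{R}^n),$$ where $u$ is the solution of $i\partial_t u-\Delta u+\frac{a}{|x|^2}u=0$, $u(x,0)=u_0(x)$, and $u^*(x)=\sup_{|t|>0}|u(x,t)|$. Then $s\ge\frac14$.
   Context: Let $n\ge2$ and $a>-(n-2)^2/4$. Write $x=r\theta$ with $r=|x|$, $\theta\in\mathbb{S}^{n-1}$. For each integer $k\ge0$ let $\{Y_{k,1},\dots,Y_{k,d(k)}\}$ be an orthonormal basis of the space of spherical harmonics of degree $k$ on $\mathbb{S}^{n-1}$; every $g\in L^2(\mathbb{R}^n)$ expands as $g(r\theta)=\sum_{k\ge0}\sum_{\ell=1}^{d(k)}a_{k,\ell}(r)Y_{k,\ell}(\theta)$. Set $\mu(k)=\frac{n-2}{2}+k$ and $\nu(k)=\sqrt{\mu(k)^2+a}$. $J_\nu$ denotes the Bessel function of order $\nu$. For $\nu\ge0$ and a function $f$ on $(0,\infty)$ the Hankel transform is $(\mathcal{H}_\nu f)(\rho)=\int_0^\infty (r\rho)^{-\frac{n-2}{2}}J_\nu(r\rho)f(r)r^{n-1}\,dr$. The solution of the equation is defined as follows: if $u_0(r\theta)=\sum_{k,\ell}a^0_{k,\ell}(r)Y_{k,\ell}(\theta)$ and $b^0_{k,\ell}=\mathcal{H}_{\nu(k)}a^0_{k,\ell}$,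 then $u(r\theta,t)=\sum_{k\ge0}\sum_{\ell=1}^{d(k)}Y_{k,\ell}(\theta)\int_0^\infty (r\rho)^{-\frac{n-2}{2}}J_{\nu(k)}(r\rho)e^{it\rho^2}b^0_{k,\ell}(\rho)\rho^{n-1}\,d\rho$. $H^s(\mathbb{R}^n)$ is the usual inhomogeneous $L^2$-Sobolev space. *)

theory Defs
  imports "HOL-Analysis.Analysis"
begin

definition partial_deriv :: "'n::finite \<Rightarrow> (real^'n \<Rightarrow> complex) \<Rightarrow> real^'n \<Rightarrow> complex" where
  "partial_deriv i f x = vector_derivative (\<lambda>h. f (x + h *\<^sub>R axis i 1)) (at 0)"

fun iter_partial :: "'n::finite list \<Rightarrow> (real^'n \<Rightarrow> complex) \<Rightarrow> real^'n \<Rightarrow> complex" where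
  "iter_partial [] f = f"
| "iter_partial (i # is) f = partial_deriv i (iter_partial is f)"

definition smooth_fun :: "(real^'n::finite \<Rightarrow> complex) \<Rightarrow> bool" where
  "smooth_fun f \<longleftrightarrow> (\<forall>is x. iter_partial is f differentiable (at x))"

definition test_fun :: "(real^'n::finite \<Rightarrow> complex) \<Rightarrow> bool" where
  "test_fun f \<longleftrightarrow> smooth_fun f \<and> bounded {x. f x \<noteq> 0}"

definition laplacian :: "(real^'n::finite \<Rightarrow> complex) \<Rightarrow> real^'n \<Rightarrow> complex" where
  "laplacian f x = (\<Sum>i\<in>UNIV. partial_deriv i (partial_deriv i f) x)"

text \<open>Integral over the unit sphere S^{n-1} w.r.t. surface measure, via polar coordinates:
  int_S f d sigma = n * int_{B^n} f(x/|x|) dx.\<close>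
definition sph_int :: "(real^'n::finite \<Rightarrow> complex) \<Rightarrow> complex" where
  "sph_int f = real CARD('n) *\<^sub>R (LINT x:ball 0 1|lborel. f (x /\<^sub>R norm x))"

definition hom_poly :: "nat \<Rightarrow> (real^'n::finite \<Rightarrow> complex) \<Rightarrow> bool" where
  "hom_poly k p \<longleftrightarrow> (\<exists>(A :: ('n \<Rightarrow> nat) set) (c :: ('n \<Rightarrow> nat) \<Rightarrow> complex).
      finite A \<and> (\<forall>\<alpha>\<in>A. (\<Sum>i\<in>UNIV. \<alpha> i) = k) \<and>
      (\<forall>x. p x = (\<Sum>\<alpha>\<in>A. c \<alpha> * (\<Prod>i\<in>UNIV. complex_of_real ((x $ i) ^ \<alpha> i)))))"

definition sph_harm :: "nat \<Rightarrow> (real^'n::finite \<Rightarrow> complex) \<Rightarrow> bool" where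
  "sph_harm k Y \<longleftrightarrow> (\<exists>p. hom_poly k p \<and> (\<forall>x. laplacian p x = 0) \<and>
      (\<forall>\<theta>\<in>sphere 0 1. Y \<theta> = p \<theta>))"

definition sph_onb :: "nat \<Rightarrow> nat \<Rightarrow> (nat \<Rightarrow> real^'n::finite \<Rightarrow> complex) \<Rightarrow> bool" where
  "sph_onb k d Y \<longleftrightarrow>
     (\<forall>l\<in>{1..d}. sph_harm k (Y l)) \<and>
     (\<forall>l\<in>{1..d}. \<forall>l'\<in>{1..d}. sph_int (\<lambda>\<theta>. Y l \<theta> * cnj (Y l' \<theta>)) = (if l = l' then 1 else 0)) \<and>
     (\<forall>Z. sph_harm k Z \<longrightarrow> (\<exists>c. \<forall>\<theta>\<in>sphere 0 1. Z \<theta> = (\<Sum>l=1..d. c l * Y l \<theta>)))"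

definition bessel_J :: "real \<Rightarrow> real \<Rightarrow> real" where
  "bessel_J \<nu> x = (\<Sum>m. (-1) ^ m / (fact m * Gamma (real m + \<nu> + 1)) * (x / 2) powr (2 * real m + \<nu>))"

definition mu_k :: "nat \<Rightarrow> nat \<Rightarrow> real" where
  "mu_k n k = (real n - 2) / 2 + real k"

definition nu_k :: "nat \<Rightarrow> real \<Rightarrow> nat \<Rightarrow> real" where
  "nu_k n a k = sqrt ((mu_k n k)\<^sup>2 + a)"

definition hankel_kernel :: "nat \<Rightarrow> real \<Rightarrow> real \<Rightarrow> real" where
  "hankel_kernel n \<nu> z = z powr (- (real n - 2) / 2) * bessel_J \<nu> z"

definition hankel :: "nat \<Rightarrow> real \<Rightarrow> (real \<Rightarrow> complex) \<Rightarrow> real \<Rightarrow> complex" where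
  "hankel n \<nu> f \<rho> = (LINT r:{0<..}|lborel.
      complex_of_real (hankel_kernel n \<nu> (r * \<rho>) * r ^ (n - 1)) * f r)"

definition sph_coeff :: "(real^'n::finite \<Rightarrow> complex) \<Rightarrow> (real^'n \<Rightarrow> complex) \<Rightarrow> real \<Rightarrow> complex" where
  "sph_coeff Y g r = sph_int (\<lambda>\<theta>. g (r *\<^sub>R \<theta>) * cnj (Y \<theta>))"

definition schr_sol :: "real \<Rightarrow> (nat \<Rightarrow> nat) \<Rightarrow> (nat \<Rightarrow> nat \<Rightarrow> real^'n::finite \<Rightarrow> complex)
     \<Rightarrow> (real^'n \<Rightarrow> complex) \<Rightarrow> real^'n \<Rightarrow> real \<Rightarrow> complex" where
  "schr_sol a d Y u0 x t =
     (let n = CARD('n); r = norm x; \<theta> = x /\<^sub>R r in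
      (\<Sum>k. \<Sum>l=1..d k. Y k l \<theta> *
         Lim at_top (\<lambda>R. LINT \<rho>:{0..R}|lborel.
            complex_of_real (hankel_kernel n (nu_k n a k) (r * \<rho>) * \<rho> ^ (n - 1))
            * cis (t * \<rho>\<^sup>2) * hankel n (nu_k n a k) (sph_coeff (Y k l) u0) \<rho>)))"

definition max_sol :: "real \<Rightarrow> (nat \<Rightarrow> nat) \<Rightarrow> (nat \<Rightarrow> nat \<Rightarrow> real^'n::finite \<Rightarrow> complex)
     \<Rightarrow> (real^'n \<Rightarrow> complex) \<Rightarrow> real^'n \<Rightarrow> ennreal" where
  "max_sol a d Y u0 x = (SUP t\<in>{t. \<bar>t\<bar> > 0}. ennreal (cmod (schr_sol a d Y u0 x t)))"

definition fourier :: "(real^'n::finite \<Rightarrow> complex) \<Rightarrow> real^'n \<Rightarrow> complex" where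
  "fourier f \<xi> = (LINT x|lborel. f x * cis (- (x \<bullet> \<xi>)))"

text \<open>Squared H^s norm (up to a harmless normalisation constant).\<close>
definition sobolev_norm_sq :: "real \<Rightarrow> (real^'n::finite \<Rightarrow> complex) \<Rightarrow> ennreal" where
  "sobolev_norm_sq s f = (\<integral>\<^sup>+ \<xi>. ennreal ((1 + (norm \<xi>)\<^sup>2) powr s * (cmod (fourier f \<xi>))\<^sup>2) \<partial>lborel)"

end

theory Submission
  imports Defs "HOL-Probability.Probability"
begin

text \<open>
  Test the estimate on the radial data \<open>u\<^sub>N(x) = exp (i N |x|\<^sup>2 / 2) \<psi> (\<surd>N (|x|\<^sup>2 - 1))\<close> with a fixed
  bump function \<open>\<psi>\<close>. They live on a shell of width \<open>N powr (-1/2)\<close> and oscillate at frequency \<open>N\<close>, so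
  the square of their \<open>H\<^sup>s\<close> norm is at most of order \<open>N powr (2 s - 1/2)\<close> for \<open>0 \<le> s \<le> 1\<close>. Only the
  component \<open>k = 0\<close> is present, and Weber's second exponential integral turns the spectral definition
  of the solution into the integral operator with kernel
  \<open>\<surd>\<lambda> w(\<lambda> r s) exp (-i \<lambda> (r\<^sup>2 + s\<^sup>2) / 2)\<close> up to a unimodular factor, where \<open>\<lambda> = 1 / (2 t)\<close> and
  \<open>w(z) = \<surd>z J\<^sub>\<nu>(z)\<close> is asymptotic to a nonzero multiple of a shifted cosine. For \<open>r\<close> between
  \<open>1/4\<close> and \<open>1/2\<close> choose \<open>\<lambda> = N / (1 - r)\<close>: then one of the two exponentials in the
  cosine is stationary at \<open>s = 1\<close>, the integrand does not oscillate on the support of \<open>u\<^sub>N\<close>, and the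
  solution at this time is bounded below by a constant. Hence \<open>1 \<le> C N powr (2 s - 1/2)\<close> for all large
  \<open>N\<close>.
\<close>

section \<open>The Bessel function through its Clifford series\<close>

text \<open>With \<open>\<lambda> = N / (1 - r)\<close> the phases of datum and kernel combine to
  \<open>M * s - M * s^2 / 2\<close>, where \<open>M = \<lambda> * r\<close> and
  \<open>M \<le> N\<close>. It is stationary at \<open>s = 1\<close> and varies by at most 1/2 when
  \<open>|s - 1| \<le> N powr (-1/2)\<close>; this fixes the width of the shell. The window integral
  is then of order \<open>N powr (-1/2)\<close>, and the prefactor \<open>sqrt \<lambda>\<close>
  restores order one. The time depends on \<open>|x|\<close>, and that is where the supremum over
  \<open>t\<close> enters.

  The obstacle is the spectral definition of the solution: a series over all spherical harmonics of
  limits of truncated integrals. The degrees \<open>k \<ge> 1\<close> disappear for radial data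
  because harmonics have mean zero, which has to be proved for a sphere integral encoded as a ball
  integral. In degree zero the \<open>\<rho>\<close>- and \<open>s\<close>-integrals must be
  exchanged although the oscillating kernel is not absolutely integrable.

  Every estimate is one-sided: the Sobolev norm is needed from above, so an inequality of Plancherel
  type and interpolation between the \<open>L^2\<close> and \<open>H^1\<close> sizes suffice, while
  the lower bound rests on a single nonvanishing amplitude in the asymptotics of the Bessel
  function.\<close>

definition bessel_coeff :: "real \<Rightarrow> nat \<Rightarrow> real" where
  "bessel_coeff \<nu> m = 1 / (fact m * Gamma (real m + \<nu> + 1))"

text \<open>The entire function shared by both Bessel families: \<open>(x / 2) powr \<nu>\<close>
  times its value at \<open>- x^2 / 4\<close> is J of order \<open>\<nu>\<close>, and at
  \<open>x^2 / 4\<close> it is I. The field is left open because the propagator kernel has complex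
  arguments, while energy estimates and majorants are real.\<close>

definition bessel_clifford :: "real \<Rightarrow> 'a::{real_normed_field,banach} \<Rightarrow> 'a" where
  "bessel_clifford \<nu> y = (\<Sum>m. of_real (bessel_coeff \<nu> m) * y ^ m)"

lemma bessel_coeff_pos: "\<nu> > 0 \<Longrightarrow> bessel_coeff \<nu> m > 0"
  by (simp add: bessel_coeff_def Gamma_real_pos)

lemma Gamma_add_nat_ge:
  assumes "\<nu> > 0" shows "Gamma (real m + \<nu> + 1) \<ge> Gamma (\<nu> + 1)"
proof (induction m)
  case (Suc m)
  have "Gamma (real (Suc m) + \<nu> + 1) = (real m + \<nu> + 1) * Gamma (real m + \<nu> + 1)"
    using Gamma_plus1[of "real m + \<nu> + 1"] assms
    by (auto simp: algebra_simps nonpos_Ints_def)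
  also have "\<dots> \<ge> 1 * Gamma (real m + \<nu> + 1)"
    using assms by (intro mult_right_mono) (auto intro!: less_imp_le Gamma_real_pos)
  finally show ?case using Suc by simp
qed auto

lemma bessel_coeff_le:
  assumes "\<nu> > 0" shows "bessel_coeff \<nu> m \<le> inverse (Gamma (\<nu> + 1)) * inverse (fact m)"
proof -
  have "Gamma (\<nu> + 1) > 0" using assms by (simp add: Gamma_real_pos)
  then have "1 / (fact m * Gamma (real m + \<nu> + 1)) \<le> 1 / (fact m * Gamma (\<nu> + 1))"
    using Gamma_add_nat_ge[OF assms, of m] by (intro divide_left_mono mult_left_mono mult_pos_pos) auto
  also have "\<dots> = inverse (Gamma (\<nu> + 1)) * inverse (fact m)"
    by (simp add: divide_inverse)
  finally show ?thesis unfolding bessel_coeff_def .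
qed

text \<open>The Gamma factors stay above \<open>Gamma (\<nu> + 1)\<close>, so a multiple of the
  exponential series dominates at every point.\<close>

lemma summable_norm_bessel_clifford:
  fixes y :: "'a::{real_normed_field,banach}"
  assumes "\<nu> > 0" shows "summable (\<lambda>m. norm (of_real (bessel_coeff \<nu> m) * y ^ m))"
proof (rule summable_comparison_test')
  show "summable (\<lambda>m. inverse (Gamma (\<nu> + 1)) * (inverse (fact m) * norm y ^ m))"
    by (intro summable_mult summable_exp)
  fix m
  have "norm (norm (of_real (bessel_coeff \<nu> m) * y ^ m)) = bessel_coeff \<nu> m * norm y ^ m"
    using bessel_coeff_pos[OF assms, of m] by (simp add: norm_mult norm_power)
  also have "\<dots> \<le> inverse (Gamma (\<nu> + 1)) * inverse (fact m) * norm y ^ m"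
    by (intro mult_right_mono bessel_coeff_le assms) auto
  finally show "norm (norm (of_real (bessel_coeff \<nu> m) * y ^ m)) \<le> inverse (Gamma (\<nu> + 1))
      * (inverse (fact m) * norm y ^ m)"
    by (simp add: mult.assoc)
qed

lemma summable_bessel_clifford:
  fixes y :: "'a::{real_normed_field,banach}"
  assumes "\<nu> > 0" shows "summable (\<lambda>m. of_real (bessel_coeff \<nu> m) * y ^ m)"
  by (rule summable_norm_cancel[OF summable_norm_bessel_clifford[OF assms]])

lemma bessel_clifford_of_real:
  assumes "\<nu> > 0"
  shows "bessel_clifford \<nu> (of_real x :: 'a::{real_normed_field,banach})
      = of_real (bessel_clifford \<nu> x)"
proof -
  have "(\<lambda>m. of_real (bessel_coeff \<nu> m * x ^ m)) sums (of_real (bessel_clifford \<nu> x) :: 'a)"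
    unfolding bessel_clifford_def using summable_bessel_clifford[OF assms, of x]
    by (intro sums_of_real) (simp add: summable_sums)
  then show ?thesis
    unfolding bessel_clifford_def[of \<nu> "of_real x"] by (simp add: sums_iff)
qed

lemma norm_bessel_clifford_le:
  fixes y :: "'a::{real_normed_field,banach}"
  assumes "\<nu> > 0" shows "norm (bessel_clifford \<nu> y) \<le> bessel_clifford \<nu> (norm y)"
proof -
  have "norm (of_real (bessel_coeff \<nu> m) * y ^ m) = of_real (bessel_coeff \<nu> m) * norm y ^ m" for m
    using bessel_coeff_pos[OF assms, of m] by (simp add: norm_mult norm_power)
  then show ?thesis
    using summable_norm[OF summable_norm_bessel_clifford[OF assms, of y]] unfolding bessel_clifford_def
        by simp
qed

lemma bessel_clifford_mono:
  assumes "\<nu> > 0" "0 \<le> x" "x \<le> y" shows "bessel_clifford \<nu> x \<le> bessel_clifford \<nu> (y::real)"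
  unfolding bessel_clifford_def
proof (intro suminf_le summable_bessel_clifford assms)
  fix m show "of_real (bessel_coeff \<nu> m) * x ^ m \<le> of_real (bessel_coeff \<nu> m) * y ^ m"
    using assms bessel_coeff_pos[OF assms(1), of m] by (auto intro!: mult_left_mono power_mono)
qed

text \<open>This is why termwise differentiation raises the order by one and stays inside the
  family.\<close>

lemma bessel_coeff_Suc: "real (Suc m) * bessel_coeff \<nu> (Suc m) = bessel_coeff (\<nu> + 1) m"
proof -
  have "Gamma (real (Suc m) + \<nu> + 1) = Gamma (real m + (\<nu> + 1) + 1)"
    by (rule arg_cong[of _ _ Gamma]) simp
  then show ?thesis
    by (simp add: bessel_coeff_def fact_Suc del: of_nat_Suc)
qed

lemma bessel_coeff_plus1:
  assumes "\<nu> > 0" shows "(real m + \<nu> + 1) * bessel_coeff (\<nu> + 1) m = bessel_coeff \<nu> m"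
proof -
  have "Gamma (real m + (\<nu> + 1) + 1) = (real m + \<nu> + 1) * Gamma (real m + \<nu> + 1)"
    using Gamma_plus1[of "real m + \<nu> + 1"] assms by (auto simp: add_ac nonpos_Ints_def)
  then show ?thesis using assms by (simp add: bessel_coeff_def)
qed

lemma has_field_derivative_bessel_clifford:
  assumes "\<nu> > 0"
  shows "(bessel_clifford \<nu> has_field_derivative bessel_clifford (\<nu> + 1) y) (at y)"
proof -
  have "diffs (\<lambda>m. of_real (bessel_coeff \<nu> m)) = (\<lambda>m. of_real (bessel_coeff (\<nu> + 1) m) :: 'a)"
    unfolding diffs_def by (metis bessel_coeff_Suc of_real_mult of_real_of_nat_eq)
  then show ?thesis
    using termdiffs_strong_converges_everywhere[OF summable_bessel_clifford[OF assms], of y]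
    by (simp add: bessel_clifford_def[abs_def])
qed

text \<open>Since differentiation raises the order, this is Clifford's equation
  \<open>y f'' + (\<nu> + 1) f' = f\<close> in disguise. It is the only input needed for Bessel's
  equation below.\<close>

lemma bessel_clifford_recurrence:
  fixes y :: "'a::{real_normed_field,banach}"
  assumes "\<nu> > 0"
  shows "y * bessel_clifford (\<nu> + 2) y + of_real (\<nu> + 1) * bessel_clifford (\<nu> + 1) y
      = bessel_clifford \<nu> y"
proof -
  have s: "(\<lambda>m. of_real (bessel_coeff \<mu> m) * y ^ m) sums bessel_clifford \<mu> y" if "\<mu> > 0" for \<mu>
    unfolding bessel_clifford_def by (rule summable_sums[OF summable_bessel_clifford[OF that]])
  \<comment> \<open>The series of \<open>y * bessel_clifford (\<nu> + 2) y\<close>, shifted so that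
    the coefficient of \<open>y ^ m\<close> sits at index \<open>m\<close>; index 0 is
    empty.\<close>
  define f where "f = (\<lambda>m. if m = 0 then 0 else of_real (bessel_coeff (\<nu> + 2) (m - 1)) * y ^ m)"
  have "(\<lambda>m. f (Suc m)) sums (y * bessel_clifford (\<nu> + 2) y)"
    using sums_mult[OF s[of "\<nu> + 2"], of y] assms by (simp add: f_def mult_ac)
  then have "f sums (y * bessel_clifford (\<nu> + 2) y)"
    by (subst (asm) sums_Suc_iff) (simp add: f_def)
  then have "(\<lambda>m. f m + of_real (\<nu> + 1) * (of_real (bessel_coeff (\<nu> + 1) m) * y ^ m)) sums
     (y * bessel_clifford (\<nu> + 2) y + of_real (\<nu> + 1) * bessel_clifford (\<nu> + 1) y)"
    using assms by (intro sums_add sums_mult s) auto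
  moreover have "f m + of_real (\<nu> + 1) * (of_real (bessel_coeff (\<nu> + 1) m) * y ^ m)
      = of_real (bessel_coeff \<nu> m) * y ^ m" for m
  proof (cases m)
    case 0
    have "(\<nu> + 1) * bessel_coeff (\<nu> + 1) 0 = bessel_coeff \<nu> 0"
      using bessel_coeff_plus1[OF assms, of 0] by simp
    then have "(of_real (\<nu> + 1) * of_real (bessel_coeff (\<nu> + 1) 0) :: 'a) = of_real (bessel_coeff \<nu> 0)"
      by (metis of_real_mult)
    then show ?thesis using 0 by (simp add: f_def)
  next
    case (Suc k)
    have "bessel_coeff (\<nu> + 2) k = real (Suc k) * bessel_coeff (\<nu> + 1) (Suc k)"
      using bessel_coeff_Suc[of k "\<nu> + 1"] by (simp add: add.assoc)
    then have "bessel_coeff (\<nu> + 2) k + (\<nu> + 1) * bessel_coeff (\<nu> + 1) (Suc k) = bessel_coeff \<nu> (Suc k)"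
      using bessel_coeff_plus1[OF assms, of "Suc k"] by (simp add: algebra_simps)
    then have *: "(of_real (bessel_coeff (\<nu> + 2) k) + of_real (\<nu> + 1)
        * of_real (bessel_coeff (\<nu> + 1) (Suc k)) :: 'a) = of_real (bessel_coeff \<nu> (Suc k))"
      by (metis of_real_add of_real_mult)
    have "f m + of_real (\<nu> + 1) * (of_real (bessel_coeff (\<nu> + 1) m) * y ^ m) =
      (of_real (bessel_coeff (\<nu> + 2) k) + of_real (\<nu> + 1) * of_real (bessel_coeff (\<nu> + 1) (Suc k)))
          * y ^ m"
      unfolding f_def Suc ring_distribs(2) mult.assoc by simp
    then show ?thesis using * Suc by simp
  qed
  ultimately have "(\<lambda>m. of_real (bessel_coeff \<nu> m) * y ^ m) sums
     (y * bessel_clifford (\<nu> + 2) y + of_real (\<nu> + 1) * bessel_clifford (\<nu> + 1) y)" by simp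
  then show ?thesis using s[OF assms] sums_unique2 by blast
qed

lemma bessel_J_eq:
  assumes "\<nu> > 0" "x > 0"
  shows "bessel_J \<nu> x = (x / 2) powr \<nu> * bessel_clifford \<nu> (- (x\<^sup>2) / 4)"
proof -
  have "(-1) ^ m / (fact m * Gamma (real m + \<nu> + 1)) * (x / 2) powr (2 * real m + \<nu>)
     = (x / 2) powr \<nu> * (of_real (bessel_coeff \<nu> m) * (- (x\<^sup>2) / 4) ^ m)" for m
  proof -
    have "(x / 2) powr (2 * real m + \<nu>) = (x / 2) powr \<nu> * (x / 2) powr (real (2 * m))"
      unfolding powr_add[symmetric] by (simp add: add.commute)
    also have "(x / 2) powr (real (2 * m)) = (x\<^sup>2 / 4) ^ m"
      using assms by (subst powr_realpow) (auto simp: power_mult power_divide)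
    finally have "(x / 2) powr (2 * real m + \<nu>) = (x / 2) powr \<nu> * (x\<^sup>2 / 4) ^ m" .
    moreover have "(- (x\<^sup>2) / 4) ^ m = (-1) ^ m * (x\<^sup>2 / 4) ^ m"
      by (metis minus_divide_left power_minus)
    ultimately show ?thesis by (simp add: bessel_coeff_def)
  qed
  then show ?thesis
    using suminf_mult[OF summable_bessel_clifford[OF assms(1), of "- (x\<^sup>2) / 4"], of "(x / 2) powr \<nu>"]
    by (simp add: bessel_J_def bessel_clifford_def)
qed

section \<open>Large-argument asymptotics by energy estimates\<close>

text \<open>The Liouville form of Bessel's equation: \<open>w = \<surd>z J\<^sub>\<nu>\<close> satisfies \<open>w'' = - (1 - (\<nu>\<^sup>2 - 1/4) / z\<^sup>2) w\<close>.\<close>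

definition bessel_w :: "real \<Rightarrow> real \<Rightarrow> real" where
  "bessel_w \<nu> z = sqrt z * bessel_J \<nu> z"

text \<open>The derivative of \<open>bessel_w \<nu>\<close> in closed form, with the derivative of
  the Clifford function replaced by the one of order \<open>\<nu> + 1\<close>. Naming it turns
  Bessel's equation into a first-order system.\<close>

definition bessel_dw :: "real \<Rightarrow> real \<Rightarrow> real" where
  "bessel_dw \<nu> z = 2 powr (-\<nu>) * z powr (\<nu> + 1/2) *
     ((\<nu> + 1/2) / z * bessel_clifford \<nu> (- (z\<^sup>2) / 4) - z / 2 * bessel_clifford (\<nu> + 1) (- (z\<^sup>2) / 4))"

lemma bessel_w_eq:
  assumes "\<nu> > 0" "z > 0"
  shows "bessel_w \<nu> z = 2 powr (-\<nu>) * z powr (\<nu> + 1/2) * bessel_clifford \<nu> (- (z\<^sup>2) / 4)"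
proof -
  have "(z / 2) powr \<nu> = 2 powr (-\<nu>) * z powr \<nu>"
    using assms by (simp add: powr_divide powr_minus_divide)
  moreover have "z powr (\<nu> + 1/2) = z powr \<nu> * sqrt z"
    using assms by (simp only: powr_add powr_half_sqrt)
  ultimately show ?thesis by (simp add: bessel_w_def bessel_J_eq[OF assms])
qed

lemma bessel_clifford_comp_deriv:
  assumes "\<nu> > 0"
  shows "((\<lambda>z::real. bessel_clifford \<nu> (- (z\<^sup>2) / 4)) has_real_derivative
     - (z / 2) * bessel_clifford (\<nu> + 1) (- (z\<^sup>2) / 4)) (at z)"
  by (rule DERIV_cong[OF DERIV_chain2[OF has_field_derivative_bessel_clifford[OF assms]]])
     (auto intro!: derivative_eq_intros)

lemma powr_deriv:
  assumes "z > 0"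
  shows "((\<lambda>z. z powr p) has_real_derivative p / z * z powr p) (at z)"
  using has_real_derivative_powr[OF assms, of p] assms by (simp add: powr_diff)

lemma has_real_derivative_bessel_w:
  assumes "\<nu> > 0" "z > 0"
  shows "(bessel_w \<nu> has_real_derivative bessel_dw \<nu> z) (at z)"
proof (rule has_field_derivative_transform_within_open[where S = "{0<..}"])
  show "((\<lambda>z. 2 powr (-\<nu>) * z powr (\<nu> + 1/2) * bessel_clifford \<nu> (- (z\<^sup>2) / 4))
      has_real_derivative bessel_dw \<nu> z) (at z)"
    by (rule derivative_eq_intros powr_deriv bessel_clifford_comp_deriv assms refl)+
       (simp add: bessel_dw_def algebra_simps)
qed (use assms in \<open>auto simp: bessel_w_eq\<close>)

text \<open>Differentiation produces the Clifford functions \<open>F0\<close>, \<open>F1\<close>,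
  \<open>F2\<close> of three consecutive orders at the same point; the recurrence eliminates
  \<open>F2\<close>, after which \<open>F1\<close> cancels as well and only a multiple of
  \<open>F0\<close>, that is of \<open>bessel_w\<close>, remains.\<close>

lemma has_real_derivative_bessel_dw:
  assumes "\<nu> > 0" "z > 0"
  shows "(bessel_dw \<nu> has_real_derivative - (1 - (\<nu>\<^sup>2 - 1/4) / z\<^sup>2) * bessel_w \<nu> z) (at z)"
proof -
  define F0 where "F0 = bessel_clifford \<nu> (- (z\<^sup>2) / 4)"
  define F1 where "F1 = bessel_clifford (\<nu> + 1) (- (z\<^sup>2) / 4)"
  define F2 where "F2 = bessel_clifford (\<nu> + 2) (- (z\<^sup>2) / 4)"
  define P where "P = 2 powr (-\<nu>) * z powr (\<nu> + 1/2)"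
  have F1': "((\<lambda>z::real. bessel_clifford (\<nu> + 1) (- (z\<^sup>2) / 4)) has_real_derivative - (z / 2) * F2)
      (at z)"
    using bessel_clifford_comp_deriv[of "\<nu> + 1" z] assms by (simp add: F2_def add.assoc)
  have F0': "((\<lambda>z::real. bessel_clifford \<nu> (- (z\<^sup>2) / 4)) has_real_derivative - (z / 2) * F1) (at z)"
    using bessel_clifford_comp_deriv[of "\<nu>" z] assms by (simp add: F1_def)
  have P': "((\<lambda>z. 2 powr (-\<nu>) * z powr (\<nu> + 1/2)) has_real_derivative (\<nu> + 1/2) / z * P) (at z)"
    using DERIV_cmult[OF powr_deriv[OF assms(2), of "\<nu> + 1/2"], of "2 powr (-\<nu>)"]
        by (simp add: P_def mult_ac)
  have "F0 = - (z\<^sup>2) / 4 * F2 + (\<nu> + 1) * F1"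
    using bessel_clifford_recurrence[OF assms(1), of "- (z\<^sup>2) / 4"] by (simp add: F0_def F1_def F2_def)
  then have F0: "z\<^sup>2 / 4 * F2 = (\<nu> + 1) * F1 - F0" by simp
  have eq: "(\<nu> + 1/2) / z * P * ((\<nu> + 1/2) / z * F0 - z / 2 * F1) +
      (- ((\<nu> + 1/2) / z\<^sup>2) * F0 + - (z / 2) * F1 * ((\<nu> + 1/2) / z) -
          (1 / 2 * F1 + - (z / 2) * F2 * (z / 2))) * P
     = - (1 - (\<nu>\<^sup>2 - 1/4) / z\<^sup>2) * (P * F0)" (is "?l = ?r")
  proof -
    have "?l = P * ((\<nu>\<^sup>2 - 1/4) / z\<^sup>2 * F0 - (\<nu> + 1) * F1 + z\<^sup>2 / 4 * F2)"
      using assms(2) by (simp add: field_simps power2_eq_square)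
    also have "\<dots> = ?r"
      unfolding F0 by (simp add: algebra_simps)
    finally show ?thesis .
  qed
  have "((\<lambda>z. (\<nu> + 1/2) / z) has_real_derivative - ((\<nu> + 1/2) / z\<^sup>2)) (at z)"
    using assms(2) by (auto intro!: derivative_eq_intros simp: power2_eq_square divide_simps)
  from DERIV_mult[OF this F0']
  have "((\<lambda>z. (\<nu> + 1/2) / z * bessel_clifford \<nu> (- (z\<^sup>2) / 4)) has_real_derivative
      - ((\<nu> + 1/2) / z\<^sup>2) * F0 + - (z / 2) * F1 * ((\<nu> + 1/2) / z)) (at z)"
    by (simp only: F0_def)
  moreover have "((\<lambda>z. z / 2 * bessel_clifford (\<nu> + 1) (- (z\<^sup>2) / 4)) has_real_derivative
      1 / 2 * F1 + - (z / 2) * F2 * (z / 2)) (at z)"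
    unfolding F1_def
    by (intro DERIV_mult F1') (auto intro!: derivative_eq_intros)
  ultimately have "((\<lambda>z. (\<nu> + 1/2) / z * bessel_clifford \<nu> (- (z\<^sup>2) / 4) - z / 2
      * bessel_clifford (\<nu> + 1) (- (z\<^sup>2) / 4)) has_real_derivative
      - ((\<nu> + 1/2) / z\<^sup>2) * F0 + - (z / 2) * F1 * ((\<nu> + 1/2) / z) -
          (1 / 2 * F1 + - (z / 2) * F2 * (z / 2))) (at z)"
    by (rule DERIV_diff)
  from DERIV_mult[OF P' this] show ?thesis
    unfolding bessel_dw_def[abs_def] bessel_w_eq[OF assms] F0_def[symmetric] F1_def[symmetric]
        P_def[symmetric] eq .
qed

lemma bessel_w_bounded_unit:
  assumes "\<nu> > 0" "0 < z" "z \<le> 1"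
  shows "\<bar>bessel_w \<nu> z\<bar> \<le> bessel_clifford \<nu> 1"
proof -
  have "\<bar>bessel_clifford \<nu> (- (z\<^sup>2) / 4)\<bar> \<le> bessel_clifford \<nu> (norm (- (z\<^sup>2) / 4))"
    using norm_bessel_clifford_le[OF assms(1), of "- (z\<^sup>2) / 4"] by simp
  also have "\<dots> \<le> bessel_clifford \<nu> 1"
    using assms power_le_one[of z 2] by (intro bessel_clifford_mono) auto
  finally have "\<bar>bessel_clifford \<nu> (- (z\<^sup>2) / 4)\<bar> \<le> bessel_clifford \<nu> 1" .
  moreover have "2 powr (-\<nu>) * z powr (\<nu> + 1/2) \<le> 1"
    using assms by (intro mult_le_one) (auto simp: powr_minus inverse_le_1_iff ge_one_powr_ge_zero
        intro!: powr_le1)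
  ultimately show ?thesis
    unfolding bessel_w_eq[OF assms(1,2)] abs_mult
    using mult_mono[of "2 powr (-\<nu>) * z powr (\<nu> + 1/2)" 1 "\<bar>bessel_clifford \<nu> (- (z\<^sup>2) / 4)\<bar>"
        "bessel_clifford \<nu> 1"]
    by (simp add: abs_mult)
qed

text \<open>The energy \<open>E = w\<^sup>2 + w'\<^sup>2\<close> times \<open>exp (\<bar>c\<bar> / z)\<close> decreases and times \<open>exp (- \<bar>c\<bar> / z)\<close> increases, which
  bounds \<open>E\<close> above and away from \<open>0\<close>. The amplitude \<open>exp (i z) (w' - i w)\<close> has derivative of order
  \<open>1 / z\<^sup>2\<close> and modulus \<open>\<surd>E\<close>, so it converges to a nonzero limit.\<close>

lemma perturbed_oscillator_asymptotics:
  fixes w dw :: "real \<Rightarrow> real"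
  assumes w: "\<And>z. z > 0 \<Longrightarrow> (w has_real_derivative dw z) (at z)"
    and dw: "\<And>z. z > 0 \<Longrightarrow> (dw has_real_derivative - (1 - c / z\<^sup>2) * w z) (at z)"
    and nz: "z1 > 0" "w z1 \<noteq> 0"
  obtains l :: complex and K B :: real where "l \<noteq> 0" "K \<ge> 0"
    "\<And>z. z \<ge> 1 \<Longrightarrow> \<bar>w z + Im (cis (- z) * l)\<bar> \<le> K / z" "\<And>z. z \<ge> 1 \<Longrightarrow> \<bar>w z\<bar> \<le> B"
proof -
  define E where "E z = (w z)\<^sup>2 + (dw z)\<^sup>2" for z
  define dE where "dE z = 2 * c * w z * dw z / z\<^sup>2" for z
  have E': "(E has_real_derivative dE z) (at z)" if "z > 0" for z
    unfolding E_def[abs_def] by (rule derivative_eq_intros w dw that refl)+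
        (use that in \<open>simp add: dE_def field_simps\<close>)
  have dE: "\<bar>dE z\<bar> \<le> \<bar>c\<bar> / z\<^sup>2 * E z" for z
  proof -
    have "2 * \<bar>w z\<bar> * \<bar>dw z\<bar> \<le> E z"
      using sum_squares_bound[of "\<bar>w z\<bar>" "\<bar>dw z\<bar>"] by (simp add: E_def)
    then have "\<bar>c\<bar> / z\<^sup>2 * (2 * \<bar>w z\<bar> * \<bar>dw z\<bar>) \<le> \<bar>c\<bar> / z\<^sup>2 * E z"
      by (intro mult_left_mono) auto
    then show ?thesis by (simp add: dE_def abs_mult mult_ac)
  qed
  have exp': "((\<lambda>z. exp (k / z)) has_real_derivative - (k / z\<^sup>2) * exp (k / z)) (at z)" if "z > 0"
      for k z :: real
    using that by (auto intro!: derivative_eq_intros simp: power2_eq_square)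
  have up: "E y * exp (\<bar>c\<bar> / y) \<le> E x * exp (\<bar>c\<bar> / x)" if "0 < x" "x \<le> y" for x y
  proof (rule DERIV_nonpos_imp_nonincreasing[OF that(2)])
    fix z assume "x \<le> z" "z \<le> y"
    then have z: "z > 0" using that by simp
    have "(dE z - \<bar>c\<bar> / z\<^sup>2 * E z) * exp (\<bar>c\<bar> / z) \<le> 0"
      using dE[of z] by (intro mult_nonpos_nonneg) auto
    then show "\<exists>y. ((\<lambda>z. E z * exp (\<bar>c\<bar> / z)) has_real_derivative y) (at z) \<and> y \<le> 0"
      using DERIV_mult[OF E'[OF z] exp'[OF z, of "\<bar>c\<bar>"]] by (auto simp: algebra_simps intro!: exI)
  qed
  have lo: "E x * exp (- \<bar>c\<bar> / x) \<le> E y * exp (- \<bar>c\<bar> / y)" if "0 < x" "x \<le> y" for x y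
  proof (rule DERIV_nonneg_imp_nondecreasing[OF that(2)])
    fix z assume "x \<le> z" "z \<le> y"
    then have z: "z > 0" using that by simp
    have "(dE z + \<bar>c\<bar> / z\<^sup>2 * E z) * exp (- \<bar>c\<bar> / z) \<ge> 0"
      using dE[of z] by (intro mult_nonneg_nonneg) auto
    then show "\<exists>y. ((\<lambda>z. E z * exp (- \<bar>c\<bar> / z)) has_real_derivative y) (at z) \<and> 0 \<le> y"
      using DERIV_mult[OF E'[OF z] exp'[OF z, of "- \<bar>c\<bar>"]] by (auto simp: algebra_simps intro!: exI)
  qed
  define B where "B = sqrt (E 1 * exp \<bar>c\<bar>)"
  have EB: "E z \<le> E 1 * exp \<bar>c\<bar>" if "z \<ge> 1" for z
  proof -
    have "E z * 1 \<le> E z * exp (\<bar>c\<bar> / z)" using that by (intro mult_left_mono) (auto simp: E_def)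
    also have "\<dots> \<le> E 1 * exp \<bar>c\<bar>" using up[of 1 z] that by simp
    finally show ?thesis by simp
  qed
  have wB: "\<bar>w z\<bar> \<le> B" if "z \<ge> 1" for z
    unfolding B_def using EB[OF that] by (intro real_le_rsqrt)
        (auto simp: E_def intro: order_trans[rotated])
  \<comment> \<open>Constant for the unperturbed oscillator \<open>w'' = - w\<close>. Hence its
    derivative contains the perturbation \<open>c / z^2 * w\<close> alone, whose integral over
    \<open>[x, y]\<close> is at most \<open>K / x - K / y\<close>.\<close>
  define L where "L z = cis z * (of_real (dw z) - \<i> * of_real (w z))" for z
  have L': "(L has_vector_derivative cis z * of_real (c / z\<^sup>2 * w z)) (at z)" if "z > 0" for z
  proof -
    note w[OF that, THEN has_vector_derivative_of_real, where 'a = complex]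
      dw[OF that, THEN has_vector_derivative_of_real, where 'a = complex]
    then have "(L has_vector_derivative (cis z * (of_real (- (1 - c / z\<^sup>2) * w z) - \<i> * of_real (dw z))
         + (\<i> * cis z) * (of_real (dw z) - \<i> * of_real (w z)))) (at z)"
      unfolding L_def[abs_def]
      by (intro has_vector_derivative_mult has_vector_derivative_diff has_vector_derivative_mult_right)
         (auto simp: has_vector_derivative_def intro!: derivative_eq_intros simp: scaleR_conv_of_real)
    then show ?thesis by (simp add: algebra_simps)
  qed
  define K where "K = \<bar>c\<bar> * B"
  have LK: "norm (L y - L x) \<le> K / x - K / y" if "1 \<le> x" "x \<le> y" for x y
  proof (cases "x = y")
    case False
    have "norm (L y - L x) \<le> - (K / y) - - (K / x)"
    proof (rule differentiable_bound_general[where \<phi>' = "\<lambda>z. K / z\<^sup>2" and f' = "\<lambda>z. cis z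
        * of_real (c / z\<^sup>2 * w z)"])
      show "x < y" using False that by simp
      show "continuous_on {x..y} L"
        using that by (intro continuous_at_imp_continuous_on ballI
            has_vector_derivative_continuous[OF L']) auto
      show "continuous_on {x..y} (\<lambda>z. - (K / z))" using that by (auto intro!: continuous_intros)
      show "((\<lambda>z. - (K / z)) has_vector_derivative K / z\<^sup>2) (at z)" if "x < z" "z < y" for z
        unfolding has_real_derivative_iff_has_vector_derivative[symmetric]
        using that \<open>1 \<le> x\<close> by (auto intro!: derivative_eq_intros simp: power2_eq_square)
      show "norm (cis z * of_real (c / z\<^sup>2 * w z)) \<le> K / z\<^sup>2" if "x < z" "z < y" for z
        using mult_left_mono[OF wB[of z], of "\<bar>c\<bar>"] that \<open>1 \<le> x\<close>
        by (simp add: K_def norm_mult abs_mult norm_divide norm_power divide_right_mono)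
      show "(L has_vector_derivative cis z * of_real (c / z\<^sup>2 * w z)) (at z)" if "x < z" for z
        using that \<open>1 \<le> x\<close> by (intro L') auto
    qed
    then show ?thesis by simp
  qed auto
  have B0: "B \<ge> 0" by (simp add: B_def E_def)
  then have K0: "K \<ge> 0" by (simp add: K_def)
  have "Cauchy (\<lambda>n. L (real (Suc n)))"
  proof (rule CauchyI)
    fix e :: real assume e: "e > 0"
    obtain M where M: "real M > K / e" using reals_Archimedean2 by blast
    have *: "norm (L (real (Suc n)) - L (real (Suc m))) < e" if "M \<le> m" "m \<le> n" for m n
    proof -
      have "norm (L (real (Suc n)) - L (real (Suc m))) \<le> K / real (Suc m) - K / real (Suc n)"
        using that by (intro LK) auto
      also have "\<dots> \<le> K / real (Suc m)" using K0 by simp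
      also have "\<dots> < e"
      proof -
        have "K / e < real (Suc m)" using M that by linarith
        then show ?thesis using e by (simp add: field_simps)
      qed
      finally show ?thesis .
    qed
    show "\<exists>M. \<forall>m\<ge>M. \<forall>n\<ge>M. norm (L (real (Suc m)) - L (real (Suc n))) < e"
      by (intro exI[of _ M] allI impI) (metis * norm_minus_commute linear)
  qed
  then obtain l where l: "(\<lambda>n. L (real (Suc n))) \<longlonglongrightarrow> l" using Cauchy_convergent_iff convergent_def
      by blast
  have Ll: "norm (L z - l) \<le> K / z" if "z \<ge> 1" for z
  proof -
    have "(\<lambda>n. norm (L (real (Suc n)) - L z)) \<longlonglongrightarrow> norm (l - L z)" using l by (intro tendsto_intros)
    moreover have "\<forall>\<^sub>F n in sequentially. norm (L (real (Suc n)) - L z) \<le> K / z"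
    proof -
      obtain M where M: "real M > z" using reals_Archimedean2 by blast
      have "norm (L (real (Suc n)) - L z) \<le> K / z" if "n \<ge> M" for n
        using LK[of z "real (Suc n)"] that M \<open>z \<ge> 1\<close> K0 by (auto intro: order_trans)
      then show ?thesis by (auto simp: eventually_sequentially)
    qed
    ultimately have "norm (l - L z) \<le> K / z" by (intro tendsto_upperbound) auto
    then show ?thesis by (simp add: norm_minus_commute)
  qed
  have nL: "(norm (L z))\<^sup>2 = E z" for z
    unfolding L_def norm_mult norm_cis by (simp add: cmod_power2 E_def)
  have "l \<noteq> 0"
  proof
    assume "l = 0"
    then have 1: "(\<lambda>n. (norm (L (real (Suc n))))\<^sup>2) \<longlonglongrightarrow> 0\<^sup>2" using tendsto_norm[OF l]
        by (intro tendsto_intros) simp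
    \<comment> \<open>By \<open>lo\<close>, the energy present at the single point \<open>z1\<close>
      can never fall below this positive value again.\<close>
    define T where "T = E z1 * exp (- \<bar>c\<bar> / z1)"
    have "T \<le> E z" if "z \<ge> z1" for z
    proof -
      have "T \<le> E z * exp (- \<bar>c\<bar> / z)" using lo[OF nz(1) that] by (simp add: T_def)
      also have "\<dots> \<le> E z * 1" using that nz by (intro mult_left_mono) (auto simp: E_def)
      finally show ?thesis by simp
    qed
    moreover obtain M where M: "real M > z1" using reals_Archimedean2 by blast
    ultimately have "\<forall>\<^sub>F n in sequentially. T \<le> (norm (L (real (Suc n))))\<^sup>2"
      unfolding nL by (auto simp: eventually_sequentially intro!: exI[of _ M])
    with 1 have "T \<le> 0\<^sup>2" by (rule tendsto_lowerbound) auto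
    moreover have "T > 0" using nz by (simp add: T_def E_def add_pos_nonneg)
    ultimately show False by simp
  qed
  moreover have "\<bar>w z + Im (cis (- z) * l)\<bar> \<le> K / z" if "z \<ge> 1" for z
  proof -
    have "cis (- z) * L z = of_real (dw z) - \<i> * of_real (w z)"
      by (simp add: L_def mult.assoc[symmetric] cis_mult)
    then have "w z + Im (cis (- z) * l) = Im (cis (- z) * (l - L z))"
      by (simp add: right_diff_distrib)
    also have "\<bar>\<dots>\<bar> \<le> norm (cis (- z) * (l - L z))" by (rule abs_Im_le_cmod)
    also have "\<dots> = norm (L z - l)" by (simp add: norm_mult norm_minus_commute)
    finally show ?thesis using Ll[OF that] by simp
  qed
  ultimately show ?thesis by (intro that[of l K B] K0 wB)
qed

text \<open>Near the origin the Clifford factor is close to its positive constant term. One such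
  point excludes the trivial solution and so keeps the limiting amplitude away from zero.\<close>

lemma bessel_w_nonzero:
  assumes "\<nu> > 0" obtains z where "z > 0" "bessel_w \<nu> z \<noteq> 0"
proof -
  have "continuous_on UNIV (\<lambda>z::real. bessel_clifford \<nu> (- (z\<^sup>2) / 4))"
    using bessel_clifford_comp_deriv[OF assms] by (meson DERIV_isCont continuous_at_imp_continuous_on)
  then have c: "isCont (\<lambda>z::real. bessel_clifford \<nu> (- (z\<^sup>2) / 4)) 0"
      by (simp add: continuous_on_eq_continuous_at)
  have "bessel_clifford \<nu> (0::real) = bessel_coeff \<nu> 0"
    unfolding bessel_clifford_def by (subst suminf_finite[of "{0}"]) auto
  then have "bessel_clifford \<nu> (0::real) > 0" using bessel_coeff_pos[OF assms] by simp
  with c have "\<forall>\<^sub>F z in at (0::real). bessel_clifford \<nu> (- (z\<^sup>2) / 4) > 0"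
    unfolding isCont_def by (intro order_tendstoD(1)) auto
  then obtain d where d: "d > 0" "\<And>z. z \<noteq> 0 \<Longrightarrow> dist z 0 < d
      \<Longrightarrow> bessel_clifford \<nu> (- (z\<^sup>2) / 4) > (0::real)"
    unfolding eventually_at by blast
  then have "bessel_clifford \<nu> (- ((d/2)\<^sup>2) / 4) > 0" by (auto simp: dist_norm)
  then have "bessel_w \<nu> (d/2) \<noteq> 0" using bessel_w_eq[OF assms, of "d/2"] d(1) by simp
  then show ?thesis using that[of "d/2"] d(1) by simp
qed

text \<open>The complex number \<open>l\<close> packs modulus and phase shift of the limiting
  cosine; \<open>l \<noteq> 0\<close> is what later makes the stationary half of the cosine
  dominate.\<close>

lemma bessel_w_asymptotics:
  assumes "\<nu> > 0"
  obtains l :: complex and K B :: real where "l \<noteq> 0" "K \<ge> 0"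
    "\<And>z. z \<ge> 1 \<Longrightarrow> \<bar>bessel_w \<nu> z + Im (cis (- z) * l)\<bar> \<le> K / z"
    "\<And>z. z \<ge> 1 \<Longrightarrow> \<bar>bessel_w \<nu> z\<bar> \<le> B"
proof -
  obtain z where z: "z > 0" "bessel_w \<nu> z \<noteq> 0" using bessel_w_nonzero[OF assms] .
  show ?thesis
  proof (rule perturbed_oscillator_asymptotics[where w = "bessel_w \<nu>" and dw = "bessel_dw \<nu>" and c
      = "\<nu>\<^sup>2 - 1/4"])
    show "(bessel_w \<nu> has_real_derivative bessel_dw \<nu> z) (at z)" if "z > 0" for z
      by (rule has_real_derivative_bessel_w[OF assms that])
    show "(bessel_dw \<nu> has_real_derivative - (1 - (\<nu>\<^sup>2 - 1/4) / z\<^sup>2) * bessel_w \<nu> z) (at z)" if "z > 0"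
        for z
      by (rule has_real_derivative_bessel_dw[OF assms that])
    show "z > 0" "bessel_w \<nu> z \<noteq> 0" by fact+
  qed (rule that)
qed

lemma bessel_w_bounded:
  assumes "\<nu> > 0"
  obtains B where "B \<ge> 0" "\<And>z. z > 0 \<Longrightarrow> \<bar>bessel_w \<nu> z\<bar> \<le> B"
proof -
  obtain B where B: "\<And>z. z \<ge> 1 \<Longrightarrow> \<bar>bessel_w \<nu> z\<bar> \<le> B"
    by (rule bessel_w_asymptotics[OF assms]) (rule that)
  have "\<bar>bessel_w \<nu> z\<bar> \<le> \<bar>B\<bar> + \<bar>bessel_clifford \<nu> 1\<bar>" if "z > 0" for z
    using bessel_w_bounded_unit[OF assms that] B[of z] by linarith
  then show ?thesis using that[of "\<bar>B\<bar> + \<bar>bessel_clifford \<nu> 1\<bar>"] by simp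
qed

section \<open>Weber's second exponential integral\<close>

text \<open>After multiplication by \<open>A\<close> this is the Vandermonde convolution of the
  binomials \<open>m\<close> over \<open>j\<close> and \<open>k + \<nu>\<close> over
  \<open>k - j\<close>, the second with a real upper index.\<close>

lemma bessel_coeff_Vandermonde:
  assumes "\<nu> > 0"
  shows "(\<Sum>j\<in>{j. j \<le> m \<and> j \<le> k}. bessel_coeff \<nu> j / (fact (m - j) * fact (k - j)))
     = Gamma (real (m + k) + \<nu> + 1) * bessel_coeff \<nu> m * bessel_coeff \<nu> k"
proof -
  have G: "Gamma (real i + \<nu> + 1) > 0" for i using assms by (simp add: Gamma_real_pos)
  define A where "A = fact m * Gamma (real k + \<nu> + 1)"
  have A: "A > 0" using G[of k] by (simp add: A_def)
  have 1: "((real k + \<nu>) gchoose (k - j)) = Gamma (real k + \<nu> + 1) /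
      (fact (k - j) * Gamma (real j + \<nu> + 1))" if "j \<le> k" for j
  proof -
    have "real k + \<nu> + 1 \<notin> \<int>\<^sub>\<le>\<^sub>0" using assms by (auto simp: nonpos_Ints_def)
    moreover have "real k + \<nu> - of_nat (k - j) + 1 = real j + \<nu> + 1" using that
        by (simp add: of_nat_diff)
    ultimately show ?thesis using gbinomial_Gamma[of "real k + \<nu>" "k - j"] by (simp add: add_ac)
  qed
  have 2: "((real m + (real k + \<nu>)) gchoose k) = Gamma (real (m + k) + \<nu> + 1) /
      (fact k * Gamma (real m + \<nu> + 1))"
  proof -
    have "real m + (real k + \<nu>) + 1 \<notin> \<int>\<^sub>\<le>\<^sub>0" using assms by (auto simp: nonpos_Ints_def)
    moreover have "real m + (real k + \<nu>) - of_nat k + 1 = real m + \<nu> + 1" "real m + (real k + \<nu>) + 1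
        = real (m + k) + \<nu> + 1" by simp_all
    ultimately show ?thesis by (metis gbinomial_Gamma)
  qed
  have "(\<Sum>j\<in>{j. j \<le> m \<and> j \<le> k}. bessel_coeff \<nu> j / (fact (m - j) * fact (k - j)))
     = (\<Sum>j\<in>{j. j \<le> m \<and> j \<le> k}. (real m gchoose j) * ((real k + \<nu>) gchoose (k - j)) / A)"
  proof (rule sum.cong[OF refl])
    fix j assume j: "j \<in> {j. j \<le> m \<and> j \<le> k}"
    have "(real m gchoose j) = fact m / (fact j * fact (m - j))"
      using j by (simp add: binomial_gbinomial[symmetric] binomial_fact)
    then show "bessel_coeff \<nu> j / (fact (m - j) * fact (k - j)) = (real m gchoose j)
        * ((real k + \<nu>) gchoose (k - j)) / A"
      using j G[of j] G[of k] by (simp add: 1 A_def bessel_coeff_def)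
  qed
  \<comment> \<open>Indices \<open>j > m\<close> contribute nothing, because \<open>m\<close> over
    \<open>j\<close> is then zero.\<close>
  also have "\<dots> = (\<Sum>j\<in>{0..k}. (real m gchoose j) * ((real k + \<nu>) gchoose (k - j)) / A)"
    by (rule sum.mono_neutral_left) (auto simp: binomial_gbinomial[symmetric])
  also have "\<dots> = Gamma (real (m + k) + \<nu> + 1) / (fact k * Gamma (real m + \<nu> + 1)) / A"
    by (simp only: sum_divide_distrib[symmetric] gbinomial_Vandermonde 2)
  also have "\<dots> = Gamma (real (m + k) + \<nu> + 1) * bessel_coeff \<nu> m * bessel_coeff \<nu> k"
    by (simp add: A_def bessel_coeff_def)
  finally show ?thesis .
qed

text \<open>The left side is the part of total degree \<open>M\<close> in
  \<open>bessel_clifford \<nu> (x * y) * exp (x + y)\<close>, where \<open>x * y\<close> counts with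
  degree 2. Comparing the coefficients of each monomial \<open>x ^ m * y ^ (M - m)\<close> leaves
  exactly the Vandermonde sum.\<close>

lemma bessel_coeff_convolution:
  fixes x y :: "'a::{real_normed_field,banach}"
  assumes "\<nu> > 0"
  shows "(\<Sum>j | 2 * j \<le> M. of_real (bessel_coeff \<nu> j) * (x * y) ^ j
      * ((x + y) ^ (M - 2 * j) /\<^sub>R fact (M - 2 * j)))
    = of_real (Gamma (real M + \<nu> + 1)) * (\<Sum>m\<le>M. of_real (bessel_coeff \<nu> m * bessel_coeff \<nu> (M - m))
        * x ^ m * y ^ (M - m))"
proof -
  have fin: "finite {j. 2 * j \<le> M}" by (rule finite_subset[of _ "{..M}"]) auto
  have bin: "(x + y) ^ n /\<^sub>R fact n = (\<Sum>p\<le>n. (1 / (fact p * fact (n - p))) *\<^sub>R (x ^ p * y ^ (n - p)))"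
      for n
    unfolding binomial_ring scaleR_sum_right
  proof (rule sum.cong[OF refl])
    fix p assume "p \<in> {..n}"
    then have "real (n choose p) = fact n / (fact p * fact (n - p))" by (simp add: binomial_fact)
    then have "inverse (fact n) * real (n choose p) = 1 / (fact p * fact (n - p))"
        by (simp add: field_simps)
    moreover have "of_nat (n choose p) * x ^ p * y ^ (n - p) = real (n choose p)
        *\<^sub>R (x ^ p * y ^ (n - p))"
      by (simp add: scaleR_conv_of_real mult.assoc)
    ultimately show "(of_nat (n choose p) * x ^ p * y ^ (n - p)) /\<^sub>R fact n
        = (1 / (fact p * fact (n - p))) *\<^sub>R (x ^ p * y ^ (n - p))"
      by simp
  qed
  define g where "g m j = (bessel_coeff \<nu> j / (fact (m - j) * fact (M - m - j)))
      *\<^sub>R (x ^ m * y ^ (M - m))" for m j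
  have "(\<Sum>j | 2 * j \<le> M. of_real (bessel_coeff \<nu> j) * (x * y) ^ j
      * ((x + y) ^ (M - 2 * j) /\<^sub>R fact (M - 2 * j)))
     = (\<Sum>j | 2 * j \<le> M. \<Sum>p\<le>M - 2 * j. g (p + j) j)"
    unfolding bin sum_distrib_left
  proof (intro sum.cong[OF refl])
    fix j p assume "j \<in> {j. 2 * j \<le> M}" "p \<in> {..M - 2 * j}"
    then have "M - 2 * j - p = M - (p + j) - j" "M - (p + j) = j + (M - 2 * j - p)" by auto
    then show "of_real (bessel_coeff \<nu> j) * (x * y) ^ j
        * ((1 / (fact p * fact (M - 2 * j - p))) *\<^sub>R (x ^ p * y ^ (M - 2 * j - p)))
      = g (p + j) j"
      by (simp add: g_def power_mult_distrib power_add scaleR_conv_of_real mult_ac)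
  qed
  also have "\<dots> = (\<Sum>(j, p)\<in>(SIGMA j:{j. 2 * j \<le> M}. {..M - 2 * j}). g (p + j) j)"
    by (rule sum.Sigma) (use fin in auto)
  \<comment> \<open>With \<open>j\<close> factors \<open>x * y\<close> and \<open>p\<close> further
    factors \<open>x\<close>, the exponent of \<open>x\<close> is \<open>m = p + j\<close>; the sum
    is regrouped by \<open>m\<close>.\<close>
  also have "\<dots> = (\<Sum>(m, j)\<in>(SIGMA m:{..M}. {j. j \<le> m \<and> j \<le> M - m}). g m j)"
    by (rule sum.reindex_bij_witness[where i = "\<lambda>(m, j). (j, m - j)" and j = "\<lambda>(j, p). (p + j, j)"])
        auto
  also have "\<dots> = (\<Sum>m\<le>M. \<Sum>j\<in>{j. j \<le> m \<and> j \<le> M - m}. g m j)"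
    by (rule sum.Sigma[symmetric]) auto
  also have "\<dots> = (\<Sum>m\<le>M. (Gamma (real M + \<nu> + 1) * bessel_coeff \<nu> m * bessel_coeff \<nu> (M - m))
      *\<^sub>R (x ^ m * y ^ (M - m)))"
  proof (rule sum.cong[OF refl])
    fix m assume "m \<in> {..M}"
    then show "(\<Sum>j\<in>{j. j \<le> m \<and> j \<le> M - m}. g m j) =
        (Gamma (real M + \<nu> + 1) * bessel_coeff \<nu> m * bessel_coeff \<nu> (M - m)) *\<^sub>R (x ^ m * y ^ (M - m))"
      using bessel_coeff_Vandermonde[OF assms, of m "M - m"]
          by (simp add: g_def scaleR_sum_left[symmetric])
  qed
  also have "\<dots> = of_real (Gamma (real M + \<nu> + 1)) *
      (\<Sum>m\<le>M. of_real (bessel_coeff \<nu> m * bessel_coeff \<nu> (M - m)) * x ^ m * y ^ (M - m))"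
    by (simp add: sum_distrib_left scaleR_conv_of_real mult.assoc)
  finally show ?thesis .
qed

text \<open>The algebraic core of Weber's formula: the factor \<open>Gamma (M + \<nu> + 1)\<close>
  on the left is what a Gaussian moment will contribute to the \<open>M\<close>-th term of a product
  of two Bessel functions.\<close>

lemma bessel_clifford_exp_sums:
  fixes x y :: "'a::{real_normed_field,banach}"
  assumes "\<nu> > 0"
  shows "(\<lambda>M. of_real (Gamma (real M + \<nu> + 1)) * (\<Sum>m\<le>M. of_real
      (bessel_coeff \<nu> m * bessel_coeff \<nu> (M - m)) * x ^ m * y ^ (M - m)))
    sums (bessel_clifford \<nu> (x * y) * exp (x + y))"
proof -
  \<comment> \<open>The powers of \<open>x * y\<close> are placed at even indices, so that the
    Cauchy product with the exponential series is graded by total degree.\<close>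
  define a where "a i = (if even i then of_real (bessel_coeff \<nu> (i div 2))
      * (x * y) ^ (i div 2) else 0)" for i
  define b where "b i = (x + y) ^ i /\<^sub>R fact i" for i
  have sm: "strict_mono (\<lambda>n::nat. 2 * n)" by (simp add: strict_mono_def)
  have z: "i \<notin> range ((*) 2) \<Longrightarrow> a i = 0" for i by (auto simp: a_def elim!: evenE)
  have a2: "a (2 * j) = of_real (bessel_coeff \<nu> j) * (x * y) ^ j" for j by (simp add: a_def)
  have sa: "(\<Sum>i. a i) = bessel_clifford \<nu> (x * y)"
    using suminf_mono_reindex[OF sm, of a, OF z] by (simp add: bessel_clifford_def a2)
  have "summable (\<lambda>i. norm (a i))"
    using summable_mono_reindex[OF sm, of "\<lambda>i. norm (a i)"] z
        summable_norm_bessel_clifford[OF assms, of "x * y"]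
    by (simp add: a_def)
  moreover have "summable (\<lambda>i. norm (b i))"
    using summable_norm_exp[of "x + y"] by (simp add: b_def)
  ultimately have "(\<lambda>M. \<Sum>i\<le>M. a i * b (M - i)) sums ((\<Sum>i. a i) * (\<Sum>i. b i))"
    by (rule Cauchy_product_sums)
  moreover note sa
  moreover have "(\<Sum>i. b i) = exp (x + y)" by (simp add: b_def exp_def)
  moreover have "(\<Sum>i\<le>M. a i * b (M - i)) = (\<Sum>j | 2 * j \<le> M. of_real (bessel_coeff \<nu> j) * (x * y) ^ j
      * ((x + y) ^ (M - 2 * j) /\<^sub>R fact (M - 2 * j)))" for M
  proof -
    have "(\<Sum>i\<le>M. a i * b (M - i)) = (\<Sum>i\<in>(*) 2 ` {j. 2 * j \<le> M}. a i * b (M - i))"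
      by (rule sum.mono_neutral_right) (auto simp: a_def elim!: evenE)
    also have "\<dots> = (\<Sum>j | 2 * j \<le> M. a (2 * j) * b (M - 2 * j))"
      by (subst sum.reindex) (auto simp: inj_on_def)
    finally show ?thesis by (simp add: a_def b_def)
  qed
  ultimately show ?thesis unfolding bessel_coeff_convolution[OF assms] by simp
qed

section \<open>Gaussian moments on the half line\<close>

lemma set_integrable_complex_of_real:
  "set_integrable M A f \<Longrightarrow> set_integrable M A (\<lambda>x. complex_of_real (f x))"
  unfolding set_integrable_def by (drule integrable_of_real[where 'a = complex])
      (simp add: scaleR_conv_of_real)

text \<open>Euler's integral for \<open>Gamma q\<close> under the substitution
  \<open>t = e * \<rho>^2\<close>; the Jacobian accounts for the exponent
  \<open>2 * q - 1\<close>.\<close>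

lemma gaussian_moment_real:
  fixes q e :: real
  assumes "q > 0" "e > 0"
  shows "set_integrable lborel {0<..} (\<lambda>\<rho>. \<rho> powr (2 * q - 1) * exp (- (e * \<rho>\<^sup>2)))"
      (is "set_integrable _ _ ?F")
    and "(LINT \<rho>:{0<..}|lborel. \<rho> powr (2 * q - 1) * exp (- (e * \<rho>\<^sup>2))) = Gamma q * e powr (- q) / 2"
proof -
  define f where "f t = t powr (q - 1) / exp t" for t :: real
  define c where "c = 2 * e powr q"
  have c: "c \<noteq> 0" using assms by (simp add: c_def)
  have img: "(\<lambda>\<rho>::real. e * \<rho>\<^sup>2) ` {0<..} = {0<..}"
  proof (intro equalityI subsetI)
    fix y :: real assume "y \<in> {0<..}"
    then show "y \<in> (\<lambda>\<rho>. e * \<rho>\<^sup>2) ` {0<..}"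
      using assms by (intro image_eqI[of _ _ "sqrt (y / e)"]) auto
  qed (use assms in auto)
  have "(f has_integral Gamma q) {0..}" using Gamma_integral_real[OF assms(1)]
      by (simp add: f_def[abs_def])
  then have f: "(f has_integral Gamma q) {0<..}"
    by (subst (asm) has_integral_spike_set_eq[where T = "{0<..}"])
        (auto intro: negligible_subset[of "{0}"])
  have "f absolutely_integrable_on {0<..}"
    using f by (intro nonnegative_absolutely_integrable_1) (auto simp: f_def has_integral_iff)
  then have *: "f absolutely_integrable_on ((\<lambda>\<rho>. e * \<rho>\<^sup>2) ` {0<..}) \<and> integral ((\<lambda>\<rho>. e * \<rho>\<^sup>2) ` {0<..})
      f = Gamma q"
    unfolding img using f by (simp add: integral_unique)
  have "inj_on (\<lambda>\<rho>::real. e * \<rho>\<^sup>2) {0<..}" using assms by (auto simp: inj_on_def power2_eq_iff)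
  moreover have "((\<lambda>\<rho>. e * \<rho>\<^sup>2) has_field_derivative 2 * e * \<rho>) (at \<rho> within {0<..})" for \<rho>
    by (auto intro!: derivative_eq_intros)
  ultimately have J: "(\<lambda>\<rho>. \<bar>2 * e * \<rho>\<bar> * f (e * \<rho>\<^sup>2)) absolutely_integrable_on {0<..} \<and>
     integral {0<..} (\<lambda>\<rho>. \<bar>2 * e * \<rho>\<bar> * f (e * \<rho>\<^sup>2)) = Gamma q"
    using * by (subst has_absolute_integral_change_of_variables_1') auto
  have eq: "\<bar>2 * e * \<rho>\<bar> * f (e * \<rho>\<^sup>2) = c * ?F \<rho>" if "\<rho> \<in> {0<..}" for \<rho>
  proof -
    have \<rho>: "\<rho> > 0" using that by simp
    have "(e * \<rho>\<^sup>2) powr (q - 1) = e powr (q - 1) * (\<rho> powr (2 * q - 1) / \<rho>)"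
    proof -
      have "(\<rho>\<^sup>2) powr (q - 1) = \<rho> powr (2 * q - 1 - 1)"
        using \<rho> by (simp add: powr_numeral[symmetric] powr_powr algebra_simps del: powr_numeral)
      also have "\<dots> = \<rho> powr (2 * q - 1) / \<rho>" using \<rho> by (simp only: powr_diff powr_one)
      finally show ?thesis using \<rho> assms by (simp add: powr_mult)
    qed
    moreover have "e * e powr (q - 1) = e powr q" using assms powr_mult_base[of e "q - 1"] by simp
    moreover have "\<bar>2 * e * \<rho>\<bar> = 2 * e * \<rho>" using assms \<rho> by simp
    ultimately have "\<bar>2 * e * \<rho>\<bar> * f (e * \<rho>\<^sup>2) = 2 * (e * e powr (q - 1))
        * (\<rho> * (\<rho> powr (2 * q - 1) / \<rho>)) / exp (e * \<rho>\<^sup>2)"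
      unfolding f_def by simp
    also have "\<dots> = c * ?F \<rho>"
      using \<rho> \<open>e * e powr (q - 1) = e powr q\<close> by (simp add: c_def exp_minus divide_inverse)
    finally show ?thesis .
  qed
  have I: "(\<lambda>\<rho>. c * ?F \<rho>) absolutely_integrable_on {0<..}" "integral {0<..} (\<lambda>\<rho>. c * ?F \<rho>) = Gamma q"
  proof -
    show "(\<lambda>\<rho>. c * ?F \<rho>) absolutely_integrable_on {0<..}"
      using J eq by (subst set_integrable_cong[OF refl refl eq[symmetric]]) auto
    have "integral {0<..} (\<lambda>\<rho>. c * ?F \<rho>) = integral {0<..} (\<lambda>\<rho>. \<bar>2 * e * \<rho>\<bar> * f (e * \<rho>\<^sup>2))"
      by (rule integral_cong) (rule eq[symmetric])
    then show "integral {0<..} (\<lambda>\<rho>. c * ?F \<rho>) = Gamma q" using J by simp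
  qed
  have "(\<lambda>\<rho>. (1 / c) *\<^sub>R (c * ?F \<rho>)) absolutely_integrable_on {0<..}"
    by (rule absolutely_integrable_scaleR_left[OF I(1)])
  then have F: "?F absolutely_integrable_on {0<..}" using c by simp
  \<comment> \<open>The change of variables takes place on the Lebesgue completion; Borel
    measurability of the integrand brings its result back to \<open>lborel\<close>.\<close>
  have meas: "(\<lambda>\<rho>. indicat_real {0<..} \<rho> *\<^sub>R ?F \<rho>) \<in> borel_measurable lborel" by measurable
  then show "set_integrable lborel {0<..} ?F"
    using F unfolding set_integrable_def by (simp add: integrable_completion)
  have "(LINT \<rho>:{0<..}|lborel. ?F \<rho>) = (LINT \<rho>:{0<..}|lebesgue. ?F \<rho>)"
    unfolding set_lebesgue_integral_def using meas by (simp add: integral_completion)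
  also have "\<dots> = integral {0<..} ?F" by (rule set_lebesgue_integral_eq_integral(2)[OF F])
  also have "\<dots> = Gamma q / c" using I(2) c by (simp add: field_simps)
  also have "\<dots> = Gamma q * e powr (- q) / 2" using assms by (simp add: c_def powr_minus_divide)
  finally show "(LINT \<rho>:{0<..}|lborel. ?F \<rho>) = Gamma q * e powr (- q) / 2" .
qed

lemma set_integral_sums:
  fixes f :: "nat \<Rightarrow> real \<Rightarrow> complex"
  assumes int: "\<And>m. set_integrable lborel A (f m)"
    and s: "\<And>x. x \<in> A \<Longrightarrow> (\<lambda>m. f m x) sums g x" "\<And>x. x \<in> A \<Longrightarrow> summable (\<lambda>m. norm (f m x))"
    and n: "summable (\<lambda>m. LINT x:A|lborel. norm (f m x))"
    and v: "(\<lambda>m. LINT x:A|lborel. f m x) sums v"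
  shows "set_integrable lborel A g" "(LINT x:A|lborel. g x) = v"
proof -
  have 1: "AE x in lborel. summable (\<lambda>m. norm (indicator A x *\<^sub>R f m x))"
  proof (rule AE_I2)
    show "summable (\<lambda>m. norm (indicator A x *\<^sub>R f m x))" for x
      using s(2)[of x] by (cases "x \<in> A") simp_all
  qed
  have 2: "summable (\<lambda>m. LINT x|lborel. norm (indicator A x *\<^sub>R f m x))"
    using n by (simp add: set_lebesgue_integral_def)
  have g: "(\<Sum>m. indicator A x *\<^sub>R f m x) = indicator A x *\<^sub>R g x" for x
    using s(1)[of x] by (cases "x \<in> A") (simp_all add: sums_iff)
  show "set_integrable lborel A g"
    using integrable_suminf[OF int[unfolded set_integrable_def] 1 2] unfolding g set_integrable_def .
  show "(LINT x:A|lborel. g x) = v"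
    using sums_integral[OF int[unfolded set_integrable_def] 1 2] v unfolding g set_lebesgue_integral_def
    by (simp add: sums_iff)
qed

text \<open>Newton's series with exponent \<open>- q\<close>: the signs of the generalised binomials
  cancel those of \<open>(- u) ^ m\<close>, so that all coefficients are positive. This makes the
  series its own majorant.\<close>

lemma powr_gbinomial_pochhammer_sums:
  fixes u :: complex and q :: real
  assumes "q > 0" "norm u < 1"
  shows "(\<lambda>m. of_real (pochhammer q m / fact m) * u ^ m) sums ((1 - u) powr (- of_real q))"
proof -
  have "(\<lambda>m. ((- of_real q) gchoose m) * (- u) ^ m) sums (1 + (- u)) powr (- of_real q)"
    by (rule gen_binomial_complex) (use assms in simp)
  moreover have "((- complex_of_real q) gchoose m) * (- u) ^ m = of_real (pochhammer q m / fact m)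
      * u ^ m" for m
    by (simp add: gbinomial_pochhammer pochhammer_of_real power_mult_distrib[symmetric] mult.commute
        mult.left_commute flip: power_mult_distrib)
  ultimately show ?thesis by simp
qed

text \<open>Every \<open>z\<close> in the right half plane lies in a disc \<open>|z - e| < e\<close> with \<open>e\<close> real; there the binomial series
  around \<open>e\<close> can be integrated term by term, and no contour rotation is needed.\<close>

lemma gaussian_moment_complex:
  fixes q :: real and z :: complex
  assumes q: "q > 0" and z: "Re z > 0"
  shows "set_integrable lborel {0<..} (\<lambda>\<rho>. of_real (\<rho> powr (2 * q - 1)) * exp (- (z * of_real (\<rho>\<^sup>2))))"
      (is "set_integrable _ _ ?F")
    and "(LINT \<rho>:{0<..}|lborel. of_real (\<rho> powr (2 * q - 1)) * exp (- (z * of_real (\<rho>\<^sup>2))))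
        = of_real (Gamma q / 2) * z powr (- of_real q)"
proof -
  \<comment> \<open>The squared distance from \<open>z\<close> to \<open>e\<close> is
    \<open>e^2 - (2 * e * Re z - |z|^2)\<close>, so every \<open>e\<close> above
    \<open>|z|^2 / (2 * Re z)\<close> is admissible; this is twice that threshold.\<close>
  define e where "e = (cmod z)\<^sup>2 / Re z"
  define w where "w = of_real e - z"
  have z0: "z \<noteq> 0" using z by auto
  have e: "e > 0" using z z0 by (simp add: e_def)
  have "(cmod w)\<^sup>2 = e\<^sup>2 - (2 * e * Re z - (cmod z)\<^sup>2)"
    unfolding w_def cmod_power2 by (simp add: power2_eq_square algebra_simps)
  also have "2 * e * Re z = 2 * (cmod z)\<^sup>2" using z by (simp add: e_def)
  finally have "(cmod w)\<^sup>2 < e\<^sup>2" using z0 by simp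
  then have w: "cmod w < e" using e by (simp add: power2_less_imp_less)
  have qm: "real m + q > 0" for m using q by simp
  define f where "f m \<rho> = (w ^ m / fact m) * of_real
      (\<rho> powr (2 * (real m + q) - 1) * exp (- (e * \<rho>\<^sup>2)))" for m \<rho>
  have int: "set_integrable lborel {0<..} (f m)" for m
  proof -
    have "set_integrable lborel {0<..} (\<lambda>\<rho>. complex_of_real
        (\<rho> powr (2 * (real m + q) - 1) * exp (- (e * \<rho>\<^sup>2))))"
      by (intro set_integrable_complex_of_real gaussian_moment_real qm e)
    then show ?thesis unfolding f_def by simp
  qed
  have fx: "f m \<rho> = of_real (\<rho> powr (2 * q - 1) * exp (- (e * \<rho>\<^sup>2)))
      * ((w * of_real (\<rho>\<^sup>2)) ^ m /\<^sub>R fact m)" if "\<rho> > 0" for m \<rho>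
  proof -
    have "\<rho> powr (2 * (real m + q) - 1) = \<rho> powr (2 * q - 1 + real (2 * m))"
        by (simp add: algebra_simps)
    also have "\<dots> = \<rho> powr (2 * q - 1) * (\<rho>\<^sup>2) ^ m"
      using that unfolding powr_add power_mult[symmetric] by (subst powr_realpow) auto
    finally have p: "\<rho> powr (2 * (real m + q) - 1) = \<rho> powr (2 * q - 1) * (\<rho>\<^sup>2) ^ m" .
    show ?thesis
      unfolding f_def p by (simp add: power_mult_distrib scaleR_conv_of_real divide_inverse mult_ac)
  qed
  have Gq: "Gamma (real m + q) = Gamma q * pochhammer q m" for m
  proof -
    have "q \<notin> \<int>\<^sub>\<le>\<^sub>0" using q by (auto simp: nonpos_Ints_def)
    moreover have "Gamma q > 0" using q by (rule Gamma_real_pos)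
    ultimately show ?thesis using pochhammer_Gamma[of q m] by (simp add: add.commute)
  qed
  have ep: "e powr (- (real m + q)) = e powr (- q) * (1 / e) ^ m" for m
    using e by (simp add: powr_diff powr_realpow power_one_over powr_minus field_simps powr_add)
  have I0: "(LINT \<rho>:{0<..}|lborel. \<rho> powr (2 * (real m + q) - 1) * exp (- (e * \<rho>\<^sup>2)))
       = Gamma q / 2 * e powr (- q) * (pochhammer q m * (1 / e) ^ m)" for m
    unfolding gaussian_moment_real(2)[OF qm e] Gq ep by simp
  have I: "(LINT \<rho>:{0<..}|lborel. f m \<rho>) = of_real (Gamma q / 2 * e powr (- q))
      * (of_real (pochhammer q m / fact m) * (w / of_real e) ^ m)" for m
  proof -
    have "(w / of_real e) ^ m = w ^ m * of_real ((1 / e) ^ m)" by (simp add: power_divide)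
    then show ?thesis
      unfolding f_def set_integral_mult_right set_integral_complex_of_real I0 by (simp add: mult_ac)
  qed
  have IN: "(LINT \<rho>:{0<..}|lborel. norm (f m \<rho>)) = Gamma q / 2 * e powr (- q)
      * (pochhammer q m / fact m * (cmod w / e) ^ m)" for m
  proof -
    have "(LINT \<rho>:{0<..}|lborel. norm (f m \<rho>)) = (LINT \<rho>:{0<..}|lborel. (cmod w ^ m / fact m)
        * (\<rho> powr (2 * (real m + q) - 1) * exp (- (e * \<rho>\<^sup>2))))"
      by (rule set_lebesgue_integral_cong) (auto simp: f_def norm_mult norm_divide norm_power)
    also have "\<dots> = (cmod w ^ m / fact m) * (Gamma q / 2 * e powr (- q)
        * (pochhammer q m * (1 / e) ^ m))"
      by (simp only: set_integral_mult_right I0)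
    finally show ?thesis by (simp add: power_divide mult_ac)
  qed
  have nrm: "norm (complex_of_real (cmod w / e)) < 1" "norm (w / of_real e) < 1" using w e
      by (simp_all add: norm_divide)
  \<comment> \<open>The integrals of the norms form the same binomial series at the real point
    \<open>cmod w / e < 1\<close>.\<close>
  have "(\<lambda>m. complex_of_real (pochhammer q m / fact m * (cmod w / e) ^ m)) sums
      ((1 - of_real (cmod w / e)) powr (- of_real q))"
    using powr_gbinomial_pochhammer_sums[OF q nrm(1)] by simp
  from sums_Re[OF this] have "summable (\<lambda>m. pochhammer q m / fact m * (cmod w / e) ^ m)"
    unfolding Re_complex_of_real by (rule sums_summable)
  then have SN: "summable (\<lambda>m. LINT \<rho>:{0<..}|lborel. norm (f m \<rho>))"
    unfolding IN by (rule summable_mult)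
  have "(\<lambda>m. LINT \<rho>:{0<..}|lborel. f m \<rho>) sums (of_real (Gamma q / 2 * e powr (- q))
      * (1 - w / of_real e) powr (- of_real q))"
    unfolding I by (intro sums_mult powr_gbinomial_pochhammer_sums q nrm)
  also have "1 - w / of_real e = z / of_real e" using e by (simp add: w_def divide_simps)
  also have "of_real (Gamma q / 2 * e powr (- q)) * (z / of_real e) powr (- of_real q)
      = of_real (Gamma q / 2) * z powr (- of_real q)"
  proof -
    \<comment> \<open>Division by the positive number \<open>e\<close> does not change the argument,
      so principal powers are multiplicative here.\<close>
    have "(z / of_real e) powr (- of_real q) = z powr (- of_real q) * of_real (e powr q)"
      using z0 e by (simp add: powr_def Ln_divide_of_real exp_of_real[symmetric] algebra_simps
          exp_add[symmetric])
    then show ?thesis using e by (simp add: powr_minus)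
  qed
  finally have S: "(\<lambda>m. LINT \<rho>:{0<..}|lborel. f m \<rho>) sums
      (of_real (Gamma q / 2) * z powr (- of_real q))" .
  have s1: "(\<lambda>m. f m \<rho>) sums ?F \<rho>" if "\<rho> \<in> {0<..}" for \<rho>
  proof -
    have "(\<lambda>m. f m \<rho>) sums (of_real (\<rho> powr (2 * q - 1) * exp (- (e * \<rho>\<^sup>2))) * exp (w * of_real (\<rho>\<^sup>2)))"
      using that by (simp only: fx greaterThan_iff) (intro sums_mult exp_converges)
    also have "of_real (\<rho> powr (2 * q - 1) * exp (- (e * \<rho>\<^sup>2))) * exp (w * of_real (\<rho>\<^sup>2)) = ?F \<rho>"
      by (simp add: w_def exp_of_real[symmetric] mult_exp_exp algebra_simps)
    finally show ?thesis .
  qed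
  have s2: "summable (\<lambda>m. norm (f m \<rho>))" if "\<rho> \<in> {0<..}" for \<rho>
    using that by (simp only: fx greaterThan_iff norm_mult) (intro summable_mult summable_norm_exp)
  show "set_integrable lborel {0<..} ?F"
    by (rule set_integral_sums(1)[OF int s1 s2 SN S])
  show "(LINT \<rho>:{0<..}|lborel. ?F \<rho>) = of_real (Gamma q / 2) * z powr (- of_real q)"
    by (rule set_integral_sums(2)[OF int s1 s2 SN S])
qed

text \<open>The kernel of \<open>exp (- z A)\<close> for the Bessel operator \<open>A\<close> in Liouville form; the modified Bessel function
  \<open>I\<^sub>\<nu> (r s / (2 z))\<close> is written through its Clifford series, so that only one complex power occurs.\<close>

definition bessel_heat :: "real \<Rightarrow> complex \<Rightarrow> real \<Rightarrow> real \<Rightarrow> complex" where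
  "bessel_heat \<nu> z r s = of_real (sqrt (r * s) * (r * s / 4) powr \<nu> / 2) * z powr (- of_real (\<nu> + 1)) *
     (bessel_clifford \<nu> (of_real ((r * s)\<^sup>2) / (16 * z\<^sup>2)) * exp (- (of_real (r\<^sup>2 + s\<^sup>2) / (4 * z))))"

section \<open>Termwise integration of a product of two Bessel functions\<close>

lemma bessel_clifford_mult_sums:
  fixes x y :: real
  assumes "\<nu> > 0"
  shows "(\<lambda>M. \<Sum>m\<le>M. bessel_coeff \<nu> m * bessel_coeff \<nu> (M - m) * x ^ m * y ^ (M - m)) sums
     (bessel_clifford \<nu> x * bessel_clifford \<nu> y)"
  using Cauchy_product_sums[OF summable_norm_bessel_clifford[OF assms, of x]
      summable_norm_bessel_clifford[OF assms, of y]]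
  by (simp add: bessel_clifford_def mult_ac)

text \<open>The product of the two Bessel functions is a power of \<open>\<rho>\<close> times a
  series in \<open>\<rho>^2\<close>. Its \<open>M\<close>-th term integrates to a Gaussian moment
  with \<open>q = M + \<nu> + 1\<close>, and the resulting series is
  \<open>bessel_clifford_exp_sums\<close> at \<open>x = - r^2 / (4 z)\<close>,
  \<open>y = - s^2 / (4 z)\<close>.\<close>

lemma weber_integral:
  fixes z :: complex and r s :: real
  assumes nu: "\<nu> > 0" and z: "Re z > 0" and r: "r > 0" and s: "s > 0"
  shows "set_integrable lborel {0<..} (\<lambda>\<rho>. of_real (bessel_w \<nu> (r * \<rho>) * bessel_w \<nu> (s * \<rho>))
      * exp (- (z * of_real (\<rho>\<^sup>2))))" (is "set_integrable _ _ ?F")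
    and "(LINT \<rho>:{0<..}|lborel. of_real (bessel_w \<nu> (r * \<rho>) * bessel_w \<nu> (s * \<rho>))
        * exp (- (z * of_real (\<rho>\<^sup>2)))) = bessel_heat \<nu> z r s"
proof -
  have z0: "z \<noteq> 0" using z by auto
  define C where "C = sqrt (r * s) * (r * s / 4) powr \<nu>"
  have C0: "C \<ge> 0" using r s by (simp add: C_def)
  define d where "d M = (\<Sum>m\<le>M. bessel_coeff \<nu> m * bessel_coeff \<nu> (M - m) * (r\<^sup>2) ^ m
      * (s\<^sup>2) ^ (M - m))" for M
  have d0: "d M \<ge> 0" for M unfolding d_def using bessel_coeff_pos[OF nu]
      by (intro sum_nonneg) (auto simp: less_imp_le)
  \<comment> \<open>\<open>d M\<close> is homogeneous of degree \<open>M\<close> in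
    \<open>r^2\<close> and \<open>s^2\<close>, so any factor \<open>k ^ M\<close> can be moved into
    these two variables. The complex version \<open>d_scale'\<close> absorbs
    \<open>- 1 / (4 z)\<close> in the same way.\<close>
  have d_scale: "k ^ M * d M = (\<Sum>m\<le>M. bessel_coeff \<nu> m * bessel_coeff \<nu> (M - m) * (k * r\<^sup>2) ^ m
      * (k * s\<^sup>2) ^ (M - m))" for k M
    unfolding d_def sum_distrib_left
  proof (rule sum.cong[OF refl])
    fix m assume "m \<in> {..M}"
    then have "k ^ M = k ^ m * k ^ (M - m)" by (simp flip: power_add)
    then show "k ^ M * (bessel_coeff \<nu> m * bessel_coeff \<nu> (M - m) * (r\<^sup>2) ^ m * (s\<^sup>2) ^ (M - m))
       = bessel_coeff \<nu> m * bessel_coeff \<nu> (M - m) * (k * r\<^sup>2) ^ m * (k * s\<^sup>2) ^ (M - m)"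
      by (simp add: power_mult_distrib)
  qed
  have d_scale': "k ^ M * of_real (d M) = (\<Sum>m\<le>M. of_real (bessel_coeff \<nu> m * bessel_coeff \<nu> (M - m))
      * (k * of_real (r\<^sup>2)) ^ m * (k * of_real (s\<^sup>2)) ^ (M - m))" for k :: complex and M
    unfolding d_def sum_distrib_left of_real_sum
  proof (rule sum.cong[OF refl])
    fix m assume "m \<in> {..M}"
    then have "k ^ M = k ^ m * k ^ (M - m)" by (simp flip: power_add)
    then show "k ^ M * of_real (bessel_coeff \<nu> m * bessel_coeff \<nu> (M - m) * (r\<^sup>2) ^ m * (s\<^sup>2) ^ (M - m))
       = of_real (bessel_coeff \<nu> m * bessel_coeff \<nu> (M - m)) * (k * of_real (r\<^sup>2)) ^ m
           * (k * of_real (s\<^sup>2)) ^ (M - m)"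
      by (simp add: power_mult_distrib)
  qed
  have q: "real M + \<nu> + 1 > 0" for M using nu by simp
  define f where "f M \<rho> = of_real (C * d M * (- 1 / 4) ^ M)
      * (of_real (\<rho> powr (2 * (real M + \<nu> + 1) - 1)) * exp (- (z * of_real (\<rho>\<^sup>2))))" for M \<rho>
  have int: "set_integrable lborel {0<..} (f M)" for M
    unfolding f_def by (intro set_integrable_mult_right gaussian_moment_complex q z)
  have powM: "\<rho> powr (2 * (real M + \<nu> + 1) - 1) = \<rho> powr (2 * \<nu> + 1) * (\<rho>\<^sup>2) ^ M" if "\<rho> > 0" for \<rho> M
  proof -
    have "\<rho> powr (2 * (real M + \<nu> + 1) - 1) = \<rho> powr (2 * \<nu> + 1 + real (2 * M))"
        by (simp add: algebra_simps)
    also have "\<dots> = \<rho> powr (2 * \<nu> + 1) * \<rho> ^ (2 * M)"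
      using that unfolding powr_add by (subst powr_realpow) auto
    finally show ?thesis by (simp add: power_mult)
  qed
  have ww: "bessel_w \<nu> (r * \<rho>) * bessel_w \<nu> (s * \<rho>) = C * \<rho> powr (2 * \<nu> + 1) *
      (bessel_clifford \<nu> (- (\<rho>\<^sup>2) / 4 * r\<^sup>2) * bessel_clifford \<nu> (- (\<rho>\<^sup>2) / 4 * s\<^sup>2))" if "\<rho> > 0" for \<rho>
  proof -
    have "(r * \<rho>) powr (\<nu> + 1/2) * (s * \<rho>) powr (\<nu> + 1/2) = (r * s) powr (\<nu> + 1/2) * \<rho> powr (2 * \<nu> + 1)"
    proof -
      have "\<rho> powr (2 * \<nu> + 1) = \<rho> powr (\<nu> + 1/2) * \<rho> powr (\<nu> + 1/2)"
        unfolding powr_add[symmetric] by (simp add: algebra_simps)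
      then show ?thesis using that r s by (simp add: powr_mult)
    qed
    moreover have "2 powr (-\<nu>) * 2 powr (-\<nu>) * (r * s) powr (\<nu> + 1/2) = C"
    proof -
      have "2 powr (-\<nu>) * 2 powr (-\<nu>) = (1/4) powr \<nu>"
        by (simp add: powr_minus_divide powr_divide powr_mult[symmetric])
      moreover have "(r * s / 4) powr \<nu> = (r * s) powr \<nu> * (1/4) powr \<nu>"
        using r s powr_mult[of "r * s" "1/4" \<nu>] by simp
      ultimately show ?thesis using r s unfolding C_def powr_add by (simp add: powr_half_sqrt)
    qed
    ultimately show ?thesis
      using that r s by (simp add: bessel_w_eq[OF nu] power_mult_distrib mult_ac)
  qed
  have s1: "(\<lambda>M. f M \<rho>) sums ?F \<rho>" if "\<rho> \<in> {0<..}" for \<rho>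
  proof -
    have \<rho>: "\<rho> > 0" using that by simp
    have "(\<lambda>M. C * \<rho> powr (2 * \<nu> + 1) * ((- (\<rho>\<^sup>2) / 4) ^ M * d M)) sums
        (bessel_w \<nu> (r * \<rho>) * bessel_w \<nu> (s * \<rho>))"
      unfolding ww[OF \<rho>] d_scale by (intro sums_mult bessel_clifford_mult_sums nu)
    from sums_of_real[OF this, where 'a = complex]
    have "(\<lambda>M. of_real (C * \<rho> powr (2 * \<nu> + 1) * ((- (\<rho>\<^sup>2) / 4) ^ M * d M))
        * exp (- (z * of_real (\<rho>\<^sup>2)))) sums ?F \<rho>"
      by (rule sums_mult2)
    moreover have "of_real (C * \<rho> powr (2 * \<nu> + 1) * ((- (\<rho>\<^sup>2) / 4) ^ M * d M))
        * exp (- (z * of_real (\<rho>\<^sup>2))) = f M \<rho>" for M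
    proof -
      have k: "(- (\<rho>\<^sup>2) / 4) ^ M = (- 1 / 4) ^ M * (\<rho>\<^sup>2) ^ M"
        unfolding power_mult_distrib[symmetric] by simp
      show ?thesis unfolding f_def powM[OF \<rho>] k by (simp only: of_real_mult mult_ac)
    qed
    ultimately show ?thesis by simp
  qed
  have s2: "summable (\<lambda>M. norm (f M \<rho>))" if "\<rho> \<in> {0<..}" for \<rho>
  proof -
    have \<rho>: "\<rho> > 0" using that by simp
    have "summable (\<lambda>M. C * \<rho> powr (2 * \<nu> + 1) * ((\<rho>\<^sup>2 / 4) ^ M * d M)
        * norm (exp (- (z * of_real (\<rho>\<^sup>2)))))"
      unfolding d_scale by (intro summable_mult summable_mult2
          sums_summable[OF bessel_clifford_mult_sums] nu)
    moreover have "C * \<rho> powr (2 * \<nu> + 1) * ((\<rho>\<^sup>2 / 4) ^ M * d M) * norm (exp (- (z * of_real (\<rho>\<^sup>2))))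
        = norm (f M \<rho>)" for M
    proof -
      have k: "(\<rho>\<^sup>2 / 4) ^ M = (1 / 4) ^ M * (\<rho>\<^sup>2) ^ M"
        unfolding power_mult_distrib[symmetric] by simp
      show ?thesis unfolding f_def powM[OF \<rho>] k using C0 d0[of M]
        by (simp add: norm_mult norm_power mult_ac del: norm_exp_eq_Re)
    qed
    ultimately show ?thesis by simp
  qed
  have I: "(LINT \<rho>:{0<..}|lborel. f M \<rho>) = of_real (C / 2) * z powr (- of_real (\<nu> + 1)) *
      (of_real (Gamma (real M + \<nu> + 1)) * (\<Sum>m\<le>M. of_real (bessel_coeff \<nu> m * bessel_coeff \<nu> (M - m)) *
         (- 1 / (4 * z) * of_real (r\<^sup>2)) ^ m * (- 1 / (4 * z) * of_real (s\<^sup>2)) ^ (M - m)))" for M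
  proof -
    have "z powr (- of_real (real M + \<nu> + 1)) = z powr (- of_real (\<nu> + 1) + - of_nat M)"
        by (simp add: algebra_simps)
    also have "\<dots> = z powr (- of_real (\<nu> + 1)) * (1 / z) ^ M"
      unfolding powr_add using z0 by (simp add: powr_minus_divide powr_nat power_one_over)
    finally have zp: "z powr (- of_real (real M + \<nu> + 1)) = z powr (- of_real (\<nu> + 1)) * (1 / z) ^ M" .
    have k: "(- 1 / (4 * z)) ^ M = (- 1 / 4) ^ M * (1 / z) ^ M"
      unfolding power_mult_distrib[symmetric] by simp
    show ?thesis
      unfolding f_def set_integral_mult_right gaussian_moment_complex(2)[OF q z] zp d_scale'[symmetric]
          k
      by (simp add: mult_ac)
  qed
  \<comment> \<open>Norms remove the alternating signs and replace \<open>z\<close> by its real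
    part. As all coefficients are positive, the majorant is again
    \<open>bessel_clifford_exp_sums\<close>, now at positive real arguments.\<close>
  define e where "e = Re z"
  have IN: "(LINT \<rho>:{0<..}|lborel. norm (f M \<rho>)) = C / 2 * e powr (- (\<nu> + 1)) *
      (Gamma (real M + \<nu> + 1) * (\<Sum>m\<le>M. bessel_coeff \<nu> m * bessel_coeff \<nu> (M - m) *
         (1 / (4 * e) * r\<^sup>2) ^ m * (1 / (4 * e) * s\<^sup>2) ^ (M - m)))" for M
  proof -
    have e: "e > 0" using z by (simp add: e_def)
    have "e powr (- (real M + \<nu> + 1)) = e powr (- (\<nu> + 1) - real M)" by (simp add: algebra_simps)
    also have "\<dots> = e powr (- (\<nu> + 1)) * (1 / e) ^ M"
      using e by (simp add: powr_diff powr_realpow power_one_over)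
    finally have ep: "e powr (- (real M + \<nu> + 1)) = e powr (- (\<nu> + 1)) * (1 / e) ^ M" .
    have k: "(1 / (4 * e)) ^ M = (1 / 4) ^ M * (1 / e) ^ M"
      unfolding power_mult_distrib[symmetric] by simp
    have "(LINT \<rho>:{0<..}|lborel. norm (f M \<rho>)) = (LINT \<rho>:{0<..}|lborel. (C * d M * (1 / 4) ^ M)
        * (\<rho> powr (2 * (real M + \<nu> + 1) - 1) * exp (- (e * \<rho>\<^sup>2))))"
      using C0 d0[of M] by (intro set_lebesgue_integral_cong)
          (auto simp: f_def norm_mult norm_power e_def)
    also have "\<dots> = (C * d M * (1 / 4) ^ M) * (Gamma (real M + \<nu> + 1) * e powr (- (real M + \<nu> + 1)) / 2)"
      unfolding set_integral_mult_right gaussian_moment_real(2)[OF q e] ..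
    finally show ?thesis unfolding ep d_scale[symmetric] k by (simp add: mult_ac)
  qed
  have SN: "summable (\<lambda>M. LINT \<rho>:{0<..}|lborel. norm (f M \<rho>))"
    unfolding IN using sums_summable[OF bessel_clifford_exp_sums[OF nu, where 'a = real]]
    by (intro summable_mult) simp
  have xy: "(- 1 / (4 * z) * of_real (r\<^sup>2)) * (- 1 / (4 * z) * of_real (s\<^sup>2))
      = of_real ((r * s)\<^sup>2) / (16 * z\<^sup>2)"
    "(- 1 / (4 * z) * of_real (r\<^sup>2)) + (- 1 / (4 * z) * of_real (s\<^sup>2))
        = - (of_real (r\<^sup>2 + s\<^sup>2) / (4 * z))"
    by (simp_all add: power2_eq_square add_divide_distrib)
  have S: "(\<lambda>M. LINT \<rho>:{0<..}|lborel. f M \<rho>) sums bessel_heat \<nu> z r s"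
    unfolding I bessel_heat_def C_def[symmetric] xy[symmetric]
    by (intro sums_mult bessel_clifford_exp_sums nu)
  show "set_integrable lborel {0<..} ?F"
    by (rule set_integral_sums(1)[OF int s1 s2 SN S])
  show "(LINT \<rho>:{0<..}|lborel. ?F \<rho>) = bessel_heat \<nu> z r s"
    by (rule set_integral_sums(2)[OF int s1 s2 SN S])
qed

section \<open>The kernel of the propagator\<close>

text \<open>Extension by zero from the positive axis, which yields a Borel function bounded on the
  whole line, as the product measurability and Fubini arguments require.\<close>

definition bessel_wp :: "real \<Rightarrow> real \<Rightarrow> real" where
  "bessel_wp \<nu> z = indicator {0<..} z * bessel_w \<nu> z"

lemma bessel_wp_eq: "z > 0 \<Longrightarrow> bessel_wp \<nu> z = bessel_w \<nu> z"
  by (simp add: bessel_wp_def)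

lemma continuous_on_bessel_w: "\<nu> > 0 \<Longrightarrow> continuous_on {0<..} (bessel_w \<nu>)"
  by (auto intro!: continuous_at_imp_continuous_on DERIV_isCont has_real_derivative_bessel_w)

lemma borel_measurable_bessel_wp [measurable]:
  assumes "\<nu> > 0" shows "bessel_wp \<nu> \<in> borel_measurable borel"
  using borel_measurable_continuous_on_indicator[OF _ continuous_on_bessel_w[OF assms]]
  by (simp add: bessel_wp_def[abs_def])

text \<open>Green's identity for the Liouville form: \<open>w (s * \<rho>)\<close> is an
  eigenfunction of \<open>- d^2/ds^2 + c / s^2\<close> with eigenvalue \<open>\<rho>^2\<close>.
  Moving the operator to \<open>G\<close> gains \<open>\<rho>^2\<close>, and the result is
  integrable in \<open>\<rho>\<close>.\<close>

lemma bessel_transform_decay: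
  fixes G G1 G2 :: "real \<Rightarrow> complex"
  assumes nu: "\<nu> > 0" and pq: "0 < p" "p \<le> q"
    and G: "\<And>s. s > 0 \<Longrightarrow> (G has_vector_derivative G1 s) (at s)"
    and G1: "\<And>s. s > 0 \<Longrightarrow> (G1 has_vector_derivative G2 s) (at s)"
    and G2: "continuous_on {0<..} G2"
    and bd: "G p = 0" "G q = 0" "G1 p = 0" "G1 q = 0"
  obtains K where "K \<ge> 0" "\<And>\<rho>. \<rho> > 0 \<Longrightarrow> norm (LINT s:{p..q}|lborel. of_real (bessel_w \<nu> (s * \<rho>)) * G s)
      \<le> K * inverse (1 + \<rho>\<^sup>2)"
proof -
  obtain W where W: "W \<ge> 0" "\<And>z. z > 0 \<Longrightarrow> \<bar>bessel_w \<nu> z\<bar> \<le> W"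
      by (rule bessel_w_bounded[OF nu]) (rule that)
  define c where "c = \<nu>\<^sup>2 - 1/4"
  define H where "H s = of_real (c / s\<^sup>2) * G s - G2 s" for s
  have cG: "continuous_on {p..q} G" using pq
    by (intro continuous_at_imp_continuous_on ballI has_vector_derivative_continuous[OF G]) auto
  have cG2: "continuous_on {p..q} G2" by (rule continuous_on_subset[OF G2]) (use pq in auto)
  have cH: "continuous_on {p..q} H" unfolding H_def using pq by (intro continuous_intros cG cG2) auto
  have cw: "continuous_on {p..q} (\<lambda>s. bessel_w \<nu> (s * \<rho>))" if "\<rho> > 0" for \<rho>
    using that pq by (intro continuous_on_compose2[OF continuous_on_bessel_w[OF nu]] continuous_intros)
        auto
  define K0 where "K0 = (LINT s:{p..q}|lborel. W * norm (G s))"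
  define K2 where "K2 = (LINT s:{p..q}|lborel. W * norm (H s))"
  have bnd: "norm (LINT s:{p..q}|lborel. of_real (bessel_w \<nu> (s * \<rho>)) * F s)
      \<le> (LINT s:{p..q}|lborel. W * norm (F s))"
    if "\<rho> > 0" "continuous_on {p..q} F" for \<rho> and F :: "real \<Rightarrow> complex"
  proof -
    have i: "set_integrable lborel {p..q} (\<lambda>s. of_real (bessel_w \<nu> (s * \<rho>)) * F s)"
      by (intro borel_integrable_atLeastAtMost' continuous_intros that cw)
    have "norm (LINT s:{p..q}|lborel. of_real (bessel_w \<nu> (s * \<rho>)) * F s)
        \<le> (LINT s:{p..q}|lborel. norm (of_real (bessel_w \<nu> (s * \<rho>)) * F s))"
      by (rule set_integral_norm_bound[OF i])
    also have "\<dots> \<le> (LINT s:{p..q}|lborel. W * norm (F s))"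
    proof (rule set_integral_mono)
      show "set_integrable lborel {p..q} (\<lambda>s. norm (of_real (bessel_w \<nu> (s * \<rho>)) * F s))"
        by (rule set_integrable_norm[OF i])
      show "set_integrable lborel {p..q} (\<lambda>s. W * norm (F s))"
        by (intro borel_integrable_atLeastAtMost' continuous_intros that)
      show "norm (of_real (bessel_w \<nu> (s * \<rho>)) * F s) \<le> W * norm (F s)" if "s \<in> {p..q}" for s
        using W(2)[of "s * \<rho>"] that \<open>\<rho> > 0\<close> pq by (auto simp: norm_mult intro!: mult_right_mono)
    qed
    finally show ?thesis .
  qed
  have parts: "\<rho>\<^sup>2 * norm (LINT s:{p..q}|lborel. of_real (bessel_w \<nu> (s * \<rho>)) * G s) \<le> K2"
      if \<rho>: "\<rho> > 0" for \<rho>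
  proof -
    \<comment> \<open>The Wronskian of \<open>w (s * \<rho>)\<close> and \<open>G\<close>. Its
      derivative \<open>dh\<close> is the difference of the two integrands to be compared, and it
      vanishes at \<open>p\<close> and \<open>q\<close> by the boundary conditions.\<close>
    define h where "h s = of_real (\<rho> * bessel_dw \<nu> (s * \<rho>)) * G s - of_real (bessel_w \<nu> (s * \<rho>))
        * G1 s" for s
    define dh where "dh s = of_real (bessel_w \<nu> (s * \<rho>)) * H s - of_real (\<rho>\<^sup>2)
        * (of_real (bessel_w \<nu> (s * \<rho>)) * G s)" for s
    have h': "(h has_vector_derivative dh s) (at s)" if s: "s \<in> {p..q}" for s
    proof -
      have s0: "s > 0" using s pq by simp
      then have sr: "s * \<rho> > 0" using \<rho> by simp
      have "((\<lambda>s. bessel_w \<nu> (s * \<rho>)) has_real_derivative bessel_dw \<nu> (s * \<rho>) * \<rho>) (at s)"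
        by (rule DERIV_chain2[where f = "bessel_w \<nu>" and g = "\<lambda>s. s * \<rho>", OF
            has_real_derivative_bessel_w[OF nu sr]])
           (auto intro!: derivative_eq_intros)
      moreover have "((\<lambda>s. \<rho> * bessel_dw \<nu> (s * \<rho>)) has_real_derivative \<rho>
          * (- (1 - c / (s * \<rho>)\<^sup>2) * bessel_w \<nu> (s * \<rho>) * \<rho>)) (at s)"
        unfolding c_def
        by (intro DERIV_cmult DERIV_chain2[where f = "bessel_dw \<nu>" and g = "\<lambda>s. s * \<rho>", OF
            has_real_derivative_bessel_dw[OF nu sr]])
           (auto intro!: derivative_eq_intros)
      ultimately have "(h has_vector_derivative
           ((of_real (\<rho> * bessel_dw \<nu> (s * \<rho>)) * G1 s
               + of_real (\<rho> * (- (1 - c / (s * \<rho>)\<^sup>2) * bessel_w \<nu> (s * \<rho>) * \<rho>)) * G s)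
            - (of_real (bessel_w \<nu> (s * \<rho>)) * G2 s + of_real (bessel_dw \<nu> (s * \<rho>) * \<rho>) * G1 s))) (at s)"
        unfolding h_def[abs_def]
        by (intro has_vector_derivative_diff has_vector_derivative_mult
            has_vector_derivative_of_real G[OF s0] G1[OF s0])
      moreover have e: "\<rho> * (- (1 - c / (s * \<rho>)\<^sup>2) * bessel_w \<nu> (s * \<rho>) * \<rho>) = (c / s\<^sup>2 - \<rho>\<^sup>2)
          * bessel_w \<nu> (s * \<rho>)"
        using s0 \<rho> by (simp add: field_simps power2_eq_square)
      have "(of_real (\<rho> * bessel_dw \<nu> (s * \<rho>)) * G1 s
          + of_real (\<rho> * (- (1 - c / (s * \<rho>)\<^sup>2) * bessel_w \<nu> (s * \<rho>) * \<rho>)) * G s)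
            - (of_real (bessel_w \<nu> (s * \<rho>)) * G2 s + of_real (bessel_dw \<nu> (s * \<rho>) * \<rho>) * G1 s) = dh s"
        unfolding e dh_def H_def by (simp add: algebra_simps)
      ultimately show ?thesis by (simp only:)
    qed
    have iH: "set_integrable lborel {p..q} (\<lambda>s. of_real (bessel_w \<nu> (s * \<rho>)) * H s)"
      by (intro borel_integrable_atLeastAtMost' continuous_intros cH cw \<rho>)
    have iG: "set_integrable lborel {p..q} (\<lambda>s. of_real (\<rho>\<^sup>2) * (of_real (bessel_w \<nu> (s * \<rho>)) * G s))"
      by (intro borel_integrable_atLeastAtMost' continuous_intros cG cw \<rho>)
    have "(LINT s:{p..q}|lborel. dh s) = h q - h p"
      unfolding set_lebesgue_integral_def
    proof (rule integral_FTC_atLeastAtMost)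
      show "continuous_on {p..q} dh"
        unfolding dh_def by (intro continuous_intros cG cH cw \<rho>)
    qed (use pq h' in \<open>auto intro: has_vector_derivative_at_within\<close>)
    also have "\<dots> = 0" using bd by (simp add: h_def)
    finally have "(LINT s:{p..q}|lborel. of_real (bessel_w \<nu> (s * \<rho>)) * H s) = of_real (\<rho>\<^sup>2)
        * (LINT s:{p..q}|lborel. of_real (bessel_w \<nu> (s * \<rho>)) * G s)"
      unfolding dh_def using set_integral_diff(2)[OF iH iG] by simp
    then have "\<rho>\<^sup>2 * norm (LINT s:{p..q}|lborel. of_real (bessel_w \<nu> (s * \<rho>)) * G s)
        = norm (LINT s:{p..q}|lborel. of_real (bessel_w \<nu> (s * \<rho>)) * H s)"
      by (simp add: norm_mult norm_power)
    also have "\<dots> \<le> K2" unfolding K2_def by (rule bnd[OF \<rho> cH])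
    finally show ?thesis .
  qed
  have main: "norm (LINT s:{p..q}|lborel. of_real (bessel_w \<nu> (s * \<rho>)) * G s) \<le> (K0 + K2)
      * inverse (1 + \<rho>\<^sup>2)" if \<rho>: "\<rho> > 0" for \<rho>
  proof -
    have "(1 + \<rho>\<^sup>2) * norm (LINT s:{p..q}|lborel. of_real (bessel_w \<nu> (s * \<rho>)) * G s) \<le> K0 + K2"
      using bnd[OF \<rho> cG] parts[OF \<rho>] by (simp add: K0_def algebra_simps)
    moreover have "1 + \<rho>\<^sup>2 > 0" by (simp add: add_pos_nonneg)
    ultimately show ?thesis by (simp add: field_simps)
  qed
  have "K0 + K2 \<ge> 0"
    unfolding K0_def K2_def set_lebesgue_integral_def using W
        by (intro add_nonneg_nonneg integral_nonneg_AE) auto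
  then show ?thesis using that main by blast
qed

text \<open>Uniform up to the imaginary axis, since \<open>Re (1 / z) \<ge> 0\<close> bounds the
  exponential by 1 and positive coefficients bound the Clifford factor. It supplies the majorant for
  letting \<open>z\<close> tend to the axis.\<close>

lemma norm_bessel_heat_le:
  assumes nu: "\<nu> > 0" and r: "r > 0" and s: "s > 0" and z: "Re z \<ge> 0" "z \<noteq> 0" "norm z \<ge> t" "t > 0"
  shows "norm (bessel_heat \<nu> z r s) \<le> sqrt (r * s) * (r * s / 4) powr \<nu> / 2 * t powr (- (\<nu> + 1))
      * bessel_clifford \<nu> ((r * s)\<^sup>2 / (16 * t\<^sup>2))"
proof -
  have 1: "norm (z powr (- of_real (\<nu> + 1))) \<le> t powr (- (\<nu> + 1))"
  proof -
    have "norm (z powr (of_real (- (\<nu> + 1)))) = norm z powr (- (\<nu> + 1))"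
        by (subst norm_powr_real_powr') auto
    also have "\<dots> \<le> t powr (- (\<nu> + 1))" using z nu by (intro powr_mono2') auto
    finally show ?thesis by simp
  qed
  have 2: "norm (bessel_clifford \<nu> (of_real ((r * s)\<^sup>2) / (16 * z\<^sup>2)))
      \<le> bessel_clifford \<nu> ((r * s)\<^sup>2 / (16 * t\<^sup>2))"
  proof (rule order_trans[OF norm_bessel_clifford_le[OF nu] bessel_clifford_mono[OF nu]])
    have "(r * s)\<^sup>2 / (16 * (norm z)\<^sup>2) \<le> (r * s)\<^sup>2 / (16 * t\<^sup>2)"
      using z by (intro divide_left_mono mult_left_mono power_mono mult_pos_pos) auto
    then show "norm (of_real ((r * s)\<^sup>2) / (16 * z\<^sup>2)) \<le> (r * s)\<^sup>2 / (16 * t\<^sup>2)"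
      using r s by (simp add: norm_divide norm_mult norm_power)
  qed simp
  have 3: "norm (exp (- (of_real (r\<^sup>2 + s\<^sup>2) / (4 * z)))) \<le> 1"
  proof -
    have "of_real (r\<^sup>2 + s\<^sup>2) / (4 * z) = of_real ((r\<^sup>2 + s\<^sup>2) / 4) * (1 / z)" by simp
    then have e: "Re (of_real (r\<^sup>2 + s\<^sup>2) / (4 * z)) = (r\<^sup>2 + s\<^sup>2) / 4 * Re (1 / z)"
      by (simp only: times_complex.sel Re_complex_of_real Im_complex_of_real mult_zero_left diff_zero)
    have "Re (1 / z) \<ge> 0" using z(1) by (simp add: Re_divide divide_nonneg_nonneg)
    then have "Re (of_real (r\<^sup>2 + s\<^sup>2) / (4 * z)) \<ge> 0"
      unfolding e by (intro mult_nonneg_nonneg) auto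
    then show ?thesis by (simp only: norm_exp_eq_Re) simp
  qed
  have "norm (bessel_heat \<nu> z r s) = sqrt (r * s) * (r * s / 4) powr \<nu> / 2
      * norm (z powr (- of_real (\<nu> + 1))) *
     (norm (bessel_clifford \<nu> (of_real ((r * s)\<^sup>2) / (16 * z\<^sup>2)))
         * norm (exp (- (of_real (r\<^sup>2 + s\<^sup>2) / (4 * z)))))"
    unfolding bessel_heat_def norm_mult norm_of_real using r s by simp
  also have "\<dots> \<le> sqrt (r * s) * (r * s / 4) powr \<nu> / 2 * t powr (- (\<nu> + 1))
      * (bessel_clifford \<nu> ((r * s)\<^sup>2 / (16 * t\<^sup>2)) * 1)"
    using r s by (intro mult_mono mult_left_mono 1 2 3 mult_nonneg_nonneg
        order_trans[OF norm_ge_zero 2]) auto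
  finally show ?thesis by simp
qed

text \<open>On the imaginary axis \<open>z^2\<close> is negative, so the argument of the Clifford
  function turns negative and I becomes J, while the Gaussian becomes a chirp. The factors
  independent of \<open>s\<close> have modulus one together and are collected in
  \<open>P\<close>.\<close>

lemma bessel_heat_imaginary:
  assumes nu: "\<nu> > 0" and r: "r > 0" and t: "t > 0"
  obtains P where "norm P = 1"
    "\<And>s. s > 0 \<Longrightarrow> bessel_heat \<nu> (- (\<i> * of_real t)) r s =
       P * of_real (sqrt (1 / (2 * t)) * bessel_w \<nu> (1 / (2 * t) * r * s))
           * cis (- (1 / (2 * t)) * s\<^sup>2 / 2)"
proof -
  define z where "z = - (\<i> * of_real t)"
  have z0: "z \<noteq> 0" using t by (simp add: z_def)
  define l where "l = 1 / (2 * t)"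
  have l: "l > 0" using t by (simp add: l_def)
  define P where "P = z powr (- of_real (\<nu> + 1)) * of_real (t powr (\<nu> + 1)) * cis (- l * r\<^sup>2 / 2)"
  have "norm (z powr (of_real (- (\<nu> + 1)))) = norm z powr (- (\<nu> + 1))"
      by (subst norm_powr_real_powr') auto
  moreover have "norm z = t" using t by (simp add: z_def norm_mult)
  moreover have "t powr (- \<nu> - 1) * t powr (\<nu> + 1) = 1" using t by (simp flip: powr_add)
  ultimately have "norm P = 1" unfolding P_def norm_mult using t by simp
  moreover have "bessel_heat \<nu> z r s = P * of_real (sqrt l * bessel_w \<nu> (l * r * s))
      * cis (- l * s\<^sup>2 / 2)" if s: "s > 0" for s
  proof -
    have z2: "of_real ((r * s)\<^sup>2) / (16 * z\<^sup>2) = (of_real (- ((l * r * s)\<^sup>2) / 4) :: complex)"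
      using t by (simp add: z_def l_def power_mult_distrib power_divide)
    have ex: "exp (- (of_real (r\<^sup>2 + s\<^sup>2) / (4 * z))) = cis (- l * r\<^sup>2 / 2) * cis (- l * s\<^sup>2 / 2)"
    proof -
      have "- (of_real (r\<^sup>2 + s\<^sup>2) / (4 * z)) = \<i> * of_real (- l * r\<^sup>2 / 2 + - l * s\<^sup>2 / 2)"
        using t by (simp add: z_def l_def divide_simps) (simp add: algebra_simps)
      then show ?thesis unfolding cis_mult by (simp only: cis_conv_exp)
    qed
    have "sqrt l * bessel_w \<nu> (l * r * s) = sqrt (r * s) * (r * s / 4) powr \<nu> / 2 * t powr (- (\<nu> + 1))
        * bessel_clifford \<nu> (- ((l * r * s)\<^sup>2) / 4)"
    proof -
      have "(l * r * s) powr (\<nu> + 1/2) = l powr (\<nu> + 1/2) * ((r * s) powr \<nu> * sqrt (r * s))"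
      proof -
        have "(l * r * s) powr (\<nu> + 1/2) = l powr (\<nu> + 1/2) * (r * s) powr (\<nu> + 1/2)"
          using l r s powr_mult[of l "r * s" "\<nu> + 1/2"] by (simp add: mult.assoc)
        also have "(r * s) powr (\<nu> + 1/2) = (r * s) powr \<nu> * sqrt (r * s)"
          using r s by (simp add: powr_add powr_half_sqrt)
        finally show ?thesis .
      qed
      moreover have "sqrt l * l powr (\<nu> + 1/2) = l powr (\<nu> + 1)"
      proof -
        have "sqrt l = l powr (1/2)" using l by (simp add: powr_half_sqrt)
        then show ?thesis by (simp add: add.commute flip: powr_add)
      qed
      moreover have "l powr (\<nu> + 1) = 2 powr (- \<nu>) / 2 * t powr (- (\<nu> + 1))"
      proof -
        have "t powr (- (\<nu> + 1)) = 1 / (t powr \<nu> * t)"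
          unfolding powr_minus_divide powr_add using t by simp
        then show ?thesis
          unfolding l_def using t by (simp only:) (simp add: powr_divide powr_mult powr_minus_divide
              powr_add)
      qed
      moreover have "(r * s / 4) powr \<nu> = (r * s) powr \<nu> * (2 powr (-\<nu>) * 2 powr (-\<nu>))"
      proof -
        have "2 powr (-\<nu>) * 2 powr (-\<nu>) = (1/4) powr \<nu>"
          by (simp add: powr_minus_divide powr_divide powr_mult[symmetric])
        then show ?thesis using r s powr_mult[of "r * s" "1/4" \<nu>] by simp
      qed
      ultimately show ?thesis
        using bessel_w_eq[OF nu, of "l * r * s"] l r s by simp
    qed
    then have e: "of_real (sqrt l * bessel_w \<nu> (l * r * s))
        = of_real (sqrt (r * s) * (r * s / 4) powr \<nu> / 2) * of_real (t powr (- (\<nu> + 1)))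
        * complex_of_real (bessel_clifford \<nu> (- ((l * r * s)\<^sup>2) / 4))"
      by (simp only: of_real_mult)
    have T: "complex_of_real (t powr (\<nu> + 1)) * of_real (t powr (- (\<nu> + 1))) = 1"
    proof -
      have "t powr (\<nu> + 1) * t powr (- (\<nu> + 1)) = 1" unfolding powr_add[symmetric] using t by simp
      then show ?thesis by (simp only: of_real_mult[symmetric] of_real_1)
    qed
    have gen: "a * Z * (\<Phi> * (c1 * c2)) = Z * T * c1 * (a * T' * \<Phi>) * c2" if "T * T' = 1"
        for a Z \<Phi> c1 c2 T T' :: complex
    proof -
      have "Z * T * c1 * (a * T' * \<Phi>) * c2 = a * Z * (\<Phi> * (c1 * c2)) * (T * T')" by (simp only: mult_ac)
      then show ?thesis using that by simp
    qed
    show ?thesis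
      unfolding bessel_heat_def z2 bessel_clifford_of_real[OF nu] ex P_def e by (rule gen[OF T])
  qed
  ultimately show ?thesis using that[of P] unfolding z_def l_def by blast
qed

section \<open>Passage from the heat kernel to imaginary time\<close>

lemma set_integrable_inverse_1_plus_square: "set_integrable lborel {0..} (\<lambda>x::real. inverse (1 + x\<^sup>2))"
proof -
  have "einterval (-\<infinity>) \<infinity> = (UNIV :: real set)" by (simp add: einterval_def)
  then have "set_integrable lborel UNIV (\<lambda>x::real. inverse (1 + x\<^sup>2))"
    using integrable_inverse_1_plus_square by simp
  then show ?thesis by (rule set_integrable_subset) auto
qed

text \<open>The Gaussian factor \<open>exp (- \<epsilon> \<rho>\<^sup>2)\<close> justifies the interchange of integrations; it is removed
  by dominated convergence on both sides.\<close>

lemma schroedinger_kernel: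
  fixes G G1 G2 :: "real \<Rightarrow> complex"
  assumes nu: "\<nu> > 0" and pq: "0 < p" "p \<le> q"
    and G: "\<And>s. s > 0 \<Longrightarrow> (G has_vector_derivative G1 s) (at s)"
    and G1: "\<And>s. s > 0 \<Longrightarrow> (G1 has_vector_derivative G2 s) (at s)"
    and G2: "continuous_on {0<..} G2"
    and bd: "G p = 0" "G q = 0" "G1 p = 0" "G1 q = 0"
    and r: "r > 0" and t: "t > 0"
  shows "((\<lambda>R. LINT \<rho>:{0..R}|lborel. of_real (bessel_w \<nu> (r * \<rho>)) * cis (t * \<rho>\<^sup>2) *
            (LINT s:{p..q}|lborel. of_real (bessel_w \<nu> (s * \<rho>)) * G s))
     \<longlongrightarrow> (LINT s:{p..q}|lborel. bessel_heat \<nu> (- (\<i> * of_real t)) r s * G s)) at_top"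
proof -
  obtain W where W: "W \<ge> 0" "\<And>z. z > 0 \<Longrightarrow> \<bar>bessel_w \<nu> z\<bar> \<le> W"
      by (rule bessel_w_bounded[OF nu]) (rule that)
  have wpW: "\<bar>bessel_wp \<nu> z\<bar> \<le> W" for z using W by (simp add: bessel_wp_def indicator_def)
  note [measurable] = borel_measurable_bessel_wp[OF nu]
  obtain K where K: "K \<ge> 0" "\<And>\<rho>. \<rho> > 0 \<Longrightarrow> norm (LINT s:{p..q}|lborel. of_real (bessel_w \<nu> (s * \<rho>))
      * G s) \<le> K * inverse (1 + \<rho>\<^sup>2)"
    by (rule bessel_transform_decay[OF nu pq G G1 G2 bd]) (assumption, assumption, rule that)
  have cG: "continuous_on {p..q} G" using pq
    by (intro continuous_at_imp_continuous_on ballI has_vector_derivative_continuous[OF G]) auto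
  define G0 where "G0 s = indicator {p..q} s *\<^sub>R G s" for s
  have G0m [measurable]: "G0 \<in> borel_measurable borel"
    using borel_measurable_continuous_on_indicator[OF _ cG] by (simp add: G0_def[abs_def])
  have G0i: "integrable lborel G0"
    using borel_integrable_atLeastAtMost'[OF cG] by (simp add: G0_def[abs_def] set_integrable_def)
  define B where "B \<rho> = (LINT s|lborel. of_real (bessel_wp \<nu> (s * \<rho>)) * G0 s)" for \<rho>
  have Bm [measurable]: "B \<in> borel_measurable borel"
    unfolding B_def[abs_def] by (rule lborel.borel_measurable_lebesgue_integral) simp
  have B_eq: "B \<rho> = (LINT s:{p..q}|lborel. of_real (bessel_w \<nu> (s * \<rho>)) * G s)" if "\<rho> > 0" for \<rho>
    unfolding B_def set_lebesgue_integral_def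
    by (rule Bochner_Integration.integral_cong) (use that pq in \<open>auto simp: G0_def bessel_wp_def
        indicator_def\<close>)
  define f where "f \<rho> = of_real (bessel_wp \<nu> (r * \<rho>)) * B \<rho>" for \<rho>
  have fm [measurable]: "f \<in> borel_measurable borel" unfolding f_def[abs_def] by measurable
  have f0: "f \<rho> = 0" if "\<rho> \<le> 0" for \<rho>
    using that r by (simp add: f_def bessel_wp_def zero_less_mult_iff)
  \<comment> \<open>The quadratic decay of \<open>B\<close> gives one integrable majorant for all
    \<open>z\<close> with \<open>Re z \<ge> 0\<close>, including the imaginary axis.\<close>
  have fb: "norm (f \<rho>) \<le> W * K * (indicator {0..} \<rho> * inverse (1 + \<rho>\<^sup>2))" for \<rho>
  proof (cases "\<rho> > 0")
    case True
    then have "norm (f \<rho>) \<le> W * (K * inverse (1 + \<rho>\<^sup>2))"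
      unfolding f_def norm_mult norm_of_real using K(2)[OF True] wpW W
      by (intro mult_mono) (auto simp: B_eq)
    then show ?thesis using True by (simp add: mult_ac)
  qed (use f0 W K in \<open>simp add: add_nonneg_nonneg\<close>)
  have di: "integrable lborel (\<lambda>\<rho>. W * K * (indicator {0..} \<rho> * inverse (1 + \<rho>\<^sup>2)))"
    using set_integrable_inverse_1_plus_square by (auto simp: set_integrable_def)
  have int: "integrable lborel (\<lambda>\<rho>. f \<rho> * exp (- (z * of_real (\<rho>\<^sup>2))))" if "Re z \<ge> 0" for z
  proof (rule Bochner_Integration.integrable_bound[OF di])
    show "AE \<rho> in lborel. norm (f \<rho> * exp (- (z * of_real (\<rho>\<^sup>2))))
        \<le> norm (W * K * (indicator {0..} \<rho> * inverse (1 + \<rho>\<^sup>2)))"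
    proof (rule AE_I2)
      fix \<rho>
      have "norm (exp (- (z * of_real (\<rho>\<^sup>2)))) \<le> 1" using that by simp
      then have "norm (f \<rho> * exp (- (z * of_real (\<rho>\<^sup>2)))) \<le> norm (f \<rho>)"
        unfolding norm_mult by (rule mult_left_le) simp
      also note fb
      finally show "norm (f \<rho> * exp (- (z * of_real (\<rho>\<^sup>2))))
          \<le> norm (W * K * (indicator {0..} \<rho> * inverse (1 + \<rho>\<^sup>2)))"
        by (rule order_trans) simp
    qed
  qed simp
  \<comment> \<open>Approach to the imaginary axis through the open half plane, where Weber's
    formula applies. At the limit \<open>- \<i> * t\<close> the factor
    \<open>exp (- z * \<rho>^2)\<close> is \<open>cis (t * \<rho>^2)\<close>.\<close>
  define z where "z n = of_real (1 / real (Suc n)) - \<i> * of_real t" for n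
  have zR: "Re (z n) > 0" for n by (simp add: z_def)
  have zl: "z \<longlonglongrightarrow> - (\<i> * of_real t)"
  proof -
    have "(\<lambda>n. 1 / real (Suc n)) \<longlonglongrightarrow> 0" using LIMSEQ_inverse_real_of_nat by (simp add: inverse_eq_divide)
    from tendsto_of_real[OF this, where 'a = complex]
    have "(\<lambda>n. complex_of_real (1 / real (Suc n)) - \<i> * of_real t) \<longlonglongrightarrow> 0 - \<i> * of_real t"
        by (intro tendsto_diff) auto
    then show ?thesis unfolding z_def by simp
  qed
  define U where "U z = (LINT \<rho>|lborel. f \<rho> * exp (- (z * of_real (\<rho>\<^sup>2))))" for z
  have U1: "(\<lambda>n. U (z n)) \<longlonglongrightarrow> U (- (\<i> * of_real t))"
    unfolding U_def
  proof (rule integral_dominated_convergence[where w = "\<lambda>\<rho>. W * K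
      * (indicator {0..} \<rho> * inverse (1 + \<rho>\<^sup>2))"])
    show "AE \<rho> in lborel. norm (f \<rho> * exp (- (z n * of_real (\<rho>\<^sup>2)))) \<le> W * K
        * (indicator {0..} \<rho> * inverse (1 + \<rho>\<^sup>2))" for n
    proof (rule AE_I2)
      fix \<rho>
      have "norm (exp (- (z n * of_real (\<rho>\<^sup>2)))) \<le> 1" using zR[of n] by (simp add: less_imp_le)
      then have "norm (f \<rho> * exp (- (z n * of_real (\<rho>\<^sup>2)))) \<le> norm (f \<rho>)"
        unfolding norm_mult by (rule mult_left_le) simp
      also note fb
      finally show "norm (f \<rho> * exp (- (z n * of_real (\<rho>\<^sup>2)))) \<le> W * K
          * (indicator {0..} \<rho> * inverse (1 + \<rho>\<^sup>2))" .
    qed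
    show "AE \<rho> in lborel. (\<lambda>n. f \<rho> * exp (- (z n * of_real (\<rho>\<^sup>2)))) \<longlonglongrightarrow> f \<rho>
        * exp (- (- (\<i> * of_real t) * of_real (\<rho>\<^sup>2)))"
      by (intro AE_I2 tendsto_intros zl)
  qed (use di in auto)
  have U2: "U z = (LINT s|lborel. bessel_heat \<nu> z r s * G0 s)" if z: "Re z > 0" for z
  proof -
    define g where "g \<rho> = of_real (bessel_wp \<nu> (r * \<rho>)) * exp (- (z * of_real (\<rho>\<^sup>2)))" for \<rho>
    have gm [measurable]: "g \<in> borel_measurable borel" unfolding g_def[abs_def] by measurable
    define F where "F \<rho> s = g \<rho> * (of_real (bessel_wp \<nu> (s * \<rho>)) * G0 s)" for \<rho> s
    have Fi: "integrable (lborel \<Otimes>\<^sub>M lborel) (case_prod F)"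
    proof (rule lborel_pair.Fubini_integrable)
      show "case_prod F \<in> borel_measurable (lborel \<Otimes>\<^sub>M lborel)" unfolding F_def[abs_def] by simp
      have Fb: "norm (F \<rho> s) \<le> norm (W * norm (g \<rho>) * norm (G0 s))" for \<rho> s
        using W mult_right_mono[OF wpW[of "s * \<rho>"], of "norm (g \<rho>) * norm (G0 s)"]
        by (simp add: F_def norm_mult mult_ac)
      have Gn: "integrable lborel (\<lambda>s. k * norm (G0 s))" for k :: real
        using integrable_norm[OF G0i] by (rule integrable_mult_right)
      have Fs: "integrable lborel (F \<rho>)" for \<rho>
        by (rule Bochner_Integration.integrable_bound[OF Gn[of "W * norm (g \<rho>)"]])
            (use Fb in \<open>auto simp: F_def[abs_def]\<close>)
      then show "AE \<rho> in lborel. integrable lborel (\<lambda>s. case (\<rho>, s) of (x, xa) \<Rightarrow> F x xa)" by simp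
      \<comment> \<open>The moment with \<open>q = 1/2\<close>: its power of \<open>\<rho>\<close>
        is trivial, so this is integrability of the plain Gaussian, which dominates because
        \<open>bessel_wp\<close> is bounded.\<close>
      have "set_integrable lborel {0<..} (\<lambda>\<rho>. (W * W)
          * (\<rho> powr (2 * (1/2) - 1) * exp (- (Re z * \<rho>\<^sup>2))))"
        by (intro set_integrable_mult_right gaussian_moment_real z) simp
      then have E: "integrable lborel (\<lambda>\<rho>. indicator {0<..} \<rho>
          *\<^sub>R ((W * W) * (\<rho> powr (2 * (1/2) - 1) * exp (- (Re z * \<rho>\<^sup>2))))
          * (LINT s|lborel. norm (G0 s)))"
        unfolding set_integrable_def by (rule integrable_mult_left)
      have "integrable lborel (\<lambda>\<rho>. LINT s|lborel. norm (F \<rho> s))"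
      proof (rule Bochner_Integration.integrable_bound[OF E])
        show "(\<lambda>\<rho>. LINT s|lborel. norm (F \<rho> s)) \<in> borel_measurable lborel"
          unfolding F_def[abs_def] by simp
        show "AE \<rho> in lborel. norm (LINT s|lborel. norm (F \<rho> s))
            \<le> norm (indicator {0<..} \<rho> *\<^sub>R ((W * W) * (\<rho> powr (2 * (1/2) - 1) * exp (- (Re z * \<rho>\<^sup>2))))
            * (LINT s|lborel. norm (G0 s)))"
        proof (rule AE_I2)
          fix \<rho>
          have "(LINT s|lborel. norm (F \<rho> s)) \<le> (LINT s|lborel. W * norm (g \<rho>) * norm (G0 s))"
            using Fb W by (intro integral_mono integrable_norm Fs Gn) auto
          also have "\<dots> = W * norm (g \<rho>) * (LINT s|lborel. norm (G0 s))" by simp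
          also have "\<dots> \<le> indicator {0<..} \<rho> *\<^sub>R ((W * W)
              * (\<rho> powr (2 * (1/2) - 1) * exp (- (Re z * \<rho>\<^sup>2)))) * (LINT s|lborel. norm (G0 s))"
          proof (rule mult_right_mono)
            show "W * norm (g \<rho>) \<le> indicator {0<..} \<rho>
                *\<^sub>R ((W * W) * (\<rho> powr (2 * (1/2) - 1) * exp (- (Re z * \<rho>\<^sup>2))))"
            proof (cases "\<rho> > 0")
              case True
              have "norm (g \<rho>) \<le> W * exp (- (Re z * \<rho>\<^sup>2))"
                unfolding g_def norm_mult norm_of_real using wpW by (intro mult_mono W) auto
              then show ?thesis using True W by (simp add: mult.assoc mult_left_mono)
            qed (use r in \<open>simp add: g_def bessel_wp_def zero_less_mult_iff\<close>)
          qed simp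
          finally show "norm (LINT s|lborel. norm (F \<rho> s))
              \<le> norm (indicator {0<..} \<rho> *\<^sub>R ((W * W)
              * (\<rho> powr (2 * (1/2) - 1) * exp (- (Re z * \<rho>\<^sup>2)))) * (LINT s|lborel. norm (G0 s)))"
            by (simp add: abs_mult del: scaleR_conv_of_real)
        qed
      qed
      then show "integrable lborel (\<lambda>x. LINT y|lborel. norm (case (x, y) of (x, xa) \<Rightarrow> F x xa))" by simp
    qed
    have "U z = (LINT \<rho>|lborel. LINT s|lborel. F \<rho> s)"
      unfolding U_def F_def f_def B_def g_def integral_mult_right_zero by (simp only: mult_ac)
    also have "\<dots> = (LINT s|lborel. LINT \<rho>|lborel. F \<rho> s)"
      by (rule lborel_pair.Fubini_integral[OF Fi, symmetric])
    also have "\<dots> = (LINT s|lborel. bessel_heat \<nu> z r s * G0 s)"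
    proof (rule Bochner_Integration.integral_cong[OF refl])
      fix s
      show "(LINT \<rho>|lborel. F \<rho> s) = bessel_heat \<nu> z r s * G0 s"
      proof (cases "s \<in> {p..q}")
        case True
        then have s: "s > 0" using pq by simp
        have "(LINT \<rho>|lborel. F \<rho> s) = (LINT \<rho>|lborel.
            (indicator {0<..} \<rho> *\<^sub>R (of_real (bessel_w \<nu> (r * \<rho>) * bessel_w \<nu> (s * \<rho>))
            * exp (- (z * of_real (\<rho>\<^sup>2))))) * G0 s)"
          by (rule Bochner_Integration.integral_cong[OF refl])
             (use r s in \<open>auto simp: F_def g_def bessel_wp_def indicator_def zero_less_mult_iff\<close>)
        also have "\<dots> = (LINT \<rho>:{0<..}|lborel. of_real (bessel_w \<nu> (r * \<rho>) * bessel_w \<nu> (s * \<rho>))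
            * exp (- (z * of_real (\<rho>\<^sup>2)))) * G0 s"
          unfolding set_lebesgue_integral_def by (rule integral_mult_left_zero)
        also have "\<dots> = bessel_heat \<nu> z r s * G0 s"
          unfolding weber_integral(2)[OF nu z r s] ..
        finally show ?thesis .
      qed (simp add: F_def G0_def)
    qed
    finally show ?thesis .
  qed
  \<comment> \<open>The kernel bound is increasing in \<open>s\<close>, so its value at the right
    end \<open>q\<close> serves for the whole interval.\<close>
  define M where "M = sqrt (r * q) * (r * q / 4) powr \<nu> / 2 * t powr (- (\<nu> + 1))
      * bessel_clifford \<nu> ((r * q)\<^sup>2 / (16 * t\<^sup>2))"
  have hM: "norm (bessel_heat \<nu> z r s) \<le> M" if "s \<in> {p..q}" "Re z \<ge> 0" "z \<noteq> 0" "norm z \<ge> t" for s z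
  proof -
    have s: "0 < s" "s \<le> q" using that pq by auto
    have "norm (bessel_heat \<nu> z r s) \<le> sqrt (r * s) * (r * s / 4) powr \<nu> / 2 * t powr (- (\<nu> + 1))
        * bessel_clifford \<nu> ((r * s)\<^sup>2 / (16 * t\<^sup>2))"
      by (rule norm_bessel_heat_le[OF nu r s(1) that(2-4) t])
    also have "\<dots> \<le> M" unfolding M_def
    proof (rule mult_mono[OF mult_right_mono[OF divide_right_mono[OF mult_mono]]])
      have rs: "r * s \<le> r * q" "0 \<le> r * s" using r s by auto
      show "sqrt (r * s) \<le> sqrt (r * q)" using rs by simp
      show "(r * s / 4) powr \<nu> \<le> (r * q / 4) powr \<nu>" using rs nu by (intro powr_mono2) auto
      have "(r * s)\<^sup>2 \<le> (r * q)\<^sup>2" using rs by (intro power_mono)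
      then show "bessel_clifford \<nu> ((r * s)\<^sup>2 / (16 * t\<^sup>2))
          \<le> bessel_clifford \<nu> ((r * q)\<^sup>2 / (16 * t\<^sup>2))"
        by (intro bessel_clifford_mono nu divide_right_mono) auto
      have "0 \<le> norm (bessel_clifford \<nu> ((r * s)\<^sup>2 / (16 * t\<^sup>2)))" by simp
      also have "\<dots> \<le> bessel_clifford \<nu> ((r * s)\<^sup>2 / (16 * t\<^sup>2))"
          using norm_bessel_clifford_le[OF nu, of "(r * s)\<^sup>2 / (16 * t\<^sup>2)"] by simp
      finally show "0 \<le> bessel_clifford \<nu> ((r * s)\<^sup>2 / (16 * t\<^sup>2))" .
    qed (use r s pq in auto)
    finally show ?thesis .
  qed
  have hc: "isCont (\<lambda>z. bessel_heat \<nu> z r s) (- (\<i> * of_real t))" for s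
  proof -
    define z0 where "z0 = - (\<i> * complex_of_real t)"
    have z0: "z0 \<notin> \<real>\<^sub>\<le>\<^sub>0" "z0 \<noteq> 0" using t by (auto simp: complex_nonpos_Reals_iff z0_def)
    have 1: "isCont (\<lambda>z. z powr (- of_real (\<nu> + 1))) z0"
      by (rule isCont_powr_complex) (use z0 in simp_all)
    have 2: "isCont (\<lambda>z. of_real ((r * s)\<^sup>2) / (16 * z\<^sup>2)) z0"
      using z0(2) by (intro continuous_intros) auto
    have 3: "isCont (\<lambda>z. bessel_clifford \<nu> (of_real ((r * s)\<^sup>2) / (16 * z\<^sup>2))) z0"
      by (rule isCont_o2[OF 2 DERIV_isCont[OF has_field_derivative_bessel_clifford[OF nu]]])
    have 4: "isCont (\<lambda>z. exp (- (of_real (r\<^sup>2 + s\<^sup>2) / (4 * z)))) z0"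
      using z0(2) by (intro continuous_intros) auto
    show ?thesis
      unfolding bessel_heat_def z0_def[symmetric] by (intro continuous_mult continuous_const 1 3 4)
  qed
  have hm [measurable]: "(\<lambda>s. bessel_heat \<nu> z r s * G0 s) \<in> borel_measurable borel" for z
  proof -
    have "continuous_on UNIV (bessel_clifford \<nu> :: complex \<Rightarrow> complex)"
      by (auto intro!: continuous_at_imp_continuous_on
          DERIV_isCont[OF has_field_derivative_bessel_clifford[OF nu]])
    then have [measurable]: "(bessel_clifford \<nu> :: complex \<Rightarrow> complex) \<in> borel_measurable borel"
        by (rule borel_measurable_continuous_onI)
    show ?thesis unfolding bessel_heat_def by measurable
  qed
  have U3: "(\<lambda>n. LINT s|lborel. bessel_heat \<nu> (z n) r s * G0 s)
      \<longlonglongrightarrow> (LINT s|lborel. bessel_heat \<nu> (- (\<i> * of_real t)) r s * G0 s)"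
  proof (rule integral_dominated_convergence[where w = "\<lambda>s. M * norm (G0 s)"])
    show "integrable lborel (\<lambda>s. M * norm (G0 s))" using integrable_norm[OF G0i]
        by (rule integrable_mult_right)
    show "AE s in lborel. (\<lambda>n. bessel_heat \<nu> (z n) r s * G0 s) \<longlonglongrightarrow> bessel_heat \<nu> (- (\<i> * of_real t)) r s
        * G0 s"
      by (intro AE_I2 tendsto_mult tendsto_const isCont_tendsto_compose[OF hc zl])
    show "AE s in lborel. norm (bessel_heat \<nu> (z n) r s * G0 s) \<le> M * norm (G0 s)" for n
    proof (rule AE_I2)
      fix s
      have "norm (z n) \<ge> t" using abs_Im_le_cmod[of "z n"] t by (simp add: z_def)
      moreover have "z n \<noteq> 0" "Re (z n) \<ge> 0" using zR[of n] by auto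
      ultimately show "norm (bessel_heat \<nu> (z n) r s * G0 s) \<le> M * norm (G0 s)"
        using hM[of s "z n"] by (cases "s \<in> {p..q}")
            (auto simp: norm_mult G0_def intro!: mult_right_mono)
    qed
  qed simp_all
  have "U (- (\<i> * of_real t)) = (LINT s|lborel. bessel_heat \<nu> (- (\<i> * of_real t)) r s * G0 s)"
    using LIMSEQ_unique[OF U1] U3 U2[OF zR] by simp
  also have "\<dots> = (LINT s:{p..q}|lborel. bessel_heat \<nu> (- (\<i> * of_real t)) r s * G s)"
    unfolding set_lebesgue_integral_def G0_def by simp
  finally have UU: "U (- (\<i> * of_real t)) = (LINT s:{p..q}|lborel. bessel_heat \<nu> (- (\<i> * of_real t)) r
      s * G s)" .
  \<comment> \<open>The limit integrand is absolutely integrable, so the truncated integrals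
    converge to the full one; since \<open>f\<close> vanishes on the negative axis, truncation to
    \<open>{..R}\<close> is truncation to \<open>{0..R}\<close>.\<close>
  have "((\<lambda>R. LINT \<rho>|lborel. indicator {..R} \<rho> *\<^sub>R (f \<rho> * exp (- (- (\<i> * of_real t) * of_real (\<rho>\<^sup>2)))))
      \<longlongrightarrow> U (- (\<i> * of_real t))) at_top"
    unfolding U_def by (rule tendsto_integral_at_top[OF _ int]) simp_all
  moreover have "(LINT \<rho>|lborel. indicator {..R} \<rho> *\<^sub>R
      (f \<rho> * exp (- (- (\<i> * of_real t) * of_real (\<rho>\<^sup>2))))) =
      (LINT \<rho>:{0..R}|lborel. of_real (bessel_w \<nu> (r * \<rho>)) * cis (t * \<rho>\<^sup>2) *
            (LINT s:{p..q}|lborel. of_real (bessel_w \<nu> (s * \<rho>)) * G s))" for R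
    unfolding set_lebesgue_integral_def[of _ "{0..R}"]
  proof (rule Bochner_Integration.integral_cong[OF refl])
    fix \<rho>
    have "exp (- (- (\<i> * of_real t) * of_real (\<rho>\<^sup>2))) = cis (t * \<rho>\<^sup>2)"
        by (simp add: cis_conv_exp mult.assoc)
    moreover have "f \<rho> = of_real (bessel_w \<nu> (r * \<rho>))
        * (LINT s:{p..q}|lborel. of_real (bessel_w \<nu> (s * \<rho>)) * G s)" if "\<rho> > 0"
      using that r by (simp add: f_def B_eq bessel_wp_eq)
    moreover have "bessel_w \<nu> 0 = 0" by (simp add: bessel_w_def)
    ultimately show "indicator {..R} \<rho> *\<^sub>R (f \<rho> * exp (- (- (\<i> * of_real t) * of_real (\<rho>\<^sup>2)))) =
       indicator {0..R} \<rho> *\<^sub>R (of_real (bessel_w \<nu> (r * \<rho>)) * cis (t * \<rho>\<^sup>2)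
           * (LINT s:{p..q}|lborel. of_real (bessel_w \<nu> (s * \<rho>)) * G s))"
      using f0[of \<rho>] by (cases "\<rho> > 0"; cases "\<rho> = 0") (auto simp: indicator_def)
  qed
  ultimately show ?thesis using UU by simp
qed

section \<open>Fourier transform and Sobolev norm\<close>

lemma gaussian_fourier_real:
  fixes e v :: real
  assumes e: "e > 0"
  shows "integrable lborel (\<lambda>x. of_real (exp (- (e\<^sup>2 * x\<^sup>2 / 2))) * cis (- (v * x)))"
    and "(LINT x|lborel. of_real (exp (- (e\<^sup>2 * x\<^sup>2 / 2))) * cis (- (v * x)))
        = of_real (sqrt (2 * pi) / e * exp (- (v\<^sup>2 / (2 * e\<^sup>2))))"
proof -
  define f where "f x = of_real (exp (- (e\<^sup>2 * x\<^sup>2 / 2))) * cis (- (v * x))" for x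
  have eq: "f (0 + (1 / e) * x) = of_real (sqrt (2 * pi))
      * (of_real (std_normal_density x) * iexp ((- v / e) * x))" for x
    using e by (simp add: f_def std_normal_density_def power_divide cis_conv_exp mult_ac)
  have i1: "integrable lborel (\<lambda>x. of_real (std_normal_density x) * iexp ((- v / e) * x))"
  proof (rule Bochner_Integration.integrable_bound[OF integrable_normal_moment[of 1 0 0]])
    show "AE x in lborel. norm (of_real (std_normal_density x) * iexp ((- v / e) * x))
        \<le> norm (std_normal_density x * (x - 0) ^ 0)"
      by (simp add: norm_mult)
  qed auto
  then have i2: "integrable lborel (\<lambda>x. f (0 + (1 / e) * x))"
    unfolding eq by (rule integrable_mult_right)
  then show "integrable lborel (\<lambda>x. of_real (exp (- (e\<^sup>2 * x\<^sup>2 / 2))) * cis (- (v * x)))"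
    using e lborel_integrable_real_affine_iff[of "1 / e" f 0] by (simp add: f_def[abs_def])
  have "(LINT x|lborel. of_real (std_normal_density x) * iexp ((- v / e) * x))
      = char std_normal_distribution (- v / e)"
    unfolding char_def by (subst integral_density) (auto simp: scaleR_conv_of_real)
  also have "\<dots> = of_real (exp (- ((- v / e)\<^sup>2) / 2))" by (simp only: char_std_normal_distribution)
  finally have c: "(LINT x|lborel. of_real (std_normal_density x) * iexp ((- v / e) * x))
      = of_real (exp (- ((- v / e)\<^sup>2) / 2))" .
  have "(LINT x|lborel. f x) = \<bar>1 / e\<bar> *\<^sub>R (LINT x|lborel. f (0 + (1 / e) * x))"
    by (rule lborel_integral_real_affine) (use e in simp)
  also have "\<dots> = of_real (1 / e) * (of_real (sqrt (2 * pi)) * of_real (exp (- ((- v / e)\<^sup>2) / 2)))"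
    unfolding eq integral_mult_right_zero c using e by (simp add: scaleR_conv_of_real)
  also have "\<dots> = of_real (sqrt (2 * pi) / e * exp (- (v\<^sup>2 / (2 * e\<^sup>2))))"
    using e by (simp add: power_divide)
  finally show "(LINT x|lborel. of_real (exp (- (e\<^sup>2 * x\<^sup>2 / 2))) * cis (- (v * x)))
      = of_real (sqrt (2 * pi) / e * exp (- (v\<^sup>2 / (2 * e\<^sup>2))))"
    unfolding f_def .
qed

text \<open>\<open>lborel\<close> is the image of the product of one-dimensional Lebesgue measures
  over the basis, so tensor products integrate factor by factor.\<close>

lemma lborel_integral_prod_Basis:
  fixes f :: "'a::euclidean_space \<Rightarrow> real \<Rightarrow> complex"
  assumes "\<And>b. b \<in> Basis \<Longrightarrow> integrable lborel (f b)"
  shows "integrable lborel (\<lambda>x::'a. \<Prod>b\<in>Basis. f b (x \<bullet> b))"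
    and "(LINT x|lborel. (\<Prod>b\<in>Basis. f b (x \<bullet> b))) = (\<Prod>b\<in>Basis. LINT t|lborel. f b t)"
proof -
  interpret product_sigma_finite "\<lambda>b::'a. lborel :: real measure" ..
  have fm [measurable]: "f b \<in> borel_measurable borel" if "b \<in> Basis" for b using assms[OF that] by auto
  have m: "(\<lambda>x::'a. \<Prod>b\<in>Basis. f b (x \<bullet> b)) \<in> borel_measurable borel" by measurable
  have T: "(\<lambda>g. \<Sum>b\<in>Basis. g b *\<^sub>R b) \<in> measurable (\<Pi>\<^sub>M b\<in>Basis. lborel) (borel :: 'a measure)"
      by measurable
  have eq: "(\<Prod>b\<in>Basis. f b ((\<Sum>c\<in>Basis. g c *\<^sub>R c) \<bullet> b)) = (\<Prod>b\<in>Basis. f b (g b))" for g :: "'a \<Rightarrow> real"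
    by (rule prod.cong) (auto simp: inner_sum_left_Basis)
  show "integrable lborel (\<lambda>x::'a. \<Prod>b\<in>Basis. f b (x \<bullet> b))"
    unfolding lborel_eq[where 'a='a] integrable_distr_eq[OF T m] eq
    by (rule product_integrable_prod) (use assms in auto)
  show "(LINT x|lborel. (\<Prod>b\<in>Basis. f b (x \<bullet> b))) = (\<Prod>b\<in>Basis. LINT t|lborel. f b t)"
    unfolding lborel_eq[where 'a='a] integral_distr[OF T m] eq
    by (rule product_integral_prod) (use assms in auto)
qed

lemma gaussian_fourier:
  fixes v :: "'a::euclidean_space"
  assumes e: "e > 0"
  shows "integrable lborel (\<lambda>x. of_real (exp (- (e\<^sup>2 * (norm x)\<^sup>2 / 2))) * cis (- (v \<bullet> x)))"
    and "(LINT x|lborel. of_real (exp (- (e\<^sup>2 * (norm x)\<^sup>2 / 2))) * cis (- (v \<bullet> x)))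
       = of_real ((sqrt (2 * pi) / e) ^ DIM('a) * exp (- ((norm v)\<^sup>2 / (2 * e\<^sup>2))))"
proof -
  have nrm: "(norm x)\<^sup>2 = (\<Sum>b\<in>Basis. (x \<bullet> b)\<^sup>2)" for x :: 'a
    unfolding power2_norm_eq_inner by (subst euclidean_inner) (simp add: power2_eq_square)
  have cis_sum: "cis (sum g A) = (\<Prod>b\<in>A. cis (g b))" if "finite A" for g and A :: "'a set"
    using that by induction (auto simp: cis_mult[symmetric])
  have eq: "of_real (exp (- (e\<^sup>2 * (norm x)\<^sup>2 / 2))) * cis (- (v \<bullet> x))
      = (\<Prod>b\<in>Basis. of_real (exp (- (e\<^sup>2 * (x \<bullet> b)\<^sup>2 / 2))) * cis (- ((v \<bullet> b) * (x \<bullet> b))))" for x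
  proof -
    have "exp (- (e\<^sup>2 * (norm x)\<^sup>2 / 2)) = (\<Prod>b\<in>Basis. exp (- (e\<^sup>2 * (x \<bullet> b)\<^sup>2 / 2)))"
      unfolding nrm by (simp add: exp_sum[symmetric] sum_distrib_left sum_divide_distrib sum_negf)
    moreover have "cis (- (v \<bullet> x)) = (\<Prod>b\<in>Basis. cis (- ((v \<bullet> b) * (x \<bullet> b))))"
      by (subst euclidean_inner) (simp add: cis_sum[symmetric] sum_negf)
    ultimately show ?thesis by (simp add: prod.distrib)
  qed
  note i = gaussian_fourier_real[OF e]
  show "integrable lborel (\<lambda>x. of_real (exp (- (e\<^sup>2 * (norm x)\<^sup>2 / 2))) * cis (- (v \<bullet> x)))"
    unfolding eq by (rule lborel_integral_prod_Basis) (rule i)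
  have "(LINT x|lborel. of_real (exp (- (e\<^sup>2 * (norm x)\<^sup>2 / 2))) * cis (- (v \<bullet> x)))
     = (\<Prod>b\<in>Basis. of_real (sqrt (2 * pi) / e * exp (- ((v \<bullet> b)\<^sup>2 / (2 * e\<^sup>2)))))"
    unfolding eq i(2)[symmetric] by (rule lborel_integral_prod_Basis) (rule i)
  also have "\<dots> = of_real ((sqrt (2 * pi) / e) ^ DIM('a) * exp (- ((norm v)\<^sup>2 / (2 * e\<^sup>2))))"
    unfolding nrm of_real_prod[symmetric] prod.distrib
        by (simp add: exp_sum[symmetric] sum_divide_distrib sum_negf)
  finally show "(LINT x|lborel. of_real (exp (- (e\<^sup>2 * (norm x)\<^sup>2 / 2))) * cis (- (v \<bullet> x)))
       = of_real ((sqrt (2 * pi) / e) ^ DIM('a) * exp (- ((norm v)\<^sup>2 / (2 * e\<^sup>2))))" .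
qed

text \<open>The mass does not depend on the width \<open>e\<close>; this is what makes the bound in
  \<open>plancherel_le\<close> uniform and becomes its constant.\<close>

lemma gaussian_integral:
  fixes y :: "'a::euclidean_space"
  assumes e: "e > 0"
  shows "(\<integral>\<^sup>+ x. ennreal ((sqrt (2 * pi) / e) ^ DIM('a) * exp (- ((norm (y - x))\<^sup>2 / (2 * e\<^sup>2))))
      \<partial>lborel) = ennreal ((2 * pi) ^ DIM('a))"
proof -
  define d where "d = 1 / e"
  have d: "d > 0" using e by (simp add: d_def)
  have c: "(\<lambda>x::'a. complex_of_real (exp (- (d\<^sup>2 * (norm x)\<^sup>2 / 2))) * cis (- (0 \<bullet> x)))
      = (\<lambda>x. of_real (exp (- (d\<^sup>2 * (norm x)\<^sup>2 / 2))))" by simp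
  have "integrable lborel (\<lambda>x::'a. Re (of_real (exp (- (d\<^sup>2 * (norm x)\<^sup>2 / 2)))))"
    using gaussian_fourier(1)[OF d, of "0::'a"] unfolding c by (rule integrable_Re)
  then have i: "integrable lborel (\<lambda>x::'a. exp (- (d\<^sup>2 * (norm x)\<^sup>2 / 2)))" by simp
  have I: "(LINT x::'a|lborel. exp (- (d\<^sup>2 * (norm x)\<^sup>2 / 2))) = (sqrt (2 * pi) / d) ^ DIM('a)"
    using gaussian_fourier(2)[OF d, of "0::'a"] unfolding c integral_complex_of_real
        by (simp flip: of_real_eq_iff[where 'a = complex])
  have "(\<integral>\<^sup>+ x. ennreal ((sqrt (2 * pi) / e) ^ DIM('a) * exp (- ((norm (y - x))\<^sup>2 / (2 * e\<^sup>2))))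
      \<partial>lborel)
     = ennreal ((sqrt (2 * pi) / e) ^ DIM('a)) * (\<integral>\<^sup>+ x. ennreal (exp (- (d\<^sup>2 * (norm (x - y))\<^sup>2 / 2)))
         \<partial>lborel)"
  proof (subst nn_integral_cmult[symmetric])
    have "ennreal (c * exp (- ((norm (y - x))\<^sup>2 / (2 * e\<^sup>2)))) = ennreal c
        * ennreal (exp (- (d\<^sup>2 * (norm (x - y))\<^sup>2 / 2)))" for c x
    proof -
      have "d\<^sup>2 * (norm (x - y))\<^sup>2 / 2 = (norm (y - x))\<^sup>2 / (2 * e\<^sup>2)"
        by (simp add: d_def power_divide norm_minus_commute)
      then show ?thesis by (simp only: ennreal_mult'' exp_ge_zero)
    qed
    then show "(\<integral>\<^sup>+ x. ennreal ((sqrt (2 * pi) / e) ^ DIM('a) * exp (- ((norm (y - x))\<^sup>2 / (2 * e\<^sup>2))))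
        \<partial>lborel)
      = (\<integral>\<^sup>+ x. ennreal ((sqrt (2 * pi) / e) ^ DIM('a))
          * ennreal (exp (- (d\<^sup>2 * (norm (x - y))\<^sup>2 / 2))) \<partial>lborel)"
      by simp
  qed measurable
  also have "(\<integral>\<^sup>+ x. ennreal (exp (- (d\<^sup>2 * (norm (x - y))\<^sup>2 / 2))) \<partial>lborel)
      = (\<integral>\<^sup>+ x. ennreal (exp (- (d\<^sup>2 * (norm (x::'a))\<^sup>2 / 2))) \<partial>distr lborel borel (\<lambda>x. - y + x))"
    by (subst nn_integral_distr) auto
  also have "\<dots> = (\<integral>\<^sup>+ x. ennreal (exp (- (d\<^sup>2 * (norm (x::'a))\<^sup>2 / 2))) \<partial>lborel)"
    unfolding lborel_distr_plus ..
  also have "\<dots> = ennreal ((sqrt (2 * pi) / d) ^ DIM('a))"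
    using nn_integral_eq_integral[OF i] I by simp
  also have "ennreal ((sqrt (2 * pi) / e) ^ DIM('a)) * ennreal ((sqrt (2 * pi) / d) ^ DIM('a))
      = ennreal ((2 * pi) ^ DIM('a))"
  proof -
    have "(sqrt (2 * pi) / e) * (sqrt (2 * pi) / d) = 2 * pi" using e by (simp add: d_def)
    then have "(sqrt (2 * pi) / e) ^ DIM('a) * (sqrt (2 * pi) / d) ^ DIM('a) = (2 * pi) ^ DIM('a)"
      by (simp only: power_mult_distrib[symmetric])
    then show ?thesis using d by (subst ennreal_mult''[symmetric]) auto
  qed
  finally show ?thesis .
qed

section \<open>Plancherel's inequality\<close>

lemma norm_integral_le_nn_integral:
  fixes f :: "'a \<Rightarrow> 'b::{banach, second_countable_topology}"
  shows "ennreal (norm (LINT x|M. f x)) \<le> (\<integral>\<^sup>+ x. ennreal (norm (f x)) \<partial>M)"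
  \<comment> \<open>Without integrability the left side is 0 by convention, so the bound holds in
    every case.\<close>
  by (cases "integrable M f") (auto intro: integral_norm_bound_ennreal simp: not_integrable_integral_eq)

lemma norm_fourier_le:
  assumes "integrable lborel u"
  shows "norm (fourier u \<xi>) \<le> (LINT x|lborel. norm (u x))"
proof -
  have "norm (fourier u \<xi>) \<le> (LINT x|lborel. norm (u x * cis (- (x \<bullet> \<xi>))))"
    unfolding fourier_def by (rule integral_norm_bound)
  then show ?thesis by (simp add: norm_mult)
qed

lemma borel_measurable_cis_inner [measurable (raw)]:
  assumes "f \<in> borel_measurable M" shows "(\<lambda>x. cis (f x)) \<in> borel_measurable M"
proof -
  have "cis \<in> borel_measurable borel"
    by (rule borel_measurable_continuous_onI) (intro continuous_intros)
  from measurable_compose[OF assms this] show ?thesis .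
qed

lemma borel_measurable_complex_cnj [measurable (raw)]:
  assumes "f \<in> borel_measurable M" shows "(\<lambda>x. cnj (f x)) \<in> borel_measurable M"
proof -
  have "cnj \<in> borel_measurable borel"
    by (rule borel_measurable_continuous_onI) (intro continuous_intros)
  from measurable_compose[OF assms this] show ?thesis .
qed

lemma borel_measurable_fourier [measurable]:
  assumes [measurable]: "u \<in> borel_measurable borel"
  shows "fourier u \<in> borel_measurable borel"
  unfolding fourier_def[abs_def]
  by (rule lborel.borel_measurable_lebesgue_integral) measurable

lemma integrable_mult_product:
  fixes f :: "'a::euclidean_space \<Rightarrow> complex" and g :: "'b::euclidean_space \<Rightarrow> complex"
  assumes f: "integrable lborel f" and g: "integrable lborel g"
    and m: "case_prod F \<in> borel_measurable (lborel \<Otimes>\<^sub>M lborel)"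
    and b: "\<And>x y. norm (F x y :: complex) \<le> norm (f x) * norm (g y)"
  shows "integrable (lborel \<Otimes>\<^sub>M lborel) (case_prod F)"
proof (rule Bochner_Integration.integrable_bound[OF _ m])
  have [measurable]: "f \<in> borel_measurable borel" "g \<in> borel_measurable borel" using f g by auto
  have gn: "integrable lborel (\<lambda>y. norm (g y))" using g by (rule integrable_norm)
  show "integrable (lborel \<Otimes>\<^sub>M lborel) (\<lambda>(x, y). norm (f x) * norm (g y))"
  proof (rule lborel_pair.Fubini_integrable)
    show "(\<lambda>(x, y). norm (f x) * norm (g y)) \<in> borel_measurable (lborel \<Otimes>\<^sub>M lborel)" by measurable
    show "integrable lborel (\<lambda>x. LINT y|lborel. norm (case (x, y) of (x, y) \<Rightarrow> norm (f x) * norm (g y)))"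
      using f by (simp add: abs_mult)
    show "AE x in lborel. integrable lborel (\<lambda>y. case (x, y) of (x, y) \<Rightarrow> norm (f x) * norm (g y))"
      using gn by simp
  qed
  show "AE p in lborel \<Otimes>\<^sub>M lborel. norm (case_prod F p)
      \<le> norm (case p of (x, y) \<Rightarrow> norm (f x) * norm (g y))"
    using b by (intro AE_I2) (auto split: prod.splits simp: abs_mult)
qed

text \<open>The Gaussian weight makes all integrals absolutely convergent; removing it by Fatou's lemma costs
  equality in Plancherel's formula, but the upper bound is all that is needed.\<close>

lemma gaussian_weighted_fourier:
  fixes u :: "real^'n::finite \<Rightarrow> complex"
  assumes u: "integrable lborel u" and e: "e > 0"
  defines "k \<equiv> (\<lambda>v::real^'n. (sqrt (2 * pi) / e) ^ DIM(real^'n) * exp (- ((norm v)\<^sup>2 / (2 * e\<^sup>2))))"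
  shows "(LINT \<xi>|lborel. (of_real (exp (- (e\<^sup>2 * (norm \<xi>)\<^sup>2 / 2))) * cnj (fourier u \<xi>)) * fourier u \<xi>)
     = (LINT x|lborel. (LINT y|lborel. cnj (u y) * of_real (k (x - y))) * u x)" (is "?lhs = ?rhs")
proof -
  have [measurable]: "u \<in> borel_measurable borel" using u by auto
  define g where "g \<xi> = complex_of_real (exp (- (e\<^sup>2 * (norm \<xi>)\<^sup>2 / 2)))" for \<xi> :: "real^'n"
  have gm [measurable]: "g \<in> borel_measurable borel" unfolding g_def[abs_def] by measurable
  have gi: "integrable lborel g" using gaussian_fourier(1)[OF e, of "0::real^'n"]
      by (simp add: g_def[abs_def])
  define B where "B = (LINT x|lborel. norm (u x))"
  have hu: "norm (fourier u \<xi>) \<le> B" for \<xi> unfolding B_def by (rule norm_fourier_le[OF u])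
  have B0: "B \<ge> 0" unfolding B_def by simp
  have gBi: "integrable lborel (\<lambda>\<xi>. of_real B * g \<xi>)" using gi by (rule integrable_mult_right)
  have kk: "(LINT \<xi>|lborel. g \<xi> * cis (- ((x - y) \<bullet> \<xi>))) = of_real (k (x - y))" for x y
    unfolding g_def k_def by (rule gaussian_fourier(2)[OF e])
  \<comment> \<open>First of two applications of Fubini: integrating out \<open>\<xi>\<close> turns
    the Gaussian weight into the convolution kernel \<open>k\<close>. The second one pairs the
    result with \<open>u\<close>.\<close>
  have inner: "(LINT \<xi>|lborel. g \<xi> * cnj (fourier u \<xi>) * cis (- (x \<bullet> \<xi>)))
      = (LINT y|lborel. cnj (u y) * of_real (k (x - y)))" for x
  proof -
    define F where "F \<xi> y = cnj (u y) * (g \<xi> * cis (- ((x - y) \<bullet> \<xi>)))" for \<xi> y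
    have F: "integrable (lborel \<Otimes>\<^sub>M lborel) (case_prod F)"
      by (rule integrable_mult_product[OF gi u]) (unfold F_def[abs_def], measurable, simp add:
          norm_mult)
    have "g \<xi> * cnj (fourier u \<xi>) * cis (- (x \<bullet> \<xi>)) = (LINT y|lborel. F \<xi> y)" for \<xi>
    proof -
      have "cnj (fourier u \<xi>) = (LINT y|lborel. cnj (u y) * cis (y \<bullet> \<xi>))"
      proof -
        have "(LINT y|lborel. cnj (u y * cis (- (y \<bullet> \<xi>)))) = cnj (fourier u \<xi>)"
          unfolding fourier_def by (rule Bochner_Integration.integral_cnj)
        then show ?thesis by (simp add: cis_cnj)
      qed
      then have "g \<xi> * cnj (fourier u \<xi>) * cis (- (x \<bullet> \<xi>))
          = (LINT y|lborel. (g \<xi> * cis (- (x \<bullet> \<xi>))) * (cnj (u y) * cis (y \<bullet> \<xi>)))"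
        by (simp only: integral_mult_right_zero) (simp only: mult_ac)
      also have "\<dots> = (LINT y|lborel. F \<xi> y)"
      proof (rule Bochner_Integration.integral_cong[OF refl])
        fix y
        have "cis (- ((x - y) \<bullet> \<xi>)) = cis (- (x \<bullet> \<xi>)) * cis (y \<bullet> \<xi>)"
            by (simp add: cis_mult inner_diff_left)
        then show "(g \<xi> * cis (- (x \<bullet> \<xi>))) * (cnj (u y) * cis (y \<bullet> \<xi>)) = F \<xi> y" by (simp add: F_def)
      qed
      finally show ?thesis .
    qed
    then have "(LINT \<xi>|lborel. g \<xi> * cnj (fourier u \<xi>) * cis (- (x \<bullet> \<xi>)))
        = (LINT \<xi>|lborel. LINT y|lborel. F \<xi> y)" by simp
    also have "\<dots> = (LINT y|lborel. LINT \<xi>|lborel. F \<xi> y)"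
        by (rule lborel_pair.Fubini_integral[OF F, symmetric])
    also have "\<dots> = (LINT y|lborel. cnj (u y) * of_real (k (x - y)))"
      unfolding F_def integral_mult_right_zero kk ..
    finally show ?thesis .
  qed
  define F where "F \<xi> x = (g \<xi> * cnj (fourier u \<xi>) * cis (- (x \<bullet> \<xi>))) * u x" for \<xi> x
  have F: "integrable (lborel \<Otimes>\<^sub>M lborel) (case_prod F)"
  proof (rule integrable_mult_product[OF gBi u])
    show "case_prod F \<in> borel_measurable (lborel \<Otimes>\<^sub>M lborel)" unfolding F_def[abs_def] by measurable
    show "norm (F \<xi> x) \<le> norm (of_real B * g \<xi>) * norm (u x)" for \<xi> x
      using mult_right_mono[OF hu[of \<xi>], of "norm (g \<xi>) * norm (u x)"] B0
          by (simp add: F_def norm_mult mult_ac)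
  qed
  have "?lhs = (LINT \<xi>|lborel. LINT x|lborel. F \<xi> x)"
  proof (rule Bochner_Integration.integral_cong[OF refl])
    fix \<xi>
    have "(LINT x|lborel. F \<xi> x) = (LINT x|lborel. (g \<xi> * cnj (fourier u \<xi>)) * (u x * cis (- (x \<bullet> \<xi>))))"
      unfolding F_def by (simp only: mult_ac)
    then show "of_real (exp (- (e\<^sup>2 * (norm \<xi>)\<^sup>2 / 2))) * cnj (fourier u \<xi>) * fourier u \<xi>
        = (LINT x|lborel. F \<xi> x)"
      unfolding integral_mult_right_zero by (simp add: g_def fourier_def)
  qed
  also have "\<dots> = (LINT x|lborel. LINT \<xi>|lborel. F \<xi> x)"
      by (rule lborel_pair.Fubini_integral[OF F, symmetric])
  also have "\<dots> = ?rhs"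
    unfolding F_def integral_mult_left_zero inner ..
  finally show ?thesis .
qed

text \<open>Schur's test: in the double integral with kernel \<open>k (x - y)\<close> the product of
  \<open>|u x|\<close> and \<open>|u y|\<close> is split by the inequality of arithmetic and
  geometric means, and each half sees only the mass of \<open>k\<close>. The bound is uniform in the
  width, so the weight can be removed.\<close>

lemma plancherel_le:
  fixes u :: "real^'n::finite \<Rightarrow> complex"
  assumes u: "integrable lborel u"
  shows "(\<integral>\<^sup>+ \<xi>. ennreal ((cmod (fourier u \<xi>))\<^sup>2) \<partial>lborel) \<le> ennreal ((2 * pi) ^ CARD('n))
      * (\<integral>\<^sup>+ x. ennreal ((cmod (u x))\<^sup>2) \<partial>lborel)"
proof -
  have [measurable]: "u \<in> borel_measurable borel" using u by auto
  define C where "C = ennreal ((2 * pi) ^ CARD('n)) * (\<integral>\<^sup>+ x. ennreal ((cmod (u x))\<^sup>2) \<partial>lborel)"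
  define B where "B = (LINT x|lborel. norm (u x))"
  have hu: "norm (fourier u \<xi>) \<le> B" for \<xi> unfolding B_def by (rule norm_fourier_le[OF u])
  have *: "(\<integral>\<^sup>+ \<xi>. ennreal (exp (- (e\<^sup>2 * (norm \<xi>)\<^sup>2 / 2)) * (cmod (fourier u \<xi>))\<^sup>2) \<partial>lborel) \<le> C"
      if e: "e > 0" for e
  proof -
    define k where "k = (\<lambda>v::real^'n. (sqrt (2 * pi) / e) ^ DIM(real^'n)
        * exp (- ((norm v)\<^sup>2 / (2 * e\<^sup>2))))"
    have k0: "k v \<ge> 0" for v using e by (simp add: k_def)
    have [measurable]: "k \<in> borel_measurable borel" unfolding k_def by measurable
    have kI: "(\<integral>\<^sup>+ x. ennreal (k (y - x)) \<partial>lborel) = ennreal ((2 * pi) ^ CARD('n))" for y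
      unfolding k_def using gaussian_integral[OF e, of y] by simp
    have kI': "(\<integral>\<^sup>+ x. ennreal (k (x - y)) \<partial>lborel) = ennreal ((2 * pi) ^ CARD('n))" for y
      using kI[of y] by (simp add: k_def norm_minus_commute)
    define w where "w \<xi> = exp (- (e\<^sup>2 * (norm \<xi>)\<^sup>2 / 2)) * (cmod (fourier u \<xi>))\<^sup>2" for \<xi>
    have wi: "integrable lborel w"
    proof (rule Bochner_Integration.integrable_bound)
      have "integrable lborel (\<lambda>\<xi>::real^'n. Re (of_real (exp (- (e\<^sup>2 * (norm \<xi>)\<^sup>2 / 2)))))"
        using integrable_Re[OF gaussian_fourier(1)[OF e, of "0::real^'n"]] by simp
      then show "integrable lborel (\<lambda>\<xi>::real^'n. B\<^sup>2 * exp (- (e\<^sup>2 * (norm \<xi>)\<^sup>2 / 2)))" by simp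
      show "w \<in> borel_measurable lborel" unfolding w_def[abs_def] by measurable
      show "AE \<xi> in lborel. norm (w \<xi>) \<le> norm (B\<^sup>2 * exp (- (e\<^sup>2 * (norm \<xi>)\<^sup>2 / 2)))"
        unfolding w_def using hu by (intro AE_I2) (auto simp: abs_mult intro!: power_mono)
    qed
    have w0: "w \<xi> \<ge> 0" for \<xi> by (simp add: w_def)
    have c: "(LINT \<xi>|lborel. complex_of_real (w \<xi>))
        = (LINT x|lborel. (LINT y|lborel. cnj (u y) * of_real (k (x - y))) * u x)"
    proof -
      have "complex_of_real (w \<xi>) = of_real (exp (- (e\<^sup>2 * (norm \<xi>)\<^sup>2 / 2))) * cnj (fourier u \<xi>)
          * fourier u \<xi>" for \<xi>
      proof -
        have "of_real ((cmod (fourier u \<xi>))\<^sup>2) = cnj (fourier u \<xi>) * fourier u \<xi>"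
          by (simp add: complex_norm_square mult.commute del: of_real_power)
        then show ?thesis unfolding w_def of_real_mult by (simp only: mult.assoc)
      qed
      then show ?thesis unfolding k_def by (simp only: gaussian_weighted_fourier[OF u e])
    qed
    have "(LINT \<xi>|lborel. w \<xi>) \<ge> 0" using w0 by simp
    then have "(LINT \<xi>|lborel. w \<xi>) = norm (LINT \<xi>|lborel. complex_of_real (w \<xi>))" by simp
    then have "ennreal (LINT \<xi>|lborel. w \<xi>) = ennreal
        (norm (LINT x|lborel. (LINT y|lborel. cnj (u y) * of_real (k (x - y))) * u x))"
      unfolding c by simp
    also have "\<dots> \<le> (\<integral>\<^sup>+ x. ennreal (norm ((LINT y|lborel. cnj (u y) * of_real (k (x - y))) * u x))
        \<partial>lborel)"
      by (rule norm_integral_le_nn_integral)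
    also have "\<dots> \<le> (\<integral>\<^sup>+ x. (\<integral>\<^sup>+ y. ennreal ((cmod (u x))\<^sup>2 / 2 * k (x - y))
        + ennreal ((cmod (u y))\<^sup>2 / 2 * k (x - y)) \<partial>lborel) \<partial>lborel)"
    proof (rule nn_integral_mono)
      fix x
      have "ennreal (norm ((LINT y|lborel. cnj (u y) * of_real (k (x - y))) * u x))
          = ennreal (norm (LINT y|lborel. cnj (u y) * of_real (k (x - y)) * u x))"
        by simp
      also have "\<dots> \<le> (\<integral>\<^sup>+ y. ennreal (norm (cnj (u y) * of_real (k (x - y)) * u x)) \<partial>lborel)"
        by (rule norm_integral_le_nn_integral)
      also have "\<dots> \<le> (\<integral>\<^sup>+ y. ennreal ((cmod (u x))\<^sup>2 / 2 * k (x - y))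
          + ennreal ((cmod (u y))\<^sup>2 / 2 * k (x - y)) \<partial>lborel)"
      proof (rule nn_integral_mono)
        fix y
        have "norm (u y) * norm (u x) \<le> (cmod (u x))\<^sup>2 / 2 + (cmod (u y))\<^sup>2 / 2"
          using sum_squares_bound[of "norm (u y)" "norm (u x)"] by simp
        then have "norm (u y) * norm (u x) * k (x - y) \<le> ((cmod (u x))\<^sup>2 / 2 + (cmod (u y))\<^sup>2 / 2)
            * k (x - y)"
          by (rule mult_right_mono) (rule k0)
        then show "ennreal (norm (cnj (u y) * of_real (k (x - y)) * u x))
            \<le> ennreal ((cmod (u x))\<^sup>2 / 2 * k (x - y)) + ennreal ((cmod (u y))\<^sup>2 / 2 * k (x - y))"
          using k0 by (simp add: norm_mult ennreal_plus[symmetric] algebra_simps del: ennreal_plus)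
      qed
      finally show "ennreal (norm ((LINT y|lborel. cnj (u y) * of_real (k (x - y))) * u x))
          \<le> (\<integral>\<^sup>+ y. ennreal ((cmod (u x))\<^sup>2 / 2 * k (x - y))
          + ennreal ((cmod (u y))\<^sup>2 / 2 * k (x - y)) \<partial>lborel)" .
    qed
    also have "\<dots> = (\<integral>\<^sup>+ x. (\<integral>\<^sup>+ y. ennreal ((cmod (u x))\<^sup>2 / 2 * k (x - y)) \<partial>lborel) \<partial>lborel)
        + (\<integral>\<^sup>+ x. (\<integral>\<^sup>+ y. ennreal ((cmod (u y))\<^sup>2 / 2 * k (x - y)) \<partial>lborel) \<partial>lborel)"
      by (subst nn_integral_add[symmetric]) (auto simp: nn_integral_add)
    also have "(\<integral>\<^sup>+ x. (\<integral>\<^sup>+ y. ennreal ((cmod (u y))\<^sup>2 / 2 * k (x - y)) \<partial>lborel) \<partial>lborel)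
        = (\<integral>\<^sup>+ y. (\<integral>\<^sup>+ x. ennreal ((cmod (u y))\<^sup>2 / 2 * k (x - y)) \<partial>lborel) \<partial>lborel)"
      by (rule lborel_pair.Fubini') measurable
    also have "\<dots> = (\<integral>\<^sup>+ y. ennreal ((cmod (u y))\<^sup>2 / 2) * ennreal ((2 * pi) ^ CARD('n)) \<partial>lborel)"
    proof (rule nn_integral_cong)
      fix y
      have "(\<integral>\<^sup>+ x. ennreal ((cmod (u y))\<^sup>2 / 2 * k (x - y)) \<partial>lborel)
          = (\<integral>\<^sup>+ x. ennreal ((cmod (u y))\<^sup>2 / 2) * ennreal (k (x - y)) \<partial>lborel)"
        by (intro nn_integral_cong ennreal_mult k0) simp
      then show "(\<integral>\<^sup>+ x. ennreal ((cmod (u y))\<^sup>2 / 2 * k (x - y)) \<partial>lborel)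
          = ennreal ((cmod (u y))\<^sup>2 / 2) * ennreal ((2 * pi) ^ CARD('n))"
        unfolding kI'[symmetric, of y] by (subst nn_integral_cmult[symmetric]) auto
    qed
    also have "(\<integral>\<^sup>+ x. (\<integral>\<^sup>+ y. ennreal ((cmod (u x))\<^sup>2 / 2 * k (x - y)) \<partial>lborel) \<partial>lborel)
        = (\<integral>\<^sup>+ y. ennreal ((cmod (u y))\<^sup>2 / 2) * ennreal ((2 * pi) ^ CARD('n)) \<partial>lborel)"
    proof (rule nn_integral_cong)
      fix x
      have "(\<integral>\<^sup>+ y. ennreal ((cmod (u x))\<^sup>2 / 2 * k (x - y)) \<partial>lborel)
          = (\<integral>\<^sup>+ y. ennreal ((cmod (u x))\<^sup>2 / 2) * ennreal (k (x - y)) \<partial>lborel)"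
        by (intro nn_integral_cong ennreal_mult k0) simp
      then show "(\<integral>\<^sup>+ y. ennreal ((cmod (u x))\<^sup>2 / 2 * k (x - y)) \<partial>lborel)
          = ennreal ((cmod (u x))\<^sup>2 / 2) * ennreal ((2 * pi) ^ CARD('n))"
        unfolding kI[symmetric, of x] by (subst nn_integral_cmult[symmetric]) auto
    qed
    also have "\<dots> + \<dots> = (\<integral>\<^sup>+ y. ennreal ((2 * pi) ^ CARD('n)) * ennreal ((cmod (u y))\<^sup>2) \<partial>lborel)"
      by (subst nn_integral_add[symmetric]) (auto simp: ennreal_mult[symmetric] ennreal_plus[symmetric]
          mult.commute simp del: ennreal_plus intro!: nn_integral_cong)
    also have "\<dots> = C" unfolding C_def by (rule nn_integral_cmult) measurable
    finally have "(\<integral>\<^sup>+ \<xi>. ennreal (w \<xi>) \<partial>lborel) \<le> C" using nn_integral_eq_integral[OF wi] w0 by simp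
    then show ?thesis unfolding w_def .
  qed
  define f where "f n \<xi> = ennreal (exp (- ((1 / real (Suc n))\<^sup>2 * (norm \<xi>)\<^sup>2 / 2))
      * (cmod (fourier u \<xi>))\<^sup>2)" for n \<xi>
  have lim: "liminf (\<lambda>n. f n \<xi>) = ennreal ((cmod (fourier u \<xi>))\<^sup>2)" for \<xi>
  proof (rule lim_imp_Liminf)
    have "(\<lambda>n. 1 / real (Suc n)) \<longlonglongrightarrow> 0" using LIMSEQ_inverse_real_of_nat by (simp add: inverse_eq_divide)
    then have "(\<lambda>n. exp (- ((1 / real (Suc n))\<^sup>2 * (norm \<xi>)\<^sup>2 / 2)) * (cmod (fourier u \<xi>))\<^sup>2)
        \<longlonglongrightarrow> exp (- (0\<^sup>2 * (norm \<xi>)\<^sup>2 / 2)) * (cmod (fourier u \<xi>))\<^sup>2"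
      by (intro tendsto_intros) auto
    then show "(\<lambda>n. f n \<xi>) \<longlonglongrightarrow> ennreal ((cmod (fourier u \<xi>))\<^sup>2)" unfolding f_def
        by (intro tendsto_ennrealI) simp
  qed simp
  have "(\<integral>\<^sup>+ \<xi>. ennreal ((cmod (fourier u \<xi>))\<^sup>2) \<partial>lborel) = (\<integral>\<^sup>+ \<xi>. liminf (\<lambda>n. f n \<xi>) \<partial>lborel)"
    unfolding lim ..
  also have "\<dots> \<le> liminf (\<lambda>n. \<integral>\<^sup>+ \<xi>. f n \<xi> \<partial>lborel)"
    by (rule nn_integral_liminf) (unfold f_def, measurable)
  also have "\<dots> \<le> liminf (\<lambda>n. C)"
    using * unfolding f_def by (intro Liminf_mono always_eventually allI) simp
  also have "\<dots> = C" by (simp add: Liminf_const)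
  finally show ?thesis unfolding C_def .
qed

section \<open>Directional derivatives and the Fourier transform\<close>

lemma integrable_continuous_bounded_support:
  fixes h :: "'a::euclidean_space \<Rightarrow> 'b::{banach, second_countable_topology}"
  assumes c: "continuous_on UNIV h" and z: "\<And>x. norm x > R \<Longrightarrow> h x = 0"
  shows "integrable lborel h"
proof -
  have "integrable lborel (\<lambda>x. indicator (cball 0 R) x *\<^sub>R h x)"
    by (rule borel_integrable_compact) (auto intro: continuous_on_subset[OF c])
  also have "(\<lambda>x. indicator (cball 0 R) x *\<^sub>R h x) = h"
  proof
    fix x show "indicator (cball 0 R) x *\<^sub>R h x = h x" using z[of x]
        by (cases "x \<in> cball 0 R") (auto simp: not_le)
  qed
  finally show ?thesis .
qed

lemma bounded_continuous_bounded_support: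
  fixes h :: "'a::euclidean_space \<Rightarrow> 'b::real_normed_vector"
  assumes c: "continuous_on UNIV h" and z: "\<And>x. norm x > R \<Longrightarrow> h x = 0"
  obtains B where "B \<ge> 0" "\<And>x. norm (h x) \<le> B"
proof -
  have "bounded (h ` cball 0 R)"
    by (rule compact_imp_bounded) (rule compact_continuous_image, auto intro:
        continuous_on_subset[OF c])
  then obtain B where "\<forall>y\<in>h ` cball 0 R. norm y \<le> B" unfolding bounded_iff ..
  then have B: "\<And>x. x \<in> cball 0 R \<Longrightarrow> norm (h x) \<le> B" by blast
  have "norm (h x) \<le> max B 0" for x using B[of x] z[of x] by (cases "x \<in> cball 0 R") (auto simp: not_le)
  then show ?thesis using that[of "max B 0"] by simp
qed

text \<open>By translation invariance every difference quotient has integral zero. The quotients are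
  dominated, by the mean value inequality, by a constant on a slightly larger ball.\<close>

lemma integral_directional_derivative_eq_0:
  fixes h Dh :: "'a::euclidean_space \<Rightarrow> complex"
  assumes d: "\<And>x. ((\<lambda>s. h (x + s *\<^sub>R v)) has_vector_derivative Dh x) (at 0)"
    and ch: "continuous_on UNIV h" and cD: "continuous_on UNIV Dh"
    and z: "\<And>x. norm x > R \<Longrightarrow> h x = 0" "\<And>x. norm x > R \<Longrightarrow> Dh x = 0"
  shows "(LINT x|lborel. Dh x) = 0"
proof -
  obtain B where B: "B \<ge> 0" "\<And>x. norm (Dh x) \<le> B" by
      (rule bounded_continuous_bounded_support[OF cD z(2)]) (assumption, rule that)
  have [measurable]: "h \<in> borel_measurable borel" "Dh \<in> borel_measurable borel"
    using ch cD by (auto intro: borel_measurable_continuous_onI)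
  have hi: "integrable lborel h" by (rule integrable_continuous_bounded_support[OF ch z(1)])
  have d': "((\<lambda>s. h (x + s *\<^sub>R v)) has_vector_derivative Dh (x + s *\<^sub>R v)) (at s)" for x s
  proof -
    have "((\<lambda>t. h ((x + s *\<^sub>R v) + t *\<^sub>R v)) has_vector_derivative Dh (x + s *\<^sub>R v)) (at 0)" by (rule d)
    then have "((\<lambda>t. h (x + (s + t) *\<^sub>R v)) has_vector_derivative Dh (x + s *\<^sub>R v)) (at 0)"
        by (simp add: algebra_simps)
    then show ?thesis
      unfolding has_vector_derivative_def has_derivative_at by (simp add: scaleR_add_left)
  qed
  define e where "e n = 1 / real (Suc n)" for n
  have e: "e n > 0" "e n \<le> 1" for n by (simp_all add: e_def)
  have e0: "e \<longlonglongrightarrow> 0" unfolding e_def using LIMSEQ_inverse_real_of_nat by (simp add: inverse_eq_divide)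
  define q where "q n x = (h (x + e n *\<^sub>R v) - h x) /\<^sub>R e n" for n x
  \<comment> \<open>The steps satisfy \<open>e n \<le> 1\<close>, so a translate of the support
    moves by at most \<open>norm v\<close>.\<close>
  have qB: "norm (q n x) \<le> B * indicator (cball 0 (R + norm v)) x" for n x
  proof (cases "x \<in> cball 0 (R + norm v)")
    case True
    have "norm (h (x + e n *\<^sub>R v) - h (x + 0 *\<^sub>R v)) \<le> B * norm (e n - 0)"
      by (rule differentiable_bound[where S = UNIV and f' = "\<lambda>s. \<lambda>t. t *\<^sub>R Dh (x + s *\<^sub>R v)"])
         (use d'[of x] B in \<open>auto simp: has_vector_derivative_def
             onorm_scaleR_left[OF bounded_linear_ident] onorm_id mult_ac intro:
             has_derivative_at_withinI\<close>)
    then have "norm (h (x + e n *\<^sub>R v) - h x) / e n \<le> B" using e[of n] by (simp add: pos_divide_le_eq)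
    moreover have "norm (q n x) = norm (h (x + e n *\<^sub>R v) - h x) / e n"
      using e[of n] by (simp add: q_def divide_inverse mult.commute)
    ultimately show ?thesis using True by simp
  next
    case False
    then have 1: "norm x > R + norm v" by simp
    have "norm (e n *\<^sub>R v) \<le> norm v" using e[of n] by (simp add: mult_left_le_one_le)
    then have "norm (x + e n *\<^sub>R v) > R" using 1 norm_diff_ineq[of x "e n *\<^sub>R v"] by linarith
    moreover have "norm x > R" using 1 norm_ge_zero[of v] by linarith
    ultimately show ?thesis using z B by (simp add: q_def)
  qed
  have "(\<lambda>n. LINT x|lborel. q n x) \<longlonglongrightarrow> (LINT x|lborel. Dh x)"
  proof (rule integral_dominated_convergence[where w = "\<lambda>x. B * indicator (cball 0 (R + norm v)) x"])
    show "integrable lborel (\<lambda>x. B * indicator (cball 0 (R + norm v)) x)"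
      using emeasure_bounded_finite[OF bounded_cball, of 0 "R + norm v"]
          by (intro integrable_mult_right integrable_real_indicator) auto
    show "AE x in lborel. (\<lambda>n. q n x) \<longlonglongrightarrow> Dh x"
    proof (rule AE_I2)
      fix x
      have "((\<lambda>s. (h (x + s *\<^sub>R v) - h x) /\<^sub>R s) \<longlongrightarrow> Dh x) (at 0)"
      proof (rule LIM_zero_cancel, rule tendsto_norm_zero_cancel, rule Lim_transform_eventually)
        show "((\<lambda>s. norm (h (x + s *\<^sub>R v) - h x - s *\<^sub>R Dh x) / norm s) \<longlongrightarrow> 0) (at 0)"
          using d[of x] by (simp add: has_vector_derivative_def has_derivative_iff_norm)
        have "norm (h (x + s *\<^sub>R v) - h x - s *\<^sub>R Dh x) / norm s
            = norm ((h (x + s *\<^sub>R v) - h x) /\<^sub>R s - Dh x)" if "s \<noteq> 0" for s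
        proof -
          have "(h (x + s *\<^sub>R v) - h x) /\<^sub>R s - Dh x = (h (x + s *\<^sub>R v) - h x - s *\<^sub>R Dh x) /\<^sub>R s"
            using that by (simp add: scaleR_diff_right)
          then show ?thesis by (simp add: divide_inverse mult.commute)
        qed
        then show "\<forall>\<^sub>F s in at 0. norm (h (x + s *\<^sub>R v) - h x - s *\<^sub>R Dh x) / norm s
            = norm ((h (x + s *\<^sub>R v) - h x) /\<^sub>R s - Dh x)"
          by (auto simp: eventually_at_filter)
      qed
      moreover have "filterlim e (at 0) sequentially"
        unfolding filterlim_at using e0 e by (auto simp: less_imp_neq[symmetric])
      ultimately show "(\<lambda>n. q n x) \<longlonglongrightarrow> Dh x" unfolding q_def by (rule filterlim_compose)
    qed
    show "AE x in lborel. norm (q n x) \<le> B * indicator (cball 0 (R + norm v)) x" for n using qB by simp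
  qed (unfold q_def, measurable)
  moreover have "(LINT x|lborel. q n x) = 0" for n
  proof -
    have i: "integrable lborel (\<lambda>x. h (e n *\<^sub>R v + x))"
    proof -
      have "integrable (distr lborel borel ((+) (e n *\<^sub>R v))) h" using hi
          by (simp only: lborel_distr_plus)
      then show ?thesis by (subst (asm) integrable_distr_eq) auto
    qed
    have "(LINT x|lborel. h (e n *\<^sub>R v + x)) = (LINT x|distr lborel borel ((+) (e n *\<^sub>R v)). h x)"
      by (subst integral_distr) auto
    also have "\<dots> = (LINT x|lborel. h x)" unfolding lborel_distr_plus ..
    finally have "(LINT x|lborel. h (e n *\<^sub>R v + x) - h x) = 0" using i hi by simp
    then show ?thesis unfolding q_def by (simp add: add.commute)
  qed
  ultimately show ?thesis by (simp add: LIMSEQ_const_iff)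
qed

lemma cis_has_vector_derivative: "(cis has_vector_derivative \<i> * cis t) (at t)"
  by (auto simp: has_vector_derivative_def scaleR_conv_of_real intro!: derivative_eq_intros)

text \<open>Integration by parts: the preceding lemma is applied to \<open>h\<close> times the
  character \<open>cis (- (x \<bullet> \<xi>))\<close>.\<close>

lemma fourier_directional_derivative:
  fixes h Dh :: "real^'n::finite \<Rightarrow> complex"
  assumes d: "\<And>x. ((\<lambda>s. h (x + s *\<^sub>R v)) has_vector_derivative Dh x) (at 0)"
    and ch: "continuous_on UNIV h" and cD: "continuous_on UNIV Dh"
    and z: "\<And>x. norm x > R \<Longrightarrow> h x = 0" "\<And>x. norm x > R \<Longrightarrow> Dh x = 0"
  shows "fourier Dh \<xi> = \<i> * of_real (v \<bullet> \<xi>) * fourier h \<xi>"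
proof -
  define H where "H x = h x * cis (- (x \<bullet> \<xi>))" for x
  define DH where "DH x = Dh x * cis (- (x \<bullet> \<xi>)) - \<i> * of_real (v \<bullet> \<xi>) * (h x * cis (- (x \<bullet> \<xi>)))" for x
  have i1: "integrable lborel (\<lambda>x. Dh x * cis (- (x \<bullet> \<xi>)))" "integrable lborel
      (\<lambda>x. h x * cis (- (x \<bullet> \<xi>)))"
    using z by (intro integrable_continuous_bounded_support[where R = R] continuous_intros ch cD; simp)+
  have "(LINT x|lborel. DH x) = 0"
  proof (rule integral_directional_derivative_eq_0)
    show "((\<lambda>s. H (x + s *\<^sub>R v)) has_vector_derivative DH x) (at 0)" for x
    proof -
      have "((\<lambda>s. cis (- ((x + s *\<^sub>R v) \<bullet> \<xi>))) has_vector_derivative (- (v \<bullet> \<xi>))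
          *\<^sub>R (\<i> * cis (- (x \<bullet> \<xi>)))) (at 0)"
      proof -
        have "((\<lambda>s. - ((x + s *\<^sub>R v) \<bullet> \<xi>)) has_real_derivative (- (v \<bullet> \<xi>))) (at 0)"
          by (auto simp: inner_add_left intro!: derivative_eq_intros)
        then have "((\<lambda>s. - ((x + s *\<^sub>R v) \<bullet> \<xi>)) has_vector_derivative (- (v \<bullet> \<xi>))) (at 0)"
          by (simp only: has_real_derivative_iff_has_vector_derivative)
        from vector_diff_chain_at[OF this cis_has_vector_derivative] show ?thesis by (simp add: o_def)
      qed
      from has_vector_derivative_mult[OF d[of x] this] show ?thesis
        unfolding H_def DH_def by (simp add: scaleR_conv_of_real algebra_simps)
    qed
    show "continuous_on UNIV H" "continuous_on UNIV DH"
      unfolding H_def DH_def by (intro continuous_intros ch cD)+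
    show "norm x > R \<Longrightarrow> H x = 0" "norm x > R \<Longrightarrow> DH x = 0" for x using z by (auto simp: H_def DH_def)
  qed
  then have "(LINT x|lborel. Dh x * cis (- (x \<bullet> \<xi>)))
      = (LINT x|lborel. \<i> * of_real (v \<bullet> \<xi>) * (h x * cis (- (x \<bullet> \<xi>))))"
    unfolding DH_def using i1 by simp
  then show ?thesis unfolding fourier_def by simp
qed

text \<open>After rescaling by \<open>N^2\<close> this is \<open>t powr s \<le> 1 + t\<close> for
  \<open>0 \<le> s \<le> 1\<close>. It trades the fractional weight for the \<open>L^2\<close> and
  \<open>H^1\<close> weights, balanced at frequency \<open>N\<close>.\<close>

lemma powr_le_interpolation:
  fixes q s N :: real
  assumes "q > 0" "N \<ge> 1" "0 \<le> s" "s \<le> 1"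
  shows "q powr s \<le> N powr (2 * s) * (1 + q / N\<^sup>2)"
proof -
  have q: "q = N\<^sup>2 * (q / N\<^sup>2)" using assms by simp
  have "(q / N\<^sup>2) powr s \<le> 1 + q / N\<^sup>2"
  proof (cases "q / N\<^sup>2 \<le> 1")
    case True
    then have "(q / N\<^sup>2) powr s \<le> 1" using assms by (intro powr_le1) auto
    then show ?thesis using assms by (simp add: add_increasing2)
  next
    case False
    then have "(q / N\<^sup>2) powr s \<le> (q / N\<^sup>2) powr 1" using assms by (intro powr_mono) auto
    then show ?thesis using False assms by simp
  qed
  moreover have "q powr s = N powr (2 * s) * (q / N\<^sup>2) powr s"
  proof -
    have "q powr s = (N\<^sup>2) powr s * (q / N\<^sup>2) powr s"
      by (subst q) (use assms in \<open>simp add: powr_mult[symmetric]\<close>)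
    also have "(N\<^sup>2) powr s = N powr (2 * s)"
      using assms by (simp flip: powr_numeral add: powr_powr)
    finally show ?thesis .
  qed
  ultimately show ?thesis by (simp add: mult_left_mono)
qed

text \<open>Interpolation at frequency \<open>N\<close> reduces the norm to the \<open>L^2\<close>
  sizes of \<open>u\<close> and its first derivatives, and these are read off from sup bounds and
  the measure of \<open>S\<close>. In the constant, 2 comes from \<open>1 + 1 / N^2 \<le> 2\<close>
  and the dimension from the number of partial derivatives.\<close>

lemma sobolev_norm_sq_le:
  fixes u :: "real^'n::finite \<Rightarrow> complex" and Du :: "'n \<Rightarrow> real^'n \<Rightarrow> complex"
  assumes d: "\<And>i x. ((\<lambda>h. u (x + h *\<^sub>R axis i 1)) has_vector_derivative Du i x) (at 0)"
    and cu: "continuous_on UNIV u" and cD: "\<And>i. continuous_on UNIV (Du i)"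
    and S: "S \<in> sets lborel" "bounded S"
    and z: "\<And>x. x \<notin> S \<Longrightarrow> u x = 0" "\<And>i x. x \<notin> S \<Longrightarrow> Du i x = 0"
    and A: "\<And>x. cmod (u x) \<le> A" "\<And>i x. cmod (Du i x) \<le> A * N" "A \<ge> 0"
    and N: "N \<ge> 1" and s: "0 \<le> s" "s \<le> 1"
  shows "sobolev_norm_sq s u \<le> ennreal ((2 * pi) ^ CARD('n) * A\<^sup>2 * (2 + real CARD('n))
      * N powr (2 * s)) * emeasure lborel S"
proof -
  obtain R where R: "\<And>x. x \<in> S \<Longrightarrow> norm x \<le> R" using S(2) by (auto simp: bounded_iff)
  have zR: "norm x > R \<Longrightarrow> u x = 0" "norm x > R \<Longrightarrow> Du i x = 0" for x i using z R by (metis not_less)+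
  have iu: "integrable lborel u" "integrable lborel (Du i)" for i
    by (rule integrable_continuous_bounded_support[OF cu zR(1)], assumption)
       (rule integrable_continuous_bounded_support[OF cD zR(2)])
  note [measurable] = borel_measurable_continuous_onI[OF cu] borel_measurable_continuous_onI[OF cD]
  define P where "P = ennreal ((2 * pi) ^ CARD('n))"
  define c where "c = N powr (2 * s)"
  have c0: "c \<ge> 0" by (simp add: c_def)
  have L2: "(\<integral>\<^sup>+ \<xi>. ennreal ((cmod (fourier f \<xi>))\<^sup>2) \<partial>lborel) \<le> P * (ennreal (K\<^sup>2) * emeasure lborel S)"
    if "integrable lborel f" "\<And>x. x \<notin> S \<Longrightarrow> f x = 0" "\<And>x. cmod (f x) \<le> K" for f K
  proof -
    have "(\<integral>\<^sup>+ x. ennreal ((cmod (f x))\<^sup>2) \<partial>lborel) \<le> (\<integral>\<^sup>+ x. ennreal (K\<^sup>2) * indicator S x \<partial>lborel)"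
    proof (rule nn_integral_mono)
      fix x show "ennreal ((cmod (f x))\<^sup>2) \<le> ennreal (K\<^sup>2) * indicator S x"
        using that(2)[of x] that(3)[of x] by (cases "x \<in> S") (auto intro!: ennreal_leI power_mono)
    qed
    also have "\<dots> = ennreal (K\<^sup>2) * emeasure lborel S" using S by (simp add: nn_integral_cmult_indicator)
    finally show ?thesis using plancherel_le[OF that(1)] unfolding P_def
        by (meson mult_left_mono order_trans zero_le)
  qed
  have nrm: "(norm \<xi>)\<^sup>2 = (\<Sum>i\<in>UNIV. (\<xi> $ i)\<^sup>2)" for \<xi> :: "real^'n"
    unfolding power2_norm_eq_inner by (simp add: inner_vec_def power2_eq_square)
  have fD: "(cmod (fourier (Du i) \<xi>))\<^sup>2 = (\<xi> $ i)\<^sup>2 * (cmod (fourier u \<xi>))\<^sup>2" for i \<xi>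
  proof -
    have "fourier (Du i) \<xi> = \<i> * of_real (axis i 1 \<bullet> \<xi>) * fourier u \<xi>"
      by (rule fourier_directional_derivative[where R = R, OF d cu cD zR(1) zR(2)])
    then show ?thesis by (simp add: norm_mult power_mult_distrib inner_axis')
  qed
  have pw: "ennreal ((1 + (norm \<xi>)\<^sup>2) powr s * (cmod (fourier u \<xi>))\<^sup>2) \<le>
      ennreal (2 * c) * ennreal ((cmod (fourier u \<xi>))\<^sup>2) + ennreal (c / N\<^sup>2)
          * (\<Sum>i\<in>UNIV. ennreal ((cmod (fourier (Du i) \<xi>))\<^sup>2))" for \<xi>
  proof -
    let ?f = "(cmod (fourier u \<xi>))\<^sup>2"
    have "(1 + (norm \<xi>)\<^sup>2) powr s \<le> c * (1 + (1 + (norm \<xi>)\<^sup>2) / N\<^sup>2)"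
      unfolding c_def by (rule powr_le_interpolation) (use N s in \<open>auto simp: add_pos_nonneg\<close>)
    also have "\<dots> \<le> 2 * c + c / N\<^sup>2 * (norm \<xi>)\<^sup>2"
    proof -
      have "c * (1 / N\<^sup>2) \<le> c * 1" using N c0 by (intro mult_left_mono)
          (auto simp: power_le_one one_le_power)
      then show ?thesis by (simp add: algebra_simps add_divide_distrib)
    qed
    finally have "(1 + (norm \<xi>)\<^sup>2) powr s * ?f \<le> (2 * c + c / N\<^sup>2 * (norm \<xi>)\<^sup>2) * ?f"
        by (rule mult_right_mono) simp
    also have "\<dots> = 2 * c * ?f + c / N\<^sup>2 * (\<Sum>i\<in>UNIV. (cmod (fourier (Du i) \<xi>))\<^sup>2)"
      unfolding fD sum_distrib_right[symmetric] nrm by (simp add: algebra_simps)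
    finally have "ennreal ((1 + (norm \<xi>)\<^sup>2) powr s * ?f)
        \<le> ennreal (2 * c * ?f + c / N\<^sup>2 * (\<Sum>i\<in>UNIV. (cmod (fourier (Du i) \<xi>))\<^sup>2))"
      by (rule ennreal_leI)
    also have "\<dots> = ennreal (2 * c) * ennreal ?f + ennreal (c / N\<^sup>2)
        * (\<Sum>i\<in>UNIV. ennreal ((cmod (fourier (Du i) \<xi>))\<^sup>2))"
    proof -
      have aux: "ennreal (2 * c * f + k * (\<Sum>i\<in>UNIV. g i)) = ennreal (2 * c) * ennreal f + ennreal k
          * (\<Sum>i\<in>UNIV. ennreal (g i))"
        if "f \<ge> 0" "k \<ge> 0" "\<And>i. g i \<ge> 0" for f k and g :: "'n \<Rightarrow> real"
      proof -
        have "(\<Sum>i\<in>UNIV. ennreal (g i)) = ennreal (\<Sum>i\<in>UNIV. g i)" using that by (intro sum_ennreal)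
        moreover have "(\<Sum>i\<in>UNIV. g i) \<ge> 0" using that by (intro sum_nonneg)
        ultimately show ?thesis using that c0
          by (simp only: ennreal_mult''[symmetric] ennreal_plus[symmetric] mult_nonneg_nonneg
              zero_le_numeral)
      qed
      show ?thesis by (rule aux) (use c0 in auto)
    qed
    finally show ?thesis .
  qed
  have "sobolev_norm_sq s u \<le> (\<integral>\<^sup>+ \<xi>. ennreal (2 * c) * ennreal ((cmod (fourier u \<xi>))\<^sup>2)
      + ennreal (c / N\<^sup>2) * (\<Sum>i\<in>UNIV. ennreal ((cmod (fourier (Du i) \<xi>))\<^sup>2)) \<partial>lborel)"
    unfolding sobolev_norm_sq_def by (rule nn_integral_mono) (rule pw)
  also have "\<dots> = ennreal (2 * c) * (\<integral>\<^sup>+ \<xi>. ennreal ((cmod (fourier u \<xi>))\<^sup>2) \<partial>lborel)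
      + ennreal (c / N\<^sup>2) * (\<Sum>i\<in>UNIV. \<integral>\<^sup>+ \<xi>. ennreal ((cmod (fourier (Du i) \<xi>))\<^sup>2) \<partial>lborel)"
    by (simp add: nn_integral_add nn_integral_cmult nn_integral_sum del: sum_ennreal)
  also have "\<dots> \<le> ennreal (2 * c) * (P * (ennreal (A\<^sup>2) * emeasure lborel S)) + ennreal (c / N\<^sup>2)
      * (\<Sum>i\<in>(UNIV :: 'n set). P * (ennreal ((A * N)\<^sup>2) * emeasure lborel S))"
    by (intro add_mono mult_left_mono sum_mono L2 iu z A) auto
  also have "\<dots> = ennreal ((2 * pi) ^ CARD('n) * A\<^sup>2 * (2 + real CARD('n)) * c) * emeasure lborel S"
  proof -
    have e1: "ennreal (2 * c) * (P * (ennreal (A\<^sup>2) * M))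
        = ennreal (2 * c * ((2 * pi) ^ CARD('n) * A\<^sup>2)) * M" for M
      unfolding P_def using c0 by (simp add: ennreal_mult mult.assoc del: ennreal_power)
    have e2: "ennreal (c / N\<^sup>2) * (of_nat CARD('n) * (P * (ennreal ((A * N)\<^sup>2) * M)))
        = ennreal (c / N\<^sup>2 * (real CARD('n) * ((2 * pi) ^ CARD('n) * (A * N)\<^sup>2))) * M" for M
    proof -
      have gen: "ennreal a * (ennreal b * (ennreal p * (ennreal d * M))) = ennreal (a * (b * (p * d)))
          * M"
        if "a \<ge> 0" "b \<ge> 0" "p \<ge> 0" "d \<ge> 0" for a b p d
        using that by (simp add: ennreal_mult mult.assoc)
      show ?thesis unfolding P_def ennreal_of_nat_eq_real_of_nat by (rule gen) (use c0 in auto)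
    qed
    have "2 * c * ((2 * pi) ^ CARD('n) * A\<^sup>2) + c / N\<^sup>2
        * (real CARD('n) * ((2 * pi) ^ CARD('n) * (A * N)\<^sup>2)) = (2 * pi) ^ CARD('n) * A\<^sup>2
        * (2 + real CARD('n)) * c"
      using N by (simp add: power_mult_distrib field_simps)
    then show ?thesis
      unfolding sum_constant e1 e2 distrib_right[symmetric] using c0
          by (subst ennreal_plus[symmetric]) auto
  qed
  finally show ?thesis unfolding c_def .
qed

section \<open>Smooth cutoffs\<close>

text \<open>With \<open>y powr (- k)\<close> in front of \<open>exp (- 1 / y)\<close> the family is closed under differentiation.\<close>

definition expk :: "nat \<Rightarrow> real \<Rightarrow> real" where
  "expk k y = (if y > 0 then (1 / y) ^ k * exp (- (1 / y)) else 0)"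

lemma expk_nonneg: "expk k y \<ge> 0" by (simp add: expk_def)

text \<open>One term of the exponential series: \<open>x ^ k / fact k \<le> exp x\<close> at
  \<open>x = 1 / y\<close>.\<close>

lemma expk_le_fact: "expk k y \<le> fact k"
proof (cases "y > 0")
  case True
  define x where "x = 1 / y"
  have x: "x \<ge> 0" using True by (simp add: x_def)
  have "(\<Sum>n\<in>{k}. inverse (fact n) * x ^ n) \<le> (\<Sum>n. inverse (fact n) * x ^ n)"
    by (rule sum_le_suminf[OF summable_exp]) (use x in auto)
  then have "inverse (fact k) * x ^ k \<le> exp x" unfolding exp_def real_scaleR_def by simp
  then have "fact k * (inverse (fact k) * x ^ k) \<le> fact k * exp x" by (rule mult_left_mono) simp
  then have "(1 / y) ^ k \<le> fact k * exp (1 / y)" by (simp add: x_def mult.assoc[symmetric])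
  then have "(1 / y) ^ k * exp (- (1 / y)) \<le> fact k * exp (1 / y) * exp (- (1 / y))"
      by (rule mult_right_mono) simp
  then show ?thesis using True by (simp add: expk_def mult.assoc flip: exp_add)
qed (simp add: expk_def)

lemma expk_Suc: "expk k y = expk (Suc k) y * y"
  by (simp add: expk_def)

text \<open>Only \<open>y = 0\<close> needs an argument: the difference quotient there is
  \<open>expk (Suc k) h\<close>, which is \<open>h\<close> times the bounded
  \<open>expk (Suc (Suc k)) h\<close> and hence tends to 0.\<close>

lemma has_real_derivative_expk:
  "(expk k has_real_derivative expk (k + 2) y - real k * expk (k + 1) y) (at y)"
proof (cases y "0::real" rule: linorder_cases)
  case less
  have "((\<lambda>_. 0) has_real_derivative 0) (at y)" by simp
  then have "(expk k has_real_derivative 0) (at y)"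
    by (rule has_field_derivative_transform_within_open[where S = "{..<0}"])
        (use less in \<open>auto simp: expk_def\<close>)
  then show ?thesis using less by (simp add: expk_def)
next
  case equal
  have "((\<lambda>h. expk (Suc k) h) \<longlongrightarrow> 0) (at 0)"
  proof (rule Lim_null_comparison)
    have "norm (expk (Suc k) h) \<le> fact (Suc (Suc k)) * \<bar>h\<bar>" for h
      using mult_mono[OF expk_le_fact[of "Suc (Suc k)" h] order_refl[of "\<bar>h\<bar>"]]
          expk_nonneg[of "Suc (Suc k)" h] expk_Suc[of "Suc k" h]
      by (simp add: abs_mult)
    then show "\<forall>\<^sub>F h in at 0. norm (expk (Suc k) h) \<le> fact (Suc (Suc k)) * \<bar>h\<bar>" by simp
    show "((\<lambda>h::real. fact (Suc (Suc k)) * \<bar>h\<bar>) \<longlongrightarrow> 0) (at 0)" by (auto intro!: tendsto_eq_intros)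
  qed
  moreover have "\<forall>\<^sub>F h in at 0. expk (Suc k) h = (expk k (0 + h) - expk k 0) / h"
    unfolding eventually_at_filter by (intro always_eventually)
        (auto simp: expk_Suc[of k] expk_def[of k 0])
  ultimately have "((\<lambda>h. (expk k (0 + h) - expk k 0) / h) \<longlongrightarrow> 0) (at 0)"
    by (rule Lim_transform_eventually)
  then show ?thesis using equal by (simp add: DERIV_def expk_def)
next
  case greater
  have "((\<lambda>y. (1 / y) ^ k * exp (- (1 / y))) has_real_derivative expk (k + 2) y - real k
      * expk (k + 1) y) (at y)"
  proof (cases k)
    case 0
    then show ?thesis using greater by (auto intro!: derivative_eq_intros simp: expk_def
        power2_eq_square)
  next
    case (Suc m)
    have "((\<lambda>y. (1 / y) ^ k * exp (- (1 / y))) has_real_derivative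
       real k * (1 / y) ^ (k - 1) * (- (1 / y\<^sup>2)) * exp (- (1 / y)) + (1 / y) ^ k
           * (exp (- (1 / y)) * (1 / y\<^sup>2))) (at y)"
      using greater by (auto intro!: derivative_eq_intros simp: power2_eq_square)
    moreover have "real k * (1 / y) ^ (k - 1) * (- (1 / y\<^sup>2)) * exp (- (1 / y)) + (1 / y) ^ k
        * (exp (- (1 / y)) * (1 / y\<^sup>2)) =
       expk (k + 2) y - real k * expk (k + 1) y"
      using greater Suc by (simp add: expk_def power2_eq_square algebra_simps add_divide_distrib)
    ultimately show ?thesis by simp
  qed
  then show ?thesis
    by (rule has_field_derivative_transform_within_open[where S = "{0<..}"])
        (use greater in \<open>auto simp: expk_def\<close>)
qed

text \<open>The algebra contains all test functions in use and is closed under \<^const>\<open>partial_deriv\<close>, hence consists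
  of smooth functions.\<close>

inductive tf_alg :: "(real^'n::finite \<Rightarrow> complex) \<Rightarrow> bool" where
  tf_const: "tf_alg (\<lambda>x. c)"
| tf_coord: "tf_alg (\<lambda>x. of_real (x $ i))"
| tf_phase: "tf_alg (\<lambda>x. cis (b * (x \<bullet> x)))"
| tf_cut: "tf_alg (\<lambda>x. of_real (expk k (a + b * (x \<bullet> x) + c * (x \<bullet> x)\<^sup>2)))"
| tf_add: "tf_alg f \<Longrightarrow> tf_alg g \<Longrightarrow> tf_alg (\<lambda>x. f x + g x)"
| tf_mult: "tf_alg f \<Longrightarrow> tf_alg g \<Longrightarrow> tf_alg (\<lambda>x. f x * g x)"

lemma tf_sum: "(\<And>i. i \<in> A \<Longrightarrow> tf_alg (f i)) \<Longrightarrow> tf_alg (\<lambda>x. \<Sum>i\<in>A. f i x)"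
  by (induction A rule: infinite_finite_induct) (auto intro: tf_alg.intros)

lemma tf_prod: "(\<And>i. i \<in> A \<Longrightarrow> tf_alg (f i)) \<Longrightarrow> tf_alg (\<lambda>x. \<Prod>i\<in>A. f i x)"
  by (induction A rule: infinite_finite_induct) (auto intro: tf_alg.intros)

lemma tf_power: "tf_alg f \<Longrightarrow> tf_alg (\<lambda>x. f x ^ k)"
  by (induction k) (auto intro: tf_alg.intros)

lemma tf_inner: "tf_alg (\<lambda>x. of_real (x \<bullet> x))"
proof -
  have "tf_alg (\<lambda>x. \<Sum>i\<in>UNIV. of_real (x $ i) * of_real (x $ i))"
    by (intro tf_sum tf_mult tf_coord)
  then show ?thesis by (simp add: inner_vec_def)
qed

lemma inner_axis_deriv:
  fixes x :: "real^'n::finite"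
  shows "((\<lambda>h. (x + h *\<^sub>R axis i 1) \<bullet> (x + h *\<^sub>R axis i 1)) has_real_derivative 2 * x $ i) (at 0)"
proof -
  have "((\<lambda>h. x \<bullet> x + 2 * h * x $ i + h\<^sup>2) has_real_derivative 2 * x $ i) (at 0)"
    by (auto intro!: derivative_eq_intros)
  moreover have "(x + h *\<^sub>R axis i 1) \<bullet> (x + h *\<^sub>R axis i 1) = x \<bullet> x + 2 * h * x $ i + h\<^sup>2" for h
    by (simp add: inner_add_left inner_add_right inner_axis inner_axis' power2_eq_square algebra_simps)
  ultimately show ?thesis by simp
qed

text \<open>Differentiating a cutoff only raises its index \<open>k\<close> and multiplies by
  polynomials, and a phase reproduces itself up to a coordinate factor, so the generators
  suffice.\<close>

lemma tf_derivative:
  fixes f :: "real^'n::finite \<Rightarrow> complex"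
  assumes "tf_alg f"
  shows "\<exists>g. tf_alg g \<and> (\<forall>x. ((\<lambda>h. f (x + h *\<^sub>R axis i 1)) has_vector_derivative g x) (at 0))"
  using assms
proof induction
  case (tf_const c)
  show ?case by (rule exI[of _ "\<lambda>_. 0"]) (auto intro: tf_alg.intros)
next
  case (tf_coord j)
  have "((\<lambda>h. complex_of_real ((x + h *\<^sub>R axis i 1) $ j))
      has_vector_derivative of_real (if i = j then 1 else 0)) (at 0)" for x
    by (rule has_vector_derivative_of_real) (auto intro!: derivative_eq_intros simp: axis_def)
  then show ?case by (intro exI[of _ "\<lambda>_. of_real (if i = j then 1 else 0)"])
      (auto intro: tf_alg.intros)
next
  case (tf_phase b)
  have "((\<lambda>h. cis (b * ((x + h *\<^sub>R axis i 1) \<bullet> (x + h *\<^sub>R axis i 1)))) has_vector_derivative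
      (2 * b * \<i>) * of_real (x $ i) * cis (b * (x \<bullet> x))) (at 0)" for x
  proof -
    have "((\<lambda>h. b * ((x + h *\<^sub>R axis i 1) \<bullet> (x + h *\<^sub>R axis i 1))) has_vector_derivative b
        * (2 * x $ i)) (at 0)"
      unfolding has_real_derivative_iff_has_vector_derivative[symmetric]
          by (intro DERIV_cmult inner_axis_deriv)
    from vector_diff_chain_at[OF this cis_has_vector_derivative] show ?thesis
        by (simp add: o_def scaleR_conv_of_real mult_ac)
  qed
  then show ?case by (intro exI[of _ "\<lambda>x. (2 * b * \<i>) * of_real (x $ i) * cis (b * (x \<bullet> x))"])
      (auto intro!: tf_alg.intros)
next
  case (tf_cut k a b c)
  define Q where "Q x = a + b * (x \<bullet> x) + c * (x \<bullet> x)\<^sup>2" for x :: "real^'n"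
  define g where "g x = (of_real (2 * b) + of_real (4 * c) * of_real (x \<bullet> x)) * of_real (x $ i)
      * (of_real (expk (k + 2) (Q x)) + of_real (- real k) * complex_of_real (expk (k + 1) (Q x)))"
      for x
  have "((\<lambda>h. of_real (expk k (Q (x + h *\<^sub>R axis i 1)))) has_vector_derivative g x) (at 0)" for x
  proof -
    have "((\<lambda>h. Q (x + h *\<^sub>R axis i 1)) has_real_derivative b * (2 * x $ i) + c
        * (2 * (x \<bullet> x) * (2 * x $ i))) (at 0)"
      unfolding Q_def by (rule derivative_eq_intros inner_axis_deriv refl)+ simp
    from DERIV_chain2[where f = "expk k", OF has_real_derivative_expk this]
    have "((\<lambda>h. expk k (Q (x + h *\<^sub>R axis i 1))) has_real_derivative
        (expk (k + 2) (Q x) - real k * expk (k + 1) (Q x))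
        * (b * (2 * x $ i) + c * (2 * (x \<bullet> x) * (2 * x $ i)))) (at 0)"
      by simp
    from has_vector_derivative_of_real[OF this, where 'a = complex] show ?thesis
      unfolding g_def by (simp add: algebra_simps)
  qed
  moreover have "tf_alg g" unfolding g_def Q_def by (intro tf_alg.intros tf_inner)
  ultimately show ?case unfolding Q_def by (intro exI[of _ g] conjI allI)
next
  case (tf_add f g)
  then obtain f' g' where *: "tf_alg f'" "tf_alg g'" "\<And>x.
      ((\<lambda>h. f (x + h *\<^sub>R axis i 1)) has_vector_derivative f' x) (at 0)" "\<And>x.
      ((\<lambda>h. g (x + h *\<^sub>R axis i 1)) has_vector_derivative g' x) (at 0)" by blast
  then have "\<forall>x. ((\<lambda>h. f (x + h *\<^sub>R axis i 1) + g (x + h *\<^sub>R axis i 1)) has_vector_derivative f' x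
      + g' x) (at 0)"
    by (intro allI has_vector_derivative_add)
  with tf_alg.tf_add[OF *(1,2)] show ?case by (intro exI[of _ "\<lambda>x. f' x + g' x"] conjI)
next
  case (tf_mult f g)
  then obtain f' g' where *: "tf_alg f'" "tf_alg g'" "\<And>x.
      ((\<lambda>h. f (x + h *\<^sub>R axis i 1)) has_vector_derivative f' x) (at 0)" "\<And>x.
      ((\<lambda>h. g (x + h *\<^sub>R axis i 1)) has_vector_derivative g' x) (at 0)" by blast
  have "((\<lambda>h. f (x + h *\<^sub>R axis i 1) * g (x + h *\<^sub>R axis i 1)) has_vector_derivative f x * g' x + f' x
      * g x) (at 0)" for x
    using has_vector_derivative_mult[OF *(3,4), of x x] by simp
  moreover have "tf_alg (\<lambda>x. f x * g' x + f' x * g x)" using * tf_mult.hyps by (intro tf_alg.intros)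
  ultimately show ?case by (intro exI[of _ "\<lambda>x. f x * g' x + f' x * g x"] conjI allI)
qed

lemma tf_partial_deriv:
  assumes "tf_alg f"
  shows "tf_alg (partial_deriv i f)" "((\<lambda>h. f (x + h *\<^sub>R axis i 1))
      has_vector_derivative partial_deriv i f x) (at 0)"
proof -
  obtain g where g: "tf_alg g" "\<And>x. ((\<lambda>h. f (x + h *\<^sub>R axis i 1)) has_vector_derivative g x) (at 0)"
      using tf_derivative[OF assms, of i] by blast
  then have "partial_deriv i f = g" by (auto simp: partial_deriv_def intro!: ext vector_derivative_at)
  with g show "tf_alg (partial_deriv i f)" "((\<lambda>h. f (x + h *\<^sub>R axis i 1))
      has_vector_derivative partial_deriv i f x) (at 0)" by auto
qed

text \<open>\<open>smooth_fun\<close> demands total differentiability of each iterated partial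
  derivative. Existence of partial derivatives does not give this, hence the second
  induction.\<close>

lemma tf_differentiable:
  assumes "tf_alg f" shows "f differentiable (at x)"
  using assms
proof induction
  case (tf_coord i)
  show ?case
    by (rule differentiableI[OF has_derivative_of_real[OF
        bounded_linear_imp_has_derivative[OF bounded_linear_vec_nth]]])
next
  case (tf_phase b)
  have 1: "(cis has_derivative (\<lambda>t. t *\<^sub>R (\<i> * cis y))) (at y)" for y
      using cis_has_vector_derivative[of y] by (simp only: has_vector_derivative_def)
  have 2: "((\<lambda>x. b * (x \<bullet> x)) has_derivative (\<lambda>h. b * (x \<bullet> h + h \<bullet> x))) (at x)"
    by (auto intro!: derivative_eq_intros)
  show ?case by (rule differentiableI[OF has_derivative_compose[OF 2 1]])
next
  case (tf_cut k a b c)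
  have 1: "((\<lambda>x. a + b * (x \<bullet> x) + c * (x \<bullet> x)\<^sup>2) has_derivative
      (\<lambda>h. b * (x \<bullet> h + h \<bullet> x) + c * (2 * (x \<bullet> x) * (x \<bullet> h + h \<bullet> x)))) (at x)"
    by (auto intro!: derivative_eq_intros)
  have 2: "(expk k has_derivative (*) (expk (k + 2) y - real k * expk (k + 1) y)) (at y)" for y
    using has_real_derivative_expk[of k y] by (simp only: has_field_derivative_def)
  show ?case by (rule differentiableI[OF has_derivative_of_real[OF has_derivative_compose[OF 1 2]]])
qed auto

lemma tf_continuous: "tf_alg f \<Longrightarrow> continuous_on S f"
  by (auto intro!: continuous_at_imp_continuous_on differentiable_imp_continuous_within
      tf_differentiable)

lemma tf_smooth_fun:
  assumes "tf_alg f" shows "smooth_fun f"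
proof -
  have "tf_alg (iter_partial is f)" for "is" by (induction "is")
      (use assms in \<open>auto intro: tf_partial_deriv\<close>)
  then show ?thesis unfolding smooth_fun_def by (auto intro: tf_differentiable)
qed

section \<open>Mean value of spherical harmonics\<close>

lemma hom_poly_tf:
  fixes p :: "real^'n::finite \<Rightarrow> complex"
  assumes "hom_poly k p" shows "tf_alg p"
proof -
  obtain A :: "('n \<Rightarrow> nat) set" and c where p: "\<And>x. p x
      = (\<Sum>\<alpha>\<in>A. c \<alpha> * (\<Prod>i\<in>UNIV. complex_of_real ((x $ i) ^ \<alpha> i)))"
    using assms unfolding hom_poly_def by blast
  have "tf_alg (\<lambda>x. \<Sum>\<alpha>\<in>A. c \<alpha> * (\<Prod>i\<in>UNIV. complex_of_real (x $ i) ^ \<alpha> i))"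
    by (intro tf_sum tf_mult tf_prod tf_power tf_coord tf_const)
  moreover have "p = (\<lambda>x. \<Sum>\<alpha>\<in>A. c \<alpha> * (\<Prod>i\<in>UNIV. complex_of_real (x $ i) ^ \<alpha> i))"
    by (rule ext) (simp add: p)
  ultimately show ?thesis by simp
qed

lemma hom_poly_scaleR:
  fixes p :: "real^'n::finite \<Rightarrow> complex"
  assumes "hom_poly k p" shows "p (t *\<^sub>R x) = of_real t ^ k * p x"
proof -
  obtain A :: "('n \<Rightarrow> nat) set" and c where A: "\<And>\<alpha>. \<alpha> \<in> A \<Longrightarrow> (\<Sum>i\<in>UNIV. \<alpha> i) = k"
    and p: "\<And>x. p x = (\<Sum>\<alpha>\<in>A. c \<alpha> * (\<Prod>i\<in>UNIV. complex_of_real ((x $ i) ^ \<alpha> i)))"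
    using assms unfolding hom_poly_def by blast
  have "(\<Prod>i\<in>UNIV. complex_of_real (((t *\<^sub>R x) $ i) ^ \<alpha> i)) = of_real t ^ k
      * (\<Prod>i\<in>UNIV. complex_of_real ((x $ i) ^ \<alpha> i))" if "\<alpha> \<in> A" for \<alpha>
    unfolding A[OF that, symmetric] power_sum prod.distrib[symmetric]
        by (rule prod.cong) (simp_all add: power_mult_distrib)
  then have "(\<Sum>\<alpha>\<in>A. c \<alpha> * (\<Prod>i\<in>UNIV. complex_of_real (((t *\<^sub>R x) $ i) ^ \<alpha> i)))
      = (\<Sum>\<alpha>\<in>A. of_real t ^ k * (c \<alpha> * (\<Prod>i\<in>UNIV. complex_of_real ((x $ i) ^ \<alpha> i))))"
    by (intro sum.cong) (simp_all only: mult.left_commute)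
  then show ?thesis unfolding p sum_distrib_left .
qed

text \<open>Both sides are the derivative of \<open>p (t *\<^sub>R x)\<close> at
  \<open>t = 1\<close>, once by the chain rule and once by homogeneity.\<close>

lemma hom_poly_Euler:
  fixes p :: "real^'n::finite \<Rightarrow> complex"
  assumes p: "hom_poly k p"
  shows "(\<Sum>i\<in>UNIV. of_real (x $ i) * partial_deriv i p x) = of_nat k * p x"
proof -
  obtain p' where p': "(p has_derivative p') (at x)"
    using tf_differentiable[OF hom_poly_tf[OF p], of x] unfolding differentiable_def by blast
  have lin: "linear p'" using has_derivative_linear[OF p'] .
  have pd: "partial_deriv i p x = p' (axis i 1)" for i
  proof -
    have "((\<lambda>h. x + h *\<^sub>R axis i 1) has_derivative (\<lambda>h. h *\<^sub>R axis i 1)) (at (0::real))"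
      by (auto intro!: derivative_eq_intros)
    from has_derivative_compose[OF this, of p p'] p'
    have "((\<lambda>h. p (x + h *\<^sub>R axis i 1)) has_derivative (\<lambda>h. p' (h *\<^sub>R axis i 1))) (at 0)" by simp
    then have "((\<lambda>h. p (x + h *\<^sub>R axis i 1)) has_vector_derivative p' (axis i 1)) (at 0)"
      by (simp add: has_vector_derivative_def linear_scale[OF lin])
    then show ?thesis unfolding partial_deriv_def by (rule vector_derivative_at)
  qed
  have "x = (\<Sum>i\<in>UNIV. (x $ i) *\<^sub>R axis i 1)"
    using basis_expansion[of x] by (simp add: scalar_mult_eq_scaleR)
  then have "p' x = p' (\<Sum>i\<in>UNIV. (x $ i) *\<^sub>R axis i 1)" by simp
  also have "\<dots> = (\<Sum>i\<in>UNIV. of_real (x $ i) * partial_deriv i p x)"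
    unfolding linear_sum[OF lin] linear_scale[OF lin] pd
        by (rule sum.cong) (simp_all add: scaleR_conv_of_real)
  finally have 1: "p' x = (\<Sum>i\<in>UNIV. of_real (x $ i) * partial_deriv i p x)" .
  have "((\<lambda>t. t *\<^sub>R x) has_derivative (\<lambda>t. t *\<^sub>R x)) (at (1::real))"
      by (auto intro!: derivative_eq_intros)
  from has_derivative_compose[OF this, of p p'] p' have
      "((\<lambda>t. p (t *\<^sub>R x)) has_derivative (\<lambda>t. p' (t *\<^sub>R x))) (at 1)" by simp
  then have 2: "((\<lambda>t. p (t *\<^sub>R x)) has_vector_derivative p' x) (at 1)"
    by (simp add: has_vector_derivative_def linear_scale[OF lin])
  have "((\<lambda>t. t ^ k) has_real_derivative real k) (at 1)" by (auto intro!: derivative_eq_intros)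
  then have "((\<lambda>t. complex_of_real (t ^ k)) has_vector_derivative of_real (real k)) (at 1)"
      by (rule has_vector_derivative_of_real)
  then have "((\<lambda>t. complex_of_real (t ^ k) * p x) has_vector_derivative of_real (real k) * p x) (at 1)"
    by (rule has_vector_derivative_mult_left)
  then have "((\<lambda>t. p (t *\<^sub>R x)) has_vector_derivative of_nat k * p x) (at 1)"
    unfolding hom_poly_scaleR[OF p] by simp
  with 2 have "p' x = of_nat k * p x" by (rule vector_derivative_unique_at)
  then show ?thesis using 1 by simp
qed

text \<open>Integrate the divergence of \<open>\<nabla>p expk 0 (1 - |x|\<^sup>2)\<close> and use Euler's identity.\<close>

lemma harmonic_weighted_integral_eq_0:
  fixes p :: "real^'n::finite \<Rightarrow> complex"
  assumes p: "hom_poly k p" and k: "k \<ge> 1" and L: "\<And>x. laplacian p x = 0"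
  shows "(LINT x|lborel. p x * of_real (expk 2 (1 - x \<bullet> x))) = 0"
proof -
  have tp: "tf_alg p" by (rule hom_poly_tf[OF p])
  have cut: "tf_alg (\<lambda>x::real^'n. of_real (expk j (1 - x \<bullet> x)))" for j
    using tf_cut[of j 1 "-1" 0] by simp
  have z: "expk j (1 - x \<bullet> x) = 0" if "norm x > 1" for j and x :: "real^'n"
  proof -
    have "(norm x)\<^sup>2 > 1" using that by (simp add: one_less_power)
    then show ?thesis by (simp add: expk_def power2_norm_eq_inner)
  qed
  \<comment> \<open>The weight vanishes outside the unit ball, so no boundary term arises; the
    derivative of \<open>expk 0\<close> is \<open>expk 2\<close>, which explains the weight in the
    conclusion.\<close>
  define V where "V i x = partial_deriv i p x * of_real (expk 0 (1 - x \<bullet> x))" for i x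
  define DV where "DV i x = partial_deriv i p x * (of_real (expk 2 (1 - x \<bullet> x))
      * of_real (- 2 * x $ i)) + partial_deriv i (partial_deriv i p) x * of_real (expk 0 (1 - x \<bullet> x))"
      for i x
  have tDV: "tf_alg (DV i)" for i
  proof -
    have "tf_alg (\<lambda>x. partial_deriv i p x * (of_real (expk 2 (1 - x \<bullet> x))
        * (of_real (- 2) * of_real (x $ i))) + partial_deriv i (partial_deriv i p) x
        * of_real (expk 0 (1 - x \<bullet> x)))"
      by (intro tf_alg.intros(1,2,5,6) tf_partial_deriv tp cut)
    then show ?thesis unfolding DV_def[abs_def] by simp
  qed
  have dV: "((\<lambda>h. V i (x + h *\<^sub>R axis i 1)) has_vector_derivative DV i x) (at 0)" for i x
  proof -
    have "((\<lambda>h. 1 - (x + h *\<^sub>R axis i 1) \<bullet> (x + h *\<^sub>R axis i 1)) has_real_derivative 0 - 2 * x $ i)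
        (at 0)"
      by (intro DERIV_diff inner_axis_deriv DERIV_const)
    from DERIV_chain2[where f = "expk 0", OF has_real_derivative_expk this]
    have "((\<lambda>h. expk 0 (1 - (x + h *\<^sub>R axis i 1) \<bullet> (x + h *\<^sub>R axis i 1)))
        has_real_derivative expk 2 (1 - x \<bullet> x) * (- 2 * x $ i)) (at 0)"
      by (simp add: numeral_2_eq_2)
    from has_vector_derivative_mult[OF tf_partial_deriv(2)[OF tf_partial_deriv(1)[OF tp]]
        has_vector_derivative_of_real[OF this, where 'a = complex], of i x i]
    show ?thesis unfolding V_def DV_def by simp
  qed
  have I0: "(LINT x|lborel. DV i x) = 0" for i
  proof (rule integral_directional_derivative_eq_0[OF dV])
    show "continuous_on UNIV (V i)" unfolding V_def
        by (intro tf_continuous tf_mult tf_partial_deriv tp cut)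
    show "continuous_on UNIV (DV i)" by (rule tf_continuous[OF tDV])
    show "V i x = 0" "DV i x = 0" if "norm x > 1" for x using z[OF that] by (simp_all add: V_def DV_def)
  qed
  have int: "integrable lborel (DV i)" for i
    by (rule integrable_continuous_bounded_support[OF tf_continuous[OF tDV], of 1]) (simp add: z DV_def)
  have "(\<Sum>i\<in>UNIV. DV i x) = - 2 * of_nat k * (p x * of_real (expk 2 (1 - x \<bullet> x)))" for x
  proof -
    have "(\<Sum>i\<in>UNIV. DV i x) = (\<Sum>i\<in>UNIV. of_real (x $ i) * partial_deriv i p x)
        * (- 2 * of_real (expk 2 (1 - x \<bullet> x))) + laplacian p x * of_real (expk 0 (1 - x \<bullet> x))"
      unfolding DV_def sum.distrib laplacian_def sum_distrib_right by (simp add: mult_ac)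
    then show ?thesis unfolding L hom_poly_Euler[OF p] by (simp add: mult_ac)
  qed
  then have "(LINT x|lborel. - 2 * of_nat k * (p x * of_real (expk 2 (1 - x \<bullet> x))))
      = (LINT x|lborel. (\<Sum>i\<in>UNIV. DV i x))" by simp
  also have "\<dots> = 0" using int I0 by simp
  finally show ?thesis using k by simp
qed

section \<open>Removing a radial weight from ball integrals\<close>

lemma integral_ball_homogeneous:
  fixes h :: "'a::euclidean_space \<Rightarrow> complex"
  assumes m [measurable]: "h \<in> borel_measurable borel" and hom: "\<And>c x. c > 0 \<Longrightarrow> h (c *\<^sub>R x) = h x"
      and R: "R > 0"
  shows "(LINT x:ball 0 R|lborel. h x) = of_real (R ^ DIM('a)) * (LINT x:ball 0 1|lborel. h x)"
proof -
  have L: "lborel = density (distr lborel borel (\<lambda>x::'a. 0 + R *\<^sub>R x)) (\<lambda>_. \<bar>R\<bar> ^ DIM('a))" using R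
      by (intro lborel_affine) simp
  have "(LINT x:ball 0 R|lborel. h x) = (LINT x|density (distr lborel borel (\<lambda>x::'a. 0 + R *\<^sub>R x))
      (\<lambda>_. ennreal (R ^ DIM('a))). indicator (ball 0 R) x *\<^sub>R h x)"
    unfolding set_lebesgue_integral_def by (subst L) (use R in simp)
  also have "\<dots> = (LINT x|lborel. R ^ DIM('a) *\<^sub>R (indicator (ball 0 R) (R *\<^sub>R x) *\<^sub>R h (R *\<^sub>R x)))"
  proof -
    have [measurable]: "(\<lambda>x. indicator (ball 0 R) x *\<^sub>R h x) \<in> borel_measurable borel"
      by (intro borel_measurable_scaleR borel_measurable_indicator m) auto
    have "(\<lambda>x. (R ^ DIM('a) * indicator (ball 0 R) x) *\<^sub>R h x) \<in> borel_measurable borel"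
      by (intro borel_measurable_scaleR borel_measurable_times borel_measurable_const
          borel_measurable_indicator m) auto
    then show ?thesis using R
      by (subst integral_density, simp, simp, simp, subst integral_distr) simp_all
  qed
  also have "\<dots> = (LINT x|lborel. R ^ DIM('a) *\<^sub>R (indicator (ball 0 1) x *\<^sub>R h x))"
    using R by (intro Bochner_Integration.integral_cong) (auto simp: hom indicator_def)
  finally show ?thesis unfolding set_lebesgue_integral_def by (simp add: scaleR_conv_of_real)
qed

text \<open>A substitute for polar coordinates: since \<open>\<Phi> 1 = 0\<close>, the weight at
  \<open>x\<close> is minus the integral of \<open>\<Phi>'\<close> over \<open>R\<close> from
  \<open>norm x\<close> to 1. Exchanging the integrals leaves integrals of \<open>h\<close> over
  balls of radius \<open>R\<close>, which scale by \<open>R ^ DIM('a)\<close>.\<close>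

lemma integral_ball_layer_cake:
  fixes h :: "'a::euclidean_space \<Rightarrow> complex" and \<Phi> \<Phi>' :: "real \<Rightarrow> real"
  assumes m [measurable]: "h \<in> borel_measurable borel" and hom: "\<And>c x. c > 0 \<Longrightarrow> h (c *\<^sub>R x) = h x"
    and b: "\<And>x. norm (h x) \<le> B"
    and d: "\<And>r. (\<Phi> has_real_derivative \<Phi>' r) (at r)" and c: "continuous_on UNIV \<Phi>'" and \<Phi>1: "\<Phi> 1 = 0"
  shows "(LINT x:ball 0 1|lborel. h x * of_real (\<Phi> (norm x))) = (LINT x:ball 0 1|lborel. h x)
      * of_real (- (LINT R:{0<..1}|lborel. \<Phi>' R * R ^ DIM('a)))"
proof -
  have [measurable]: "\<Phi>' \<in> borel_measurable borel" by (rule borel_measurable_continuous_onI[OF c])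
  have B0: "B \<ge> 0" using order_trans[OF norm_ge_zero b] .
  define F where "F x R = (indicator (ball 0 1) x *\<^sub>R h x) * of_real (indicator {norm x<..1} R * \<Phi>' R)"
      for x R
  have Fm: "case_prod F \<in> borel_measurable (lborel \<Otimes>\<^sub>M lborel)"
  proof -
    have "(\<lambda>(x, R). (if norm x < 1 then h x else 0) * of_real (if norm x < R \<and> R \<le> 1 then \<Phi>' R else 0))
        \<in> borel_measurable (lborel \<Otimes>\<^sub>M lborel)"
      by measurable
    also have "(\<lambda>(x, R). (if norm x < 1 then h x else 0)
        * of_real (if norm x < R \<and> R \<le> 1 then \<Phi>' R else 0)) = case_prod F"
      by (auto simp: F_def indicator_def fun_eq_iff)
    finally show ?thesis .
  qed
  have fi: "integrable lborel (\<lambda>x::'a. complex_of_real (B * indicator (ball 0 1) x))"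
    using emeasure_bounded_finite[OF bounded_ball, of "0::'a" 1]
        by (intro integrable_of_real integrable_mult_right integrable_real_indicator) auto
  have "integrable lborel (\<lambda>R. indicator {0..1} R *\<^sub>R complex_of_real (\<Phi>' R))"
    by (rule borel_integrable_compact) (auto intro!: continuous_intros continuous_on_subset[OF c])
  then have gi: "integrable lborel (\<lambda>R. indicator {0..1} R *\<^sub>R complex_of_real (\<Phi>' R))" .
  have F: "integrable (lborel \<Otimes>\<^sub>M lborel) (case_prod F)"
  proof (rule integrable_mult_product[OF fi gi Fm])
    fix x R
    show "norm (F x R) \<le> norm (complex_of_real (B * indicator (ball 0 1) x))
        * norm (indicator {0..1} R *\<^sub>R complex_of_real (\<Phi>' R))"
      using b[of x] B0 norm_ge_zero[of x]
      by (auto simp: F_def norm_mult indicator_def intro!: mult_right_mono simp del: norm_ge_zero)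
  qed
  have 1: "(LINT R|lborel. F x R) = - (indicator (ball 0 1) x *\<^sub>R (h x * of_real (\<Phi> (norm x))))" for x
  proof (cases "x \<in> ball 0 1")
    case True
    have "(LINT R|lborel. indicator {norm x<..1} R * \<Phi>' R)
        = (LINT R|lborel. indicator {norm x..1} R *\<^sub>R \<Phi>' R)"
      by (rule integral_cong_AE) (use AE_lborel_singleton[of "norm x"] in \<open>auto simp: indicator_def\<close>)
    also have "\<dots> = \<Phi> 1 - \<Phi> (norm x)"
      using True by (intro integral_FTC_atLeastAtMost)
          (auto intro: has_field_derivative_at_within[OF d] continuous_on_subset[OF c] simp flip:
          has_real_derivative_iff_has_vector_derivative)
    finally show ?thesis using True \<Phi>1 unfolding F_def integral_mult_right_zero
        integral_complex_of_real by simp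
  qed (simp add: F_def)
  have 2: "(LINT x|lborel. F x R) = of_real (indicator {0<..1} R *\<^sub>R (\<Phi>' R * R ^ DIM('a)))
      * (LINT x:ball 0 1|lborel. h x)" for R
  proof (cases "R \<in> {0<..1}")
    case True
    have "F x R = (indicator (ball 0 R) x *\<^sub>R h x) * of_real (\<Phi>' R)" for x
      using True by (auto simp: F_def indicator_def)
    then have "(LINT x|lborel. F x R) = (LINT x:ball 0 R|lborel. h x) * of_real (\<Phi>' R)"
      unfolding set_lebesgue_integral_def by (simp only: integral_mult_left_zero)
    then show ?thesis using True integral_ball_homogeneous[OF m hom, of R] by simp
  next
    case False
    have "F x R = 0" for x using False norm_ge_zero[of x]
        by (auto simp: F_def indicator_def simp del: norm_ge_zero)
    then show ?thesis using False by simp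
  qed
  have "- (LINT x:ball 0 1|lborel. h x * of_real (\<Phi> (norm x))) = (LINT x|lborel. LINT R|lborel. F x R)"
    unfolding 1 set_lebesgue_integral_def by simp
  also have "\<dots> = (LINT R|lborel. LINT x|lborel. F x R)"
      by (rule lborel_pair.Fubini_integral[OF F, symmetric])
  also have "\<dots> = of_real (LINT R:{0<..1}|lborel. \<Phi>' R * R ^ DIM('a)) * (LINT x:ball 0 1|lborel. h x)"
    unfolding 2 set_lebesgue_integral_def integral_mult_left_zero integral_complex_of_real ..
  finally show ?thesis by (simp add: mult.commute minus_equation_iff[of "LINT x:ball 0 1|lborel. h x
      * of_real (\<Phi> (norm x))"])
qed

text \<open>By homogeneity the weighted integral of \<open>p\<close>, which is zero, is that of the
  angular part \<open>h\<close> against a radial weight \<open>\<Phi>\<close>. The layer-cake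
  formula factors it as the unweighted integral times a constant \<open>K\<close>.\<close>

lemma harmonic_ball_integral_eq_0:
  fixes p :: "real^'n::finite \<Rightarrow> complex"
  assumes p: "hom_poly k p" and k: "k \<ge> 1" and L: "\<And>x. laplacian p x = 0"
  shows "(LINT x:ball 0 1|lborel. p (x /\<^sub>R norm x)) = 0"
proof -
  have cp: "continuous_on UNIV p" by (rule tf_continuous[OF hom_poly_tf[OF p]])
  have [measurable]: "p \<in> borel_measurable borel" by (rule borel_measurable_continuous_onI[OF cp])
  define h where "h x = p (x /\<^sub>R norm x)" for x
  have hm [measurable]: "h \<in> borel_measurable borel" unfolding h_def[abs_def] by measurable
  have hh: "h (c *\<^sub>R x) = h x" if "c > 0" for c x using that
      by (simp add: h_def mult.commute[of _ c] mult.assoc[symmetric])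
  have "bounded (p ` cball 0 1)"
    by (rule compact_imp_bounded) (rule compact_continuous_image, auto intro:
        continuous_on_subset[OF cp])
  then obtain B where "\<forall>y\<in>p ` cball 0 1. norm y \<le> B" unfolding bounded_iff ..
  then have hb: "norm (h x) \<le> B" for x unfolding h_def by (cases "x = 0") auto
  define \<Phi> where "\<Phi> r = r ^ k * expk 2 (1 - r\<^sup>2)" for r
  define \<Phi>' where "\<Phi>' r = real k * r ^ (k - 1) * expk 2 (1 - r\<^sup>2)
      + (expk 4 (1 - r\<^sup>2) - 2 * expk 3 (1 - r\<^sup>2)) * (- (2 * r)) * r ^ k" for r
  have dexp: "((\<lambda>r. expk j (1 - r\<^sup>2)) has_real_derivative
      (expk (j + 2) (1 - r\<^sup>2) - real j * expk (j + 1) (1 - r\<^sup>2)) * (- (2 * r))) (at r)" for j r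
    by (rule DERIV_chain2[where f = "expk j", OF has_real_derivative_expk])
        (auto intro!: derivative_eq_intros)
  have d: "(\<Phi> has_real_derivative \<Phi>' r) (at r)" for r
  proof -
    have "((\<lambda>r. r ^ k) has_real_derivative real k * r ^ (k - 1)) (at r)"
        by (auto intro!: derivative_eq_intros)
    from DERIV_mult[OF this dexp[of 2 r]] show ?thesis unfolding \<Phi>_def[abs_def] \<Phi>'_def by simp
  qed
  have cexp: "continuous_on UNIV (\<lambda>r. expk j (1 - r\<^sup>2))" for j
    using dexp by (intro continuous_at_imp_continuous_on ballI DERIV_isCont)
  have c: "continuous_on UNIV \<Phi>'" unfolding \<Phi>'_def by (intro continuous_intros cexp)
  have \<Phi>1: "\<Phi> 1 = 0" by (simp add: \<Phi>_def expk_def)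
  define K where "K = - (LINT R:{0<..1}|lborel. \<Phi>' R * R ^ DIM(real^'n))"
  have "(LINT x:ball 0 1|lborel. h x * of_real (\<Phi> (norm x))) = (LINT x:ball 0 1|lborel. h x)
      * of_real K"
    unfolding K_def by (rule integral_ball_layer_cake[OF hm hh hb d c \<Phi>1])
  moreover have "(LINT x:ball 0 1|lborel. h x * of_real (\<Phi> (norm x)))
      = (LINT x|lborel. p x * of_real (expk 2 (1 - x \<bullet> x)))"
    unfolding set_lebesgue_integral_def
  proof (rule Bochner_Integration.integral_cong[OF refl])
    fix x :: "real^'n"
    show "indicator (ball 0 1) x *\<^sub>R (h x * of_real (\<Phi> (norm x))) = p x * of_real (expk 2 (1 - x \<bullet> x))"
    proof (cases "x \<in> ball 0 1")
      case True
      have "p x = of_real (norm x) ^ k * h x"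
      proof (cases "x = 0")
        case True
        then show ?thesis using hom_poly_scaleR[OF p, of 0 x] k by (cases k) simp_all
      next
        case False
        then show ?thesis using hom_poly_scaleR[OF p, of "norm x" "x /\<^sub>R norm x"] by (simp add: h_def)
      qed
      then show ?thesis using True by (simp add: \<Phi>_def power2_norm_eq_inner)
    next
      case False
      then have "(norm x)\<^sup>2 \<ge> 1" by (simp add: one_le_power)
      then show ?thesis using False by (simp add: expk_def power2_norm_eq_inner)
    qed
  qed
  ultimately have HK: "(LINT x:ball 0 1|lborel. h x) * of_real K = 0"
    using harmonic_weighted_integral_eq_0[OF p k L] by simp
  \<comment> \<open>\<open>K\<close> depends only on the weight. The same formula for the constant
    function 1 would make the integral of \<open>\<Phi>\<close> vanish, although
    \<open>\<Phi>\<close> is positive inside the ball except possibly at the centre.\<close>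
  have "K \<noteq> 0"
  proof
    assume "K = 0"
    have cc: "(LINT x::real^'n:ball 0 1|lborel. (1::complex) * of_real (\<Phi> (norm x)))
        = (LINT x::real^'n:ball 0 1|lborel. (1::complex)) * of_real K"
      unfolding K_def by (rule integral_ball_layer_cake[where B = 1, OF _ _ _ d c \<Phi>1]) auto
    have "(LINT x::real^'n:ball 0 1|lborel. complex_of_real (\<Phi> (norm x))) = 0" using cc \<open>K = 0\<close> by simp
    then have i0: "(LINT x|lborel. indicator (ball 0 1) (x::real^'n) *\<^sub>R \<Phi> (norm x)) = 0"
      unfolding set_integral_complex_of_real by (simp add: set_lebesgue_integral_def)
    have "continuous_on UNIV \<Phi>" using d by (intro continuous_at_imp_continuous_on ballI DERIV_isCont)
    then have "integrable lborel (\<lambda>x. indicator (cball 0 1) (x::real^'n) *\<^sub>R \<Phi> (norm x))"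
      by (intro borel_integrable_compact) (auto intro!: continuous_on_compose2[of UNIV \<Phi>]
          continuous_intros)
    moreover have eq: "indicator (cball 0 1) x *\<^sub>R \<Phi> (norm x) = indicator (ball 0 1) x *\<^sub>R \<Phi> (norm x)"
        for x :: "real^'n"
      using \<Phi>1 by (auto simp: indicator_def)
    ultimately have ii: "integrable lborel (\<lambda>x. indicator (ball 0 1) (x::real^'n) *\<^sub>R \<Phi> (norm x))"
        by (simp only: eq)
    have nn: "AE x in lborel. 0 \<le> indicator (ball 0 1) (x::real^'n) *\<^sub>R \<Phi> (norm x)"
      by (intro AE_I2) (auto simp: \<Phi>_def indicator_def expk_nonneg)
    have "AE x in lborel. indicator (ball 0 1) (x::real^'n) *\<^sub>R \<Phi> (norm x) = 0"
      using integral_nonneg_eq_0_iff_AE[OF ii nn] i0 by simp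
    then have "AE x in lborel. (x::real^'n) \<notin> ball 0 1"
      using AE_lborel_singleton[of "0::real^'n"]
    proof eventually_elim
      case (elim x)
      have "\<Phi> (norm x) > 0" if "x \<in> ball 0 1"
      proof -
        have "(norm x)\<^sup>2 < 1" using that by (simp add: power_less_one_iff abs_square_less_1)
        then show ?thesis using elim(2) by (simp add: \<Phi>_def expk_def)
      qed
      then show ?case using elim(1) by (auto simp: indicator_def split: if_splits)
    qed
    then have z: "emeasure lborel (ball (0::real^'n) 1) = 0"
    proof -
      have e: "{x::real^'n. norm x < 1} = ball 0 1" by auto
      then show ?thesis using \<open>AE x in lborel. (x::real^'n) \<notin> ball 0 1\<close>
        by (subst (asm) AE_iff_measurable[OF _ refl]) auto
    qed
    then show False using content_ball_pos[of 1 "0::real^'n"] by (simp add: measure_def)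
  qed
  then show ?thesis using HK unfolding h_def by simp
qed

section \<open>The oscillatory integral along a ray\<close>

lemma norm_set_integral_le_support:
  fixes f :: "real \<Rightarrow> complex"
  assumes c: "continuous_on {a..b} f" and d: "d \<ge> 0" and C: "C \<ge> 0"
    and b: "\<And>s. s \<in> {a..b} \<Longrightarrow> norm (f s) \<le> C * indicator {m - d..m + d} s"
  shows "norm (LINT s:{a..b}|lborel. f s) \<le> 2 * C * d"
proof -
  have i: "set_integrable lborel {a..b} f" by (rule borel_integrable_atLeastAtMost'[OF c])
  have "norm (LINT s:{a..b}|lborel. f s) \<le> (LINT s|lborel. norm (indicator {a..b} s *\<^sub>R f s))"
    unfolding set_lebesgue_integral_def by (rule integral_norm_bound)
  also have "\<dots> \<le> (LINT s|lborel. C * indicator {m - d..m + d} s)"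
  proof (rule integral_mono)
    show "integrable lborel (\<lambda>s. norm (indicator {a..b} s *\<^sub>R f s))"
      using i unfolding set_integrable_def by (rule integrable_norm)
    show "integrable lborel (\<lambda>s. C * indicator {m - d..m + d} s)"
      by (intro integrable_mult_right integrable_real_indicator) (auto simp: emeasure_lborel_Icc_eq)
    show "norm (indicator {a..b} s *\<^sub>R f s) \<le> C * indicator {m - d..m + d} s" for s
      using b[of s] C by (auto simp: indicator_def)
  qed
  also have "\<dots> = 2 * C * d" using d by simp
  finally show ?thesis .
qed

text \<open>A function of \<open>s^2\<close>, so that on the whole space it becomes a smooth
  function of \<open>x \<bullet> x\<close> and belongs to \<open>tf_alg\<close>. The second argument
  is the index in the family closed under differentiation.\<close>

definition cutoff :: "real \<Rightarrow> nat \<Rightarrow> real \<Rightarrow> real" where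
  "cutoff N k s = expk k (1 - N * (s\<^sup>2 - 1)\<^sup>2)"

lemma cutoff_nonneg: "cutoff N k s \<ge> 0" by (simp add: cutoff_def expk_nonneg)

lemma cutoff_le: "cutoff N k s \<le> fact k" by (simp add: cutoff_def expk_le_fact)

lemma cutoff_support:
  assumes N: "N > 0" and s: "s \<ge> 0" and nz: "cutoff N k s \<noteq> 0"
  shows "\<bar>s\<^sup>2 - 1\<bar> < 1 / sqrt N" "\<bar>s - 1\<bar> < 1 / sqrt N"
proof -
  have "N * (s\<^sup>2 - 1)\<^sup>2 < 1" using nz by (simp add: cutoff_def expk_def split: if_splits)
  then have "(sqrt N * \<bar>s\<^sup>2 - 1\<bar>)\<^sup>2 < 1\<^sup>2" using N by (simp add: power_mult_distrib)
  then have "sqrt N * \<bar>s\<^sup>2 - 1\<bar> < 1" by (rule power2_less_imp_less) simp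
  then show 1: "\<bar>s\<^sup>2 - 1\<bar> < 1 / sqrt N" using N by (simp add: pos_less_divide_eq mult.commute)
  have "s\<^sup>2 - 1 = (s - 1) * (s + 1)" by (simp add: power2_eq_square algebra_simps)
  then have "\<bar>s\<^sup>2 - 1\<bar> = \<bar>s - 1\<bar> * \<bar>s + 1\<bar>" by (simp add: abs_mult)
  moreover have "\<bar>s - 1\<bar> * 1 \<le> \<bar>s - 1\<bar> * \<bar>s + 1\<bar>" using s by (intro mult_left_mono) auto
  ultimately have "\<bar>s - 1\<bar> \<le> \<bar>s\<^sup>2 - 1\<bar>" by simp
  then show "\<bar>s - 1\<bar> < 1 / sqrt N" using 1 by (rule le_less_trans)
qed

lemma has_real_derivative_cutoff:
  "(cutoff N k has_real_derivative (cutoff N (k + 2) s - real k * cutoff N (k + 1) s)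
      * (- (4 * N * (s\<^sup>2 - 1) * s))) (at s)"
  unfolding cutoff_def[abs_def]
  by (rule DERIV_chain2[where f = "expk k", OF has_real_derivative_expk])
     (auto intro!: derivative_eq_intros simp: power2_eq_square algebra_simps)

lemma continuous_on_cutoff: "continuous_on A (cutoff N k)"
  by (auto intro!: continuous_at_imp_continuous_on DERIV_isCont has_real_derivative_cutoff)

text \<open>The exponent will be \<open>p = (n - 1) / 2\<close>, half of the radial Jacobian, as
  required by the Liouville form of the Hankel transform.\<close>

definition amplitude :: "real \<Rightarrow> real \<Rightarrow> real \<Rightarrow> real" where
  "amplitude p N s = s powr p * cutoff N 0 s"

lemma amplitude_nonneg: "amplitude p N s \<ge> 0"
  by (simp add: amplitude_def cutoff_nonneg)

lemma continuous_on_amplitude: "continuous_on {1/2..3/2} (amplitude p N)"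
  unfolding amplitude_def by (auto intro!: continuous_intros continuous_on_cutoff)

lemma amplitude_le:
  assumes N: "N > 0" and p: "p \<ge> 0" and s: "s \<in> {1/2..3/2}"
  shows "amplitude p N s \<le> 2 powr p * indicator {1 - 1 / sqrt N..1 + 1 / sqrt N} s"
proof (cases "cutoff N 0 s = 0")
  case False
  have "s powr p * cutoff N 0 s \<le> 2 powr p * 1"
    using s p cutoff_le[of N 0 s] cutoff_nonneg[of N 0 s] by (intro mult_mono powr_mono2) auto
  moreover have "s \<in> {1 - 1 / sqrt N..1 + 1 / sqrt N}"
    using cutoff_support(2)[OF N _ False] s by (auto simp: abs_less_iff)
  ultimately show ?thesis by (simp add: amplitude_def)
qed (simp add: amplitude_def)

lemma amplitude_integral_ge:
  assumes N: "N \<ge> 1" and p: "p \<ge> 0"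
  shows "(LINT s:{1/2..3/2}|lborel. amplitude p N s) \<ge> (1/2) powr p * exp (- 2) / 2 / sqrt N"
proof -
  \<comment> \<open>A quarter of the support radius: there \<open>|s^2 - 1| \<le> 9/4 * d\<close>,
    so \<open>N * (s^2 - 1)^2 \<le> 81/256 < 1/2\<close> and the cutoff is at least
    \<open>exp (- 2)\<close>.\<close>
  define d where "d = 1 / (4 * sqrt N)"
  have sN: "sqrt N \<ge> 1" using N by simp
  then have d: "0 < d" "d \<le> 1/4" using N by (auto simp: d_def field_simps)
  define C where "C = (1/2) powr p * exp (- 2)"
  have "C * (2 * d) = (LINT s|lborel. C * indicator {1 - d..1 + d} s)" using d by simp
  also have "\<dots> \<le> (LINT s:{1/2..3/2}|lborel. amplitude p N s)"
    unfolding set_lebesgue_integral_def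
  proof (rule integral_mono)
    show "integrable lborel (\<lambda>s. indicator {1/2..3/2} s *\<^sub>R amplitude p N s)"
      using borel_integrable_atLeastAtMost'[OF continuous_on_amplitude]
          by (simp add: set_integrable_def)
    show "integrable lborel (\<lambda>s. C * indicator {1 - d..1 + d} s)"
      by (intro integrable_mult_right integrable_real_indicator) (auto simp: emeasure_lborel_Icc_eq)
    show "C * indicator {1 - d..1 + d} s \<le> indicator {1/2..3/2} s *\<^sub>R amplitude p N s" for s
    proof (cases "s \<in> {1 - d..1 + d}")
      case True
      then have s: "s \<in> {1/2..3/2}" "\<bar>s - 1\<bar> \<le> d" "\<bar>s + 1\<bar> \<le> 9/4" using d by auto
      have "s\<^sup>2 - 1 = (s - 1) * (s + 1)" by (simp add: power2_eq_square algebra_simps)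
      then have "\<bar>s\<^sup>2 - 1\<bar> = \<bar>s - 1\<bar> * \<bar>s + 1\<bar>" by (simp add: abs_mult)
      also have "\<dots> \<le> d * (9/4)" using d by (intro mult_mono s) auto
      finally have "\<bar>s\<^sup>2 - 1\<bar> \<le> d * (9/4)" .
      then have "\<bar>s\<^sup>2 - 1\<bar>\<^sup>2 \<le> (d * (9/4))\<^sup>2" by (rule power_mono) simp
      then have "N * (s\<^sup>2 - 1)\<^sup>2 \<le> N * (d * (9/4))\<^sup>2" using N by (intro mult_left_mono) auto
      also have "\<dots> = 81/256" using N by (simp add: d_def power_mult_distrib power_divide)
      finally have q: "1 - N * (s\<^sup>2 - 1)\<^sup>2 \<ge> 1/2" by simp
      then have "1 / (1 - N * (s\<^sup>2 - 1)\<^sup>2) \<le> 1 / (1/2)" by (intro divide_left_mono) auto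
      then have "exp (- 2) \<le> cutoff N 0 s" using q by (simp add: cutoff_def expk_def)
      moreover have "(1/2) powr p \<le> s powr p" using s p by (intro powr_mono2) auto
      ultimately have "C \<le> amplitude p N s" unfolding C_def amplitude_def by (intro mult_mono) auto
      then show ?thesis using True s by simp
    qed (simp add: amplitude_nonneg)
  qed
  also have "C * (2 * d) = (1/2) powr p * exp (- 2) / 2 / sqrt N" by (simp add: C_def d_def)
  finally show ?thesis .
qed

text \<open>Completing the square leaves the phase \<open>- M * (s - 1)^2 / 2\<close>. On the
  support it is at most 1/2 in modulus, below \<open>pi / 3\<close>, so the real part keeps half of
  the amplitude. No cancellation estimate is involved.\<close>

lemma stationary_phase_lower:
  assumes N: "N \<ge> 1" and M: "0 < M" "M \<le> N"
  shows "norm (LINT s:{1/2..3/2}|lborel. cis (M * s - M * s\<^sup>2 / 2) * of_real (amplitude p N s))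
      \<ge> (LINT s:{1/2..3/2}|lborel. amplitude p N s) / 2"
proof -
  define f where "f s = cis (- (M * (s - 1)\<^sup>2 / 2)) * of_real (amplitude p N s)" for s
  have cf: "continuous_on {1/2..3/2} f" unfolding f_def
      by (intro continuous_intros continuous_on_amplitude) auto
  have "cis (M * s - M * s\<^sup>2 / 2) * of_real (amplitude p N s) = cis (M / 2) * f s" for s
  proof -
    have "M * s - M * s\<^sup>2 / 2 = M / 2 + - (M * (s - 1)\<^sup>2 / 2)"
        by (simp add: power2_eq_square field_simps)
    then show ?thesis by (simp only: f_def cis_mult[symmetric] mult.assoc)
  qed
  then have "norm (LINT s:{1/2..3/2}|lborel. cis (M * s - M * s\<^sup>2 / 2) * of_real (amplitude p N s))
      = norm (LINT s:{1/2..3/2}|lborel. f s)"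
    by (simp add: norm_mult)
  moreover have "(LINT s:{1/2..3/2}|lborel. amplitude p N s) / 2
      = (LINT s:{1/2..3/2}|lborel. amplitude p N s / 2)" by simp
  moreover have "\<dots> \<le> (LINT s:{1/2..3/2}|lborel. Re (f s))"
  proof (rule set_integral_mono)
    show "set_integrable lborel {1/2..3/2} (\<lambda>s. amplitude p N s / 2)"
      by (intro borel_integrable_atLeastAtMost' continuous_intros continuous_on_amplitude) simp
    show "set_integrable lborel {1/2..3/2} (\<lambda>s. Re (f s))"
      by (intro borel_integrable_atLeastAtMost' continuous_intros cf)
    fix s :: real assume s: "s \<in> {1/2..3/2}"
    show "amplitude p N s / 2 \<le> Re (f s)"
    proof (cases "cutoff N 0 s = 0")
      case False
      have "\<bar>s - 1\<bar> \<le> 1 / sqrt N" using cutoff_support(2)[OF _ _ False] s N by simp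
      then have "\<bar>s - 1\<bar>\<^sup>2 \<le> (1 / sqrt N)\<^sup>2" by (intro power_mono) auto
      then have "(s - 1)\<^sup>2 \<le> 1 / N" using N by (simp add: power_divide)
      then have "M * (s - 1)\<^sup>2 \<le> N * (1 / N)" using M by (intro mult_mono) auto
      then have "M * (s - 1)\<^sup>2 / 2 \<le> pi / 3" using N pi_gt3 by simp
      then have "cos (pi / 3) \<le> cos (M * (s - 1)\<^sup>2 / 2)" using M by (intro cos_monotone_0_pi_le) auto
      then have "1 / 2 * amplitude p N s \<le> cos (M * (s - 1)\<^sup>2 / 2) * amplitude p N s"
        by (intro mult_right_mono amplitude_nonneg) (simp add: cos_60)
      then show ?thesis by (simp add: f_def)
    qed (simp add: f_def amplitude_def)
  qed
  moreover have "\<dots> = Re (LINT s:{1/2..3/2}|lborel. f s)"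
    using borel_integrable_atLeastAtMost'[OF cf] unfolding set_integrable_def set_lebesgue_integral_def
    by (subst integral_Re[symmetric]) auto
  moreover have "\<dots> \<le> norm (LINT s:{1/2..3/2}|lborel. f s)" by (rule complex_Re_le_cmod)
  ultimately show ?thesis by linarith
qed

text \<open>The phase derivative \<open>- M * (1 + s)\<close> has no zero on the interval, and one
  integration by parts gains \<open>1 / M\<close>. The differentiated amplitude grows like
  \<open>sqrt N\<close>, but lives on a window of length \<open>2 / sqrt N\<close>, so nothing else
  is lost.\<close>

lemma nonstationary_phase_upper:
  assumes N: "N \<ge> 4" and M: "M > 0" and p: "p \<ge> 0"
  shows "norm (LINT s:{1/2..3/2}|lborel. cis (- (M * s) - M * s\<^sup>2 / 2) * of_real (amplitude p N s)) \<le> 2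
      * (2 powr p * (2 * p + 13)) / M"
proof -
  have N0: "N > 0" using N by simp
  define a where "a s = amplitude p N s / (1 + s)" for s
  define da where "da s = ((p / s * s powr p * cutoff N 0 s + s powr p
      * (cutoff N 2 s * (- (4 * N * (s\<^sup>2 - 1) * s)))) * (1 + s) - amplitude p N s) / (1 + s)\<^sup>2" for s
  have a': "(a has_real_derivative da s) (at s)" if s: "s \<in> {1/2..3/2}" for s
  proof -
    have s0: "s > 0" using s by simp
    have cut: "(cutoff N 0 has_real_derivative (cutoff N 2 s * (- (4 * N * (s\<^sup>2 - 1) * s)))) (at s)"
      using has_real_derivative_cutoff[of N 0 s] by (simp add: numeral_2_eq_2)
    have "(amplitude p N has_real_derivative p / s * s powr p * cutoff N 0 s + s powr p
        * (cutoff N 2 s * (- (4 * N * (s\<^sup>2 - 1) * s)))) (at s)"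
      unfolding amplitude_def[abs_def] using DERIV_mult[OF powr_deriv[OF s0, of p] cut]
          by (simp add: mult.commute)
    moreover have "((\<lambda>s. 1 + s) has_real_derivative 1) (at s)" by (auto intro!: derivative_eq_intros)
    ultimately show ?thesis unfolding a_def[abs_def] da_def
        using DERIV_divide[of "amplitude p N" _ s UNIV "\<lambda>s. 1 + s" 1] s0
      by (simp add: power2_eq_square)
  qed
  have ca: "continuous_on {1/2..3/2} a" unfolding a_def
      by (intro continuous_intros continuous_on_amplitude) auto
  have cda: "continuous_on {1/2..3/2} da" unfolding da_def
      by (intro continuous_intros continuous_on_amplitude continuous_on_cutoff) auto
  define e where "e s = cis (- (M * s) - M * s\<^sup>2 / 2)" for s
  have ce: "continuous_on {1/2..3/2} e" unfolding e_def by (intro continuous_intros) auto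
  have e': "(e has_vector_derivative of_real (- M * (1 + s)) * (\<i> * e s)) (at s)" for s
  proof -
    have "((\<lambda>s. - (M * s) - M * s\<^sup>2 / 2) has_vector_derivative (- M * (1 + s))) (at s)"
      unfolding has_real_derivative_iff_has_vector_derivative[symmetric]
          by (auto intro!: derivative_eq_intros simp: algebra_simps)
    from vector_diff_chain_at[OF this cis_has_vector_derivative] show ?thesis
        by (simp add: o_def e_def[abs_def] scaleR_conv_of_real)
  qed
  define J where "J = (LINT s:{1/2..3/2}|lborel. e s * of_real (amplitude p N s))"
  \<comment> \<open>At the end points \<open>(s^2 - 1)^2\<close> is 9/16 and 25/16, so
    \<open>N \<ge> 4\<close> closes the cutoff and removes the boundary terms.\<close>
  have edge: "amplitude p N (1/2) = 0" "amplitude p N (3/2) = 0"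
    using N by (simp_all add: amplitude_def cutoff_def expk_def power2_eq_square)
  have 1: "set_integrable lborel {1/2..3/2} (\<lambda>s. e s * of_real (da s))"
    by (intro borel_integrable_atLeastAtMost' continuous_intros ce cda)
  have 2: "set_integrable lborel {1/2..3/2} (\<lambda>s. (- \<i> * of_real M) * (e s * of_real (amplitude p N s)))"
    by (intro borel_integrable_atLeastAtMost' continuous_intros ce continuous_on_amplitude)
  define F where "F s = e s * of_real (a s)" for s
  define dF where "dF s = e s * of_real (da s) + (- \<i> * of_real M) * (e s * of_real (amplitude p N s))"
      for s
  have F': "(F has_vector_derivative dF s) (at s within {1/2..3/2})" if s: "s \<in> {1/2..3/2}" for s
  proof -
    have hv: "(F has_vector_derivative e s * of_real (da s) + (of_real (- M * (1 + s)) * (\<i> * e s))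
        * of_real (a s)) (at s)"
      unfolding F_def by (intro has_vector_derivative_mult e' has_vector_derivative_of_real a' s)
    have "amplitude p N s = (1 + s) * a s" using s by (simp add: a_def)
    then have eq: "(of_real (- M * (1 + s)) * (\<i> * e s)) * of_real (a s) = (- \<i> * of_real M)
        * (e s * of_real (amplitude p N s))"
      by simp
    show ?thesis using hv unfolding eq dF_def by (rule has_vector_derivative_at_within)
  qed
  have cdF: "continuous_on {1/2..3/2} dF"
    unfolding dF_def by (intro continuous_intros ce cda continuous_on_amplitude)
  have "(LINT s:{1/2..3/2}|lborel. dF s) = F (3/2) - F (1/2)"
    unfolding set_lebesgue_integral_def by (rule integral_FTC_atLeastAtMost) (use F' cdF in auto)
  also have "\<dots> = 0" using edge by (simp add: F_def a_def)
  finally have "(LINT s:{1/2..3/2}|lborel. e s * of_real (da s)) = \<i> * of_real M * J"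
    unfolding dF_def set_integral_add(2)[OF 1 2] set_integral_mult_right J_def
        by (simp add: add_eq_0_iff2)
  then have "M * norm J = norm (LINT s:{1/2..3/2}|lborel. e s * of_real (da s))" using M
      by (simp add: norm_mult)
  also have "\<dots> \<le> 2 * (2 powr p * (2 * p + 13) * sqrt N) * (1 / sqrt N)"
  proof (rule norm_set_integral_le_support)
    show "continuous_on {1/2..3/2} (\<lambda>s. e s * of_real (da s))" by (intro continuous_intros ce cda)
    fix s :: real assume s: "s \<in> {1/2..3/2}"
    have s0: "s > 0" using s by simp
    show "norm (e s * of_real (da s)) \<le> 2 powr p * (2 * p + 13) * sqrt N
        * indicator {1 - 1 / sqrt N..1 + 1 / sqrt N} s"
    proof (cases "s \<in> {1 - 1 / sqrt N..1 + 1 / sqrt N}")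
      case True
      have sp: "s powr p \<le> 2 powr p" using s p by (intro powr_mono2) auto
      have sN: "sqrt N \<ge> 1" using N by simp
      have t1: "\<bar>p / s * s powr p * cutoff N 0 s\<bar> \<le> 2 * p * 2 powr p"
      proof -
        have "p / s \<le> p / (1/2)" using s p by (intro divide_left_mono) auto
        then have "p / s * s powr p * cutoff N 0 s \<le> (2 * p) * 2 powr p * 1"
          using s0 p sp cutoff_le[of N 0 s] cutoff_nonneg[of N 0 s] by (intro mult_mono) auto
        moreover have "p / s * s powr p * cutoff N 0 s \<ge> 0" using s0 p cutoff_nonneg[of N 0 s]
            by (intro mult_nonneg_nonneg) auto
        ultimately show ?thesis by simp
      qed
      have t2: "\<bar>s powr p * (cutoff N 2 s * (- (4 * N * (s\<^sup>2 - 1) * s)))\<bar> \<le> 2 powr p * (12 * sqrt N)"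
      proof (cases "cutoff N 2 s = 0")
        case False
        have "N * \<bar>s\<^sup>2 - 1\<bar> \<le> N * (1 / sqrt N)" using cutoff_support(1)[OF N0 less_imp_le[OF s0] False]
            N by (intro mult_left_mono) auto
        also have "\<dots> = sqrt N" using N by (simp add: real_div_sqrt)
        finally have "4 * (N * \<bar>s\<^sup>2 - 1\<bar>) * s \<le> 4 * sqrt N * (3/2)" using s N0 by (intro mult_mono) auto
        then have "\<bar>- (4 * N * (s\<^sup>2 - 1) * s)\<bar> \<le> 6 * sqrt N" using N s0
            by (simp add: abs_mult mult.assoc)
        then have "cutoff N 2 s * \<bar>- (4 * N * (s\<^sup>2 - 1) * s)\<bar> \<le> 2 * (6 * sqrt N)"
          using cutoff_le[of N 2 s] cutoff_nonneg[of N 2 s] by (intro mult_mono) auto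
        then have "s powr p * (cutoff N 2 s * \<bar>- (4 * N * (s\<^sup>2 - 1) * s)\<bar>) \<le> 2 powr p
            * (2 * (6 * sqrt N))"
          by (rule mult_mono[OF sp]) (use cutoff_nonneg[of N 2 s] in auto)
        then show ?thesis using cutoff_nonneg[of N 2 s] by (simp add: abs_mult)
      qed (use N in simp)
      have t3: "amplitude p N s \<le> 2 powr p" using amplitude_le[OF N0 p s] True by simp
      have u: "1 / (1 + s) \<le> 1" "1 / (1 + s) \<ge> 0" using s0 by auto
      have dae: "da s = (p / s * s powr p * cutoff N 0 s) * (1 / (1 + s))
          + (s powr p * (cutoff N 2 s * (- (4 * N * (s\<^sup>2 - 1) * s)))) * (1 / (1 + s)) - amplitude p N s
          * (1 / (1 + s)) * (1 / (1 + s))"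
      proof -
        have gen: "((X + Y) * u - Z) / u\<^sup>2 = X * (1 / u) + Y * (1 / u) - Z * (1 / u) * (1 / u)"
            if "u \<noteq> 0" for X Y Z u :: real
          using that by (simp add: field_simps power2_eq_square)
        show ?thesis unfolding da_def by (rule gen) (use s0 in simp)
      qed
      have "\<bar>da s\<bar> \<le> \<bar>(p / s * s powr p * cutoff N 0 s) * (1 / (1 + s))\<bar>
          + \<bar>(s powr p * (cutoff N 2 s * (- (4 * N * (s\<^sup>2 - 1) * s)))) * (1 / (1 + s))\<bar>
          + \<bar>amplitude p N s * (1 / (1 + s)) * (1 / (1 + s))\<bar>"
      proof -
        have tri: "\<bar>X + Y - Z\<bar> \<le> \<bar>X\<bar> + \<bar>Y\<bar> + \<bar>Z\<bar>" for X Y Z :: real by linarith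
        show ?thesis unfolding dae by (rule tri)
      qed
      also have "\<dots> \<le> 2 * p * 2 powr p + 2 powr p * (12 * sqrt N) + 2 powr p"
      proof -
        have damp: "\<bar>x * (1 / (1 + s))\<bar> \<le> b" if "\<bar>x\<bar> \<le> b" for x b
        proof -
          have "\<bar>x * (1 / (1 + s))\<bar> = \<bar>x\<bar> * (1 / (1 + s))" unfolding abs_mult using u(2)
              by (simp only: abs_of_nonneg)
          also have "\<dots> \<le> \<bar>x\<bar> * 1" using u(1) by (rule mult_left_mono) simp
          finally show ?thesis using that by simp
        qed
        have "\<bar>amplitude p N s\<bar> \<le> 2 powr p" using t3 amplitude_nonneg[of p N s] by simp
        then show ?thesis by (intro add_mono damp t1 t2)
      qed
      also have "\<dots> \<le> 2 powr p * (2 * p + 13) * sqrt N"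
      proof -
        have "2 powr p * (2 * p + 1) * 1 \<le> 2 powr p * (2 * p + 1) * sqrt N" using sN p
            by (intro mult_left_mono) auto
        then show ?thesis by (simp add: algebra_simps)
      qed
      finally show ?thesis using True by (simp add: norm_mult e_def)
    next
      case False
      then have "\<not> \<bar>s - 1\<bar> < 1 / sqrt N" by (auto simp: abs_less_iff)
      then have "cutoff N j s = 0" for j using cutoff_support(2)[OF N0 less_imp_le[OF s0], of j]
          by blast
      then show ?thesis using False by (simp add: da_def amplitude_def)
    qed
  qed (use N p in auto)
  also have "\<dots> = 2 * (2 powr p * (2 * p + 13))" using N by simp
  finally show ?thesis using M unfolding J_def e_def by (simp add: pos_le_divide_eq mult.commute)
qed

text \<open>The asymptotics split the integral into a stationary part of order
  \<open>1 / sqrt N\<close>, a nonstationary part and an error part, both of order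
  \<open>1 / N\<close>. The restriction on \<open>r\<close> keeps \<open>M\<close> between
  \<open>N / 3\<close> and \<open>N\<close>: the upper bound is needed for the first part, the lower
  one for the others.\<close>

lemma propagated_wave_lower_bound:
  assumes nu: "\<nu> > 0" and p: "p \<ge> 0"
  obtains c N0 :: real where "c > 0" "N0 \<ge> 6"
    "\<And>N r. N \<ge> N0 \<Longrightarrow> 1/4 \<le> r \<Longrightarrow> r \<le> 1/2 \<Longrightarrow>
       c \<le> sqrt (N / (1 - r)) * norm (LINT s:{1/2..3/2}|lborel. of_real
           (bessel_w \<nu> (N / (1 - r) * r * s)) * cis (- (N / (1 - r) * r * s\<^sup>2 / 2))
           * of_real (amplitude p N s))"
proof -
  obtain l :: complex and K where l: "l \<noteq> 0" and K: "K \<ge> 0"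
    and as: "\<And>z. z \<ge> 1 \<Longrightarrow> \<bar>bessel_w \<nu> z + Im (cis (- z) * l)\<bar> \<le> K / z"
    by (rule bessel_w_asymptotics[OF nu]) (rule that)
  define S where "S = 2 powr p"
  define C1 where "C1 = S * (2 * p + 13)"
  define b where "b = (1/2) powr p * exp (- 2) / 2"
  define D where "D = 3 * norm l * C1 + 12 * K * S"
  have pos: "S > 0" "C1 > 0" "b > 0" "norm l > 0" "D \<ge> 0" using p l K
      by (auto simp: S_def C1_def b_def D_def)
  \<comment> \<open>Half of the leading constant \<open>norm l * b / 4\<close>; the other half
    absorbs the remainder \<open>D / sqrt N\<close>.\<close>
  define c where "c = norm l * b / 8"
  \<comment> \<open>The value 6 gives \<open>M \<ge> 2\<close>, hence \<open>M * s \<ge> 1\<close>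
    on the interval, where the asymptotics hold; the second entry forces
    \<open>D / sqrt N \<le> c\<close>.\<close>
  define N0 where "N0 = max 6 ((D / c)\<^sup>2)"
  have c: "c > 0" using pos by (simp add: c_def)
  have "c \<le> sqrt (N / (1 - r)) * norm (LINT s:{1/2..3/2}|lborel. of_real
      (bessel_w \<nu> (N / (1 - r) * r * s)) * cis (- (N / (1 - r) * r * s\<^sup>2 / 2))
      * of_real (amplitude p N s))"
    if N: "N \<ge> N0" and r: "1/4 \<le> r" "r \<le> 1/2" for N r
  proof -
    have N6: "N \<ge> 6" and ND: "N \<ge> (D / c)\<^sup>2" using N by (auto simp: N0_def)
    have sN: "sqrt N \<ge> 1" "sqrt N > 0" using N6 by auto
    define M where "M = N / (1 - r) * r"
    have rr: "r / (1 - r) \<le> 1" "1/3 \<le> r / (1 - r)" using r by (auto simp: field_simps)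
    have "M = N * (r / (1 - r))" by (simp add: M_def)
    moreover have "N * (1/3) \<le> N * (r / (1 - r))" by (rule mult_left_mono[OF rr(2)]) (use N6 in simp)
    moreover have "N * (r / (1 - r)) \<le> N * 1" by (rule mult_left_mono[OF rr(1)]) (use N6 in simp)
    ultimately have M: "M \<le> N" "N / 3 \<le> M" by auto
    have M2: "M \<ge> 2" using M N6 by simp
    define ap where "ap s = complex_of_real (amplitude p N s)" for s
    define er where "er s = bessel_w \<nu> (M * s) + Im (cis (- (M * s)) * l)" for s
    have cap: "continuous_on {1/2..3/2} ap" unfolding ap_def
        by (intro continuous_intros continuous_on_amplitude)
    have cw: "continuous_on {1/2..3/2} (\<lambda>s. bessel_w \<nu> (M * s))"
      using M2 by (intro continuous_on_compose2[OF continuous_on_bessel_w[OF nu]] continuous_intros)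
          auto
    have ce: "continuous_on {1/2..3/2} er" unfolding er_def by (intro continuous_intros cw)
    define f1 where "f1 s = cis (M * s - M * s\<^sup>2 / 2) * ap s" for s
    define f2 where "f2 s = cis (- (M * s) - M * s\<^sup>2 / 2) * ap s" for s
    define f3 where "f3 s = of_real (er s) * cis (- (M * s\<^sup>2 / 2)) * ap s" for s
    have cc: "continuous_on {1/2..3/2} f1" "continuous_on {1/2..3/2} f2" "continuous_on {1/2..3/2} f3"
      unfolding f1_def f2_def f3_def by (intro continuous_intros cap ce; simp)+
    note ii = cc[THEN borel_integrable_atLeastAtMost']
    define I1 where "I1 = (LINT s:{1/2..3/2}|lborel. f1 s)"
    define I2 where "I2 = (LINT s:{1/2..3/2}|lborel. f2 s)"
    define I3 where "I3 = (LINT s:{1/2..3/2}|lborel. f3 s)"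
    \<comment> \<open>From \<open>- Im z = \<i> / 2 * (z - cnj z)\<close>: the two conjugate halves
      of the cosine give \<open>f2\<close> (nonstationary) and \<open>f1\<close>
      (stationary).\<close>
    have split: "of_real (bessel_w \<nu> (M * s)) * cis (- (M * s\<^sup>2 / 2)) * ap s = (\<i> / 2 * l)
        * f2 s - (\<i> / 2 * cnj l) * f1 s + f3 s" for s
    proof -
      have "complex_of_real (bessel_w \<nu> (M * s)) = of_real (er s)
          + of_real (- Im (cis (- (M * s)) * l))"
        unfolding er_def of_real_add[symmetric] by simp
      also have "complex_of_real (- Im z) = \<i> / 2 * (z - cnj z)" for z by (simp add: complex_eq_iff)
      also have "cnj (cis (- (M * s)) * l) = cis (M * s) * cnj l" by (simp add: cis_cnj)
      finally have w: "complex_of_real (bessel_w \<nu> (M * s)) = of_real (er s) + \<i> / 2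
          * (cis (- (M * s)) * l - cis (M * s) * cnj l)" .
      have c: "cis (- (M * s) - M * s\<^sup>2 / 2) = cis (- (M * s))
          * cis (- (M * s\<^sup>2 / 2))" "cis (M * s - M * s\<^sup>2 / 2) = cis (M * s) * cis (- (M * s\<^sup>2 / 2))"
        by (simp_all add: cis_mult)
      show ?thesis unfolding f1_def f2_def f3_def w c by (simp add: algebra_simps)
    qed
    have "(LINT s:{1/2..3/2}|lborel. of_real (bessel_w \<nu> (M * s)) * cis (- (M * s\<^sup>2 / 2)) * ap s)
        = (\<i> / 2 * l) * I2 - (\<i> / 2 * cnj l) * I1 + I3"
      unfolding split I1_def I2_def I3_def using ii
      by (subst set_integral_add(2), simp, simp, subst set_integral_diff(2)) simp_all
    moreover have "norm ((\<i> / 2 * cnj l) * I1) = norm l / 2 * norm I1" "norm ((\<i> / 2 * l) * I2)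
        = norm l / 2 * norm I2"
      by (simp_all add: norm_mult norm_divide)
    moreover have "norm (\<i> / 2 * cnj l * I1) - norm (\<i> / 2 * l * I2) - norm I3
        \<le> norm ((\<i> / 2 * l) * I2 - (\<i> / 2 * cnj l) * I1 + I3)"
    proof -
      have "norm (\<i> / 2 * cnj l * I1) \<le> norm ((\<i> / 2 * l) * I2
          + I3 - ((\<i> / 2 * l) * I2 - (\<i> / 2 * cnj l) * I1 + I3))" by simp
      also have "\<dots> \<le> norm ((\<i> / 2 * l) * I2 + I3) + norm
          ((\<i> / 2 * l) * I2 - (\<i> / 2 * cnj l) * I1 + I3)" by (rule norm_triangle_ineq4)
      also have "norm ((\<i> / 2 * l) * I2 + I3) \<le> norm ((\<i> / 2 * l) * I2) + norm I3"
          by (rule norm_triangle_ineq)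
      finally show ?thesis by linarith
    qed
    ultimately have low: "norm l / 2 * norm I1 - norm l / 2 * norm I2 - norm I3
        \<le> norm (LINT s:{1/2..3/2}|lborel. of_real (bessel_w \<nu> (M * s)) * cis (- (M * s\<^sup>2 / 2)) * ap s)"
      by simp
    have b1: "norm I1 \<ge> b / sqrt N / 2"
      using stationary_phase_lower[of N M p] amplitude_integral_ge[of N p] N6 M M2 p
      unfolding I1_def f1_def ap_def b_def by simp
    have b2: "norm I2 \<le> 6 * C1 / N"
    proof -
      have "norm I2 \<le> 2 * C1 / M"
        using nonstationary_phase_upper[of N M p] N6 M2 p unfolding I2_def f2_def ap_def C1_def S_def
            by simp
      also have "\<dots> \<le> 2 * C1 / (N / 3)" using M N6 pos M2 by (intro divide_left_mono) auto
      finally show ?thesis by simp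
    qed
    have b3: "norm I3 \<le> 12 * K * S / N"
    proof -
      have "norm I3 \<le> 2 * (2 * K / M * S) * (1 / sqrt N)"
        unfolding I3_def
      proof (rule norm_set_integral_le_support[OF cc(3)])
        fix s :: real assume s: "s \<in> {1/2..3/2}"
        have "M * (1/2) \<le> M * s" using s M2 by (intro mult_left_mono) auto
        then have Ms: "M * s \<ge> 1" "M / 2 \<le> M * s" using M2 by linarith+
        have "\<bar>er s\<bar> \<le> K / (M * s)" unfolding er_def by (rule as[OF Ms(1)])
        also have "\<dots> \<le> K / (M / 2)" using Ms K M2 by (intro divide_left_mono) auto
        finally have e: "\<bar>er s\<bar> \<le> 2 * K / M" by (simp add: mult.commute)
        have "amplitude p N s \<le> S * indicator {1 - 1 / sqrt N..1 + 1 / sqrt N} s"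
          unfolding S_def using amplitude_le[of N p s] N6 p s by simp
        then have "\<bar>er s\<bar> * amplitude p N s \<le> 2 * K / M
            * (S * indicator {1 - 1 / sqrt N..1 + 1 / sqrt N} s)"
          using e amplitude_nonneg[of p N s] K M2 by (intro mult_mono) auto
        then show "norm (f3 s) \<le> 2 * K / M * S * indicator {1 - 1 / sqrt N..1 + 1 / sqrt N} s"
          using amplitude_nonneg[of p N s] by (simp add: f3_def ap_def norm_mult mult.assoc)
      qed (use K M2 pos sN in auto)
      also have "\<dots> \<le> 2 * (2 * K / (N / 3) * S) * 1"
        using K M M2 N6 pos sN by (intro mult_mono mult_left_mono mult_right_mono divide_left_mono) auto
      finally show ?thesis by simp
    qed
    have "c \<le> sqrt N * (norm l / 2 * norm I1 - norm l / 2 * norm I2 - norm I3)"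
    proof -
      have "norm l / 2 * (b / sqrt N / 2) - norm l / 2 * (6 * C1 / N) - 12 * K * S / N \<le> norm l / 2
          * norm I1 - norm l / 2 * norm I2 - norm I3"
        using b1 b2 b3 pos by (intro diff_mono mult_left_mono) auto
      then have "sqrt N * (norm l / 2 * (b / sqrt N / 2) - norm l / 2 * (6 * C1 / N) - 12 * K * S / N)
          \<le> sqrt N * (norm l / 2 * norm I1 - norm l / 2 * norm I2 - norm I3)"
        using sN by (intro mult_left_mono) auto
      moreover have "sqrt N * (norm l / 2 * (b / sqrt N / 2) - norm l / 2 * (6 * C1 / N) - 12 * K
          * S / N) = 2 * c - D / sqrt N"
      proof -
        have gen: "q * (norm l / 2 * (b / q / 2) - norm l / 2 * (6 * C1 / (q * q)) - 12 * K
            * S / (q * q)) = 2 * (norm l * b / 8) - (3 * norm l * C1 + 12 * K * S) / q" if "q > 0" for q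
          using that by (simp add: field_simps)
        have "sqrt N * sqrt N = N" using N6 by simp
        with gen[OF sN(2)] show ?thesis unfolding c_def D_def by simp
      qed
      moreover have "D / sqrt N \<le> c"
      proof -
        have "sqrt ((D / c)\<^sup>2) \<le> sqrt N" using ND by (rule real_sqrt_le_mono)
        then have "D / c \<le> sqrt N" using pos c by simp
        then show ?thesis using sN c by (simp add: field_simps)
      qed
      ultimately show ?thesis by linarith
    qed
    also have "\<dots> \<le> sqrt N * norm (LINT s:{1/2..3/2}|lborel. of_real (bessel_w \<nu> (M * s))
        * cis (- (M * s\<^sup>2 / 2)) * ap s)"
      using low sN by (intro mult_left_mono) auto
    also have "\<dots> \<le> sqrt (N / (1 - r)) * norm (LINT s:{1/2..3/2}|lborel. of_real (bessel_w \<nu> (M * s))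
        * cis (- (M * s\<^sup>2 / 2)) * ap s)"
    proof (rule mult_right_mono[OF real_sqrt_le_mono])
      show "N \<le> N / (1 - r)" using N6 r by (simp add: pos_le_divide_eq mult_left_le)
    qed simp
    finally show ?thesis unfolding M_def ap_def .
  qed
  then show ?thesis using c that[of c N0] by (simp add: N0_def)
qed

section \<open>The wave packets\<close>

text \<open>The one-dimensional counterpart of \<open>tf_alg\<close>, on the open half line only,
  because the profile contains the power \<open>s powr p\<close>, whose exponent need not be an
  integer.\<close>

inductive ray_alg :: "(real \<Rightarrow> complex) \<Rightarrow> bool" where
  ray_const: "ray_alg (\<lambda>s. c)"
| ray_powr: "ray_alg (\<lambda>s. of_real (s powr q))"
| ray_phase: "ray_alg (\<lambda>s. cis (b * s\<^sup>2))"
| ray_cut: "ray_alg (\<lambda>s. of_real (cutoff N k s))"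
| ray_add: "ray_alg f \<Longrightarrow> ray_alg g \<Longrightarrow> ray_alg (\<lambda>s. f s + g s)"
| ray_mult: "ray_alg f \<Longrightarrow> ray_alg g \<Longrightarrow> ray_alg (\<lambda>s. f s * g s)"

lemma ray_derivative:
  assumes "ray_alg f"
  shows "\<exists>g. ray_alg g \<and> (\<forall>s>0. (f has_vector_derivative g s) (at s))"
  using assms
proof induction
  case (ray_const c)
  show ?case by (rule exI[of _ "\<lambda>_. 0"]) (auto intro: ray_alg.intros)
next
  case (ray_powr q)
  have "((\<lambda>s. complex_of_real (s powr q)) has_vector_derivative of_real q * of_real (s powr (q - 1)))
      (at s)" if "s > 0" for s
    using has_vector_derivative_of_real[OF has_real_derivative_powr[OF that, of q], where 'a = complex]
        by simp
  then show ?case by (intro exI[of _ "\<lambda>s. of_real q * of_real (s powr (q - 1))"] conjI allI impI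
      ray_alg.intros)
next
  case (ray_phase b)
  have "((\<lambda>s. cis (b * s\<^sup>2)) has_vector_derivative (2 * b * \<i>) * of_real (s powr 1) * cis (b * s\<^sup>2))
      (at s)" if "s > 0" for s
  proof -
    have "((\<lambda>s. b * s\<^sup>2) has_vector_derivative b * (2 * s)) (at s)"
      unfolding has_real_derivative_iff_has_vector_derivative[symmetric]
          by (auto intro!: derivative_eq_intros)
    from vector_diff_chain_at[OF this cis_has_vector_derivative] show ?thesis using that
        by (simp add: o_def scaleR_conv_of_real mult_ac)
  qed
  then show ?case by (intro exI[of _ "\<lambda>s. (2 * b * \<i>) * of_real (s powr 1) * cis (b * s\<^sup>2)"] conjI allI
      impI ray_alg.intros)
next
  case (ray_cut N k)
  have "((\<lambda>s. complex_of_real (cutoff N k s)) has_vector_derivative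
      (of_real (cutoff N (k + 2) s) + of_real (- real k) * of_real (cutoff N (k + 1) s))
          * (of_real (- 4 * N) * (of_real (s powr 3) + of_real (- 1) * of_real (s powr 1)))) (at s)"
          if "s > 0" for s
  proof -
    have p: "s powr 3 = s ^ 3" using that by simp
    have eq: "(cutoff N (k + 2) s - real k * cutoff N (k + 1) s) * (- (4 * N * (s\<^sup>2 - 1) * s))
        = (cutoff N (k + 2) s - real k * cutoff N (k + 1) s) * (- 4 * N * (s powr 3 - s powr 1))"
      unfolding p using that by (simp add: power2_eq_square power3_eq_cube algebra_simps)
    have c: "complex_of_real ((x - real k * y) * (- 4 * N * (u - v)))
        = (of_real x + of_real (- real k) * of_real y)
        * (of_real (- 4 * N) * (of_real u + of_real (- 1) * of_real v))" for x y u v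
      by simp
    show ?thesis
      using has_vector_derivative_of_real[OF has_real_derivative_cutoff[of N k s], where 'a = complex]
          unfolding eq c .
  qed
  then show ?case
    by (intro exI[of _ "\<lambda>s. (of_real (cutoff N (k + 2) s) + of_real (- real k)
        * of_real (cutoff N (k + 1) s)) * (of_real (- 4 * N)
        * (of_real (s powr 3) + of_real (- 1) * of_real (s powr 1)))"] conjI allI impI ray_alg.intros)
next
  case (ray_add f g)
  then obtain f' g' where *: "ray_alg f'" "ray_alg g'" "\<And>s. s > 0
      \<Longrightarrow> (f has_vector_derivative f' s) (at s)" "\<And>s. s > 0 \<Longrightarrow> (g has_vector_derivative g' s) (at s)"
      by blast
  show ?case
    by (rule exI[of _ "\<lambda>s. f' s + g' s"]) (auto intro!: ray_alg.ray_add * has_vector_derivative_add)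
next
  case (ray_mult f g)
  then obtain f' g' where *: "ray_alg f'" "ray_alg g'" "\<And>s. s > 0
      \<Longrightarrow> (f has_vector_derivative f' s) (at s)" "\<And>s. s > 0 \<Longrightarrow> (g has_vector_derivative g' s) (at s)"
      by blast
  show ?case
    by (rule exI[of _ "\<lambda>s. f s * g' s + f' s * g s"])
        (auto intro!: ray_alg.ray_add ray_alg.ray_mult * ray_mult.hyps has_vector_derivative_mult)
qed

lemma ray_continuous:
  assumes "ray_alg f" shows "continuous_on {0<..} f"
proof -
  obtain g where "\<And>s. s > 0 \<Longrightarrow> (f has_vector_derivative g s) (at s)" using ray_derivative[OF assms]
      by blast
  then show ?thesis by (intro continuous_at_imp_continuous_on ballI has_vector_derivative_continuous)
      auto
qed

definition profile :: "real \<Rightarrow> real \<Rightarrow> real \<Rightarrow> complex" where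
  "profile p N s = of_real (amplitude p N s) * cis (N / 2 * s\<^sup>2)"

lemma cutoff_vanishes:
  assumes N: "N \<ge> 6" and s: "s > 0" "s < 3/5 \<or> s > 7/5"
  shows "cutoff N k s = 0"
proof (rule ccontr)
  assume "cutoff N k s \<noteq> 0"
  then have "N * (s\<^sup>2 - 1)\<^sup>2 < 1" by (simp add: cutoff_def expk_def split: if_splits)
  moreover have "\<bar>s\<^sup>2 - 1\<bar> \<ge> 1/2"
  proof (cases "s < 3/5")
    case True
    then have "s\<^sup>2 \<le> (3/5)\<^sup>2" using s by (intro power_mono) auto
    then show ?thesis by (simp add: power2_eq_square)
  next
    case False
    then have "s\<^sup>2 \<ge> (7/5)\<^sup>2" using s by (intro power_mono) auto
    then show ?thesis by (simp add: power2_eq_square)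
  qed
  then have "(1/2)\<^sup>2 \<le> \<bar>s\<^sup>2 - 1\<bar>\<^sup>2" by (intro power_mono) auto
  then have "(s\<^sup>2 - 1)\<^sup>2 \<ge> 1/4" by (simp add: power2_eq_square)
  then have "6 * (1/4) \<le> N * (s\<^sup>2 - 1)\<^sup>2" using N by (intro mult_mono) auto
  ultimately show False by simp
qed

text \<open>Provides the hypotheses of \<open>schroedinger_kernel\<close>. The cutoff already
  vanishes outside \<open>[3/5, 7/5]\<close>, hence near \<open>1/2\<close> and \<open>3/2\<close>,
  so the first derivative vanishes there along with the profile.\<close>

lemma profile_derivatives:
  assumes N: "N \<ge> 6"
  obtains G1 G2 where "\<And>s. s > 0 \<Longrightarrow> (profile p N has_vector_derivative G1 s) (at s)"
    "\<And>s. s > 0 \<Longrightarrow> (G1 has_vector_derivative G2 s) (at s)" "continuous_on {0<..} G2"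
    "profile p N (1/2) = 0" "profile p N (3/2) = 0" "G1 (1/2) = 0" "G1 (3/2) = 0"
proof -
  have "ray_alg (\<lambda>s. (of_real (s powr p) * of_real (cutoff N 0 s)) * cis (N / 2 * s\<^sup>2))"
      by (intro ray_alg.intros)
  then have "ray_alg (profile p N)" unfolding profile_def[abs_def] amplitude_def by simp
  then obtain G1 where G1: "ray_alg G1" "\<And>s. s > 0 \<Longrightarrow> (profile p N has_vector_derivative G1 s) (at s)"
      using ray_derivative by blast
  obtain G2 where G2: "ray_alg G2" "\<And>s. s > 0 \<Longrightarrow> (G1 has_vector_derivative G2 s) (at s)"
      using ray_derivative[OF G1(1)] by blast
  have z: "profile p N s = 0" if "s > 0" "s < 3/5 \<or> s > 7/5" for s
    using cutoff_vanishes[OF N that] by (simp add: profile_def amplitude_def)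
  have G1z: "G1 t = 0" if "t \<in> S" "open S" "\<And>s. s \<in> S \<Longrightarrow> s > 0 \<and> (s < 3/5 \<or> s > 7/5)" for t S
  proof -
    have "((\<lambda>_. 0) has_vector_derivative 0) (at t)" by simp
    then have "(profile p N has_vector_derivative 0) (at t)"
      by (rule has_vector_derivative_transform_within_open[OF _ that(2,1)]) (use z that(3) in auto)
    then show ?thesis using G1(2)[of t] that(1,3) vector_derivative_unique_at by blast
  qed
  show ?thesis
  proof (rule that[of G1 G2])
    show "G1 (1/2) = 0" by (rule G1z[of _ "{0<..<3/5}"]) auto
    show "G1 (3/2) = 0" by (rule G1z[of _ "{7/5<..}"]) auto
  qed (use G1 G2 z ray_continuous in auto)
qed

text \<open>The power of \<open>z\<close> separated here cancels half of the Jacobian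
  \<open>r ^ (n - 1)\<close> in each of the two transforms.\<close>

lemma hankel_kernel_eq:
  assumes "z > 0"
  shows "hankel_kernel n \<nu> z = z powr (- (real n - 1) / 2) * bessel_w \<nu> z"
proof -
  have "z powr (- (real n - 2) / 2) = z powr (- (real n - 1) / 2 + 1/2)"
      by (rule arg_cong[of _ _ "\<lambda>e. z powr e"]) (simp add: field_simps)
  also have "\<dots> = z powr (- (real n - 1) / 2) * sqrt z" unfolding powr_add using assms
      by (simp add: powr_half_sqrt)
  finally show ?thesis by (simp add: hankel_kernel_def bessel_w_def)
qed

definition wave_packet :: "real \<Rightarrow> real^'n::finite \<Rightarrow> complex" where
  "wave_packet N x = cis (N / 2 * (x \<bullet> x)) * of_real (expk 0 (1 - N * (x \<bullet> x - 1)\<^sup>2))"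

definition ray_packet :: "real \<Rightarrow> real \<Rightarrow> complex" where
  "ray_packet N r = cis (N / 2 * r\<^sup>2) * of_real (cutoff N 0 r)"

lemma wave_packet_radial: "wave_packet N x = ray_packet N (norm x)"
  by (simp add: wave_packet_def ray_packet_def cutoff_def power2_norm_eq_inner)

lemma profile_eq: "profile p N s = of_real (s powr p) * ray_packet N s"
  by (simp add: profile_def ray_packet_def amplitude_def)

lemma tf_cut_packet: "tf_alg (\<lambda>x::real^'n::finite. of_real (expk k (1 - N * (x \<bullet> x - 1)\<^sup>2)))"
proof -
  have eq: "(1 - N) + 2 * N * (x \<bullet> x) + (- N) * (x \<bullet> x)\<^sup>2 = 1 - N * (x \<bullet> x - 1)\<^sup>2" for x :: "real^'n"
    by (simp add: power2_eq_square algebra_simps)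
  have "tf_alg (\<lambda>x::real^'n. of_real (expk k ((1 - N) + 2 * N * (x \<bullet> x) + (- N) * (x \<bullet> x)\<^sup>2)))"
      by (rule tf_cut)
  then show ?thesis unfolding eq .
qed

lemma wave_packet_tf: "tf_alg (wave_packet N)"
  unfolding wave_packet_def[abs_def] by (intro tf_mult tf_phase tf_cut_packet)

lemma wave_packet_support:
  assumes N: "N > 0" and nz: "expk k (1 - N * (x \<bullet> x - 1)\<^sup>2) \<noteq> 0"
  shows "\<bar>x \<bullet> x - 1\<bar> < 1 / sqrt N" "\<bar>norm x - 1\<bar> < 1 / sqrt N"
proof -
  have "cutoff N k (norm x) \<noteq> 0" using nz by (simp add: cutoff_def power2_norm_eq_inner)
  then show "\<bar>x \<bullet> x - 1\<bar> < 1 / sqrt N" "\<bar>norm x - 1\<bar> < 1 / sqrt N"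
    using cutoff_support[OF N norm_ge_zero, of k x] by (simp_all add: power2_norm_eq_inner)
qed

lemma wave_packet_test_fun:
  assumes N: "N \<ge> 1" shows "test_fun (wave_packet N :: real^'n::finite \<Rightarrow> complex)"
  unfolding test_fun_def
proof
  show "smooth_fun (wave_packet N :: real^'n \<Rightarrow> complex)" by (rule tf_smooth_fun[OF wave_packet_tf])
  have "norm x \<le> 2" if "wave_packet N x \<noteq> 0" for x :: "real^'n"
  proof -
    have "\<bar>norm x - 1\<bar> < 1 / sqrt N" using wave_packet_support(2)[of N 0 x] N that
        by (simp add: wave_packet_def)
    also have "\<dots> \<le> 1" using N by simp
    finally show ?thesis by linarith
  qed
  then show "bounded {x :: real^'n. wave_packet N x \<noteq> 0}" unfolding bounded_iff by auto
qed

text \<open>The packet is bounded, its gradient is of order \<open>N\<close>, and the shell carrying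
  it has volume of order \<open>1 / sqrt N\<close>.\<close>

lemma wave_packet_sobolev:
  obtains C where "C \<ge> 0" "\<And>N s. N \<ge> 1 \<Longrightarrow> 0 \<le> s \<Longrightarrow> s \<le> 1 \<Longrightarrow>
     sobolev_norm_sq s (wave_packet N :: real^'n::finite \<Rightarrow> complex)
         \<le> ennreal (C * N powr (2 * s) / sqrt N)"
proof -
  define n where "n = CARD('n)"
  define V where "V = unit_ball_vol (real n)"
  have V: "V \<ge> 0" by (simp add: V_def)
  define C0 where "C0 = (2 * pi) ^ n * 18\<^sup>2 * (2 + real n)"
  have C0: "C0 \<ge> 0" by (simp add: C0_def)
  define C where "C = C0 * (V * (real n * 2 ^ n * 2))"
  \<comment> \<open>A crude mean value bound on \<open>[0, 2]\<close>, used for the difference of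
    the volumes of the balls of radius \<open>1 + h\<close> and \<open>1 - h\<close>.\<close>
  have pd: "x ^ k - y ^ k \<le> real k * 2 ^ k * (x - y)" if "0 \<le> y" "y \<le> x" "x \<le> 2" for x y :: real and k
  proof (induction k)
    case (Suc k)
    have "x ^ Suc k - y ^ Suc k = x * (x ^ k - y ^ k) + (x - y) * y ^ k" by (simp add: algebra_simps)
    also have "x * (x ^ k - y ^ k) \<le> 2 * (real k * 2 ^ k * (x - y))"
      using Suc that power_mono[of y x k] by (intro mult_mono) auto
    also have "(x - y) * y ^ k \<le> (x - y) * 2 ^ Suc k"
    proof (rule mult_left_mono)
      have "y ^ k \<le> 2 ^ k" using that by (intro power_mono) auto
      moreover have "(2::real) ^ k \<ge> 0" by simp
      ultimately show "y ^ k \<le> 2 ^ Suc k" unfolding power_Suc by linarith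
    qed (use that in simp)
    finally show ?case by (simp add: algebra_simps)
  qed simp
  have main: "sobolev_norm_sq s (wave_packet N :: real^'n \<Rightarrow> complex)
      \<le> ennreal (C * N powr (2 * s) / sqrt N)"
    if N: "N \<ge> 1" and s: "0 \<le> s" "s \<le> 1" for N s
  proof -
    define h where "h = 1 / sqrt N"
    have sN: "sqrt N \<ge> 1" using N by simp
    have h: "0 < h" "h \<le> 1" using sN N by (auto simp: h_def)
    define S where "S = cball (0::real^'n) (1 + h) - ball 0 (1 - h)"
    have S: "x \<in> S" if "\<bar>norm x - 1\<bar> < h" for x using that by (auto simp: S_def)
    define D where "D i x = cis (N / 2 * (x \<bullet> x)) *
        (of_real (x $ i) * (\<i> * of_real N * of_real (expk 0 (1 - N * (x \<bullet> x - 1)\<^sup>2))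
        - of_real (4 * N * (x \<bullet> x - 1)) * of_real (expk 2 (1 - N * (x \<bullet> x - 1)\<^sup>2))))" for i
            and x :: "real^'n"
    have dD: "((\<lambda>t. wave_packet N (x + t *\<^sub>R axis i 1)) has_vector_derivative D i x) (at 0)" for i x
    proof -
      have "((\<lambda>t. N / 2 * ((x + t *\<^sub>R axis i 1) \<bullet> (x + t *\<^sub>R axis i 1))) has_vector_derivative N / 2
          * (2 * x $ i)) (at 0)"
        unfolding has_real_derivative_iff_has_vector_derivative[symmetric]
            by (intro DERIV_cmult inner_axis_deriv)
      from vector_diff_chain_at[OF this cis_has_vector_derivative]
      have 1: "((\<lambda>t. cis (N / 2 * ((x + t *\<^sub>R axis i 1) \<bullet> (x + t *\<^sub>R axis i 1))))
          has_vector_derivative of_real (N * x $ i) * (\<i> * cis (N / 2 * (x \<bullet> x)))) (at 0)"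
        by (simp add: o_def scaleR_conv_of_real)
      have "((\<lambda>t. 1 - N * ((x + t *\<^sub>R axis i 1) \<bullet> (x + t *\<^sub>R axis i 1) - 1)\<^sup>2)
          has_real_derivative - (4 * N * (x \<bullet> x - 1) * x $ i)) (at 0)"
        by (rule derivative_eq_intros inner_axis_deriv refl)+ simp
      from DERIV_chain2[where f = "expk 0", OF has_real_derivative_expk this]
      have "((\<lambda>t. expk 0 (1 - N * ((x + t *\<^sub>R axis i 1) \<bullet> (x + t *\<^sub>R axis i 1) - 1)\<^sup>2))
          has_real_derivative expk 2 (1 - N * (x \<bullet> x - 1)\<^sup>2) * - (4 * N * (x \<bullet> x - 1) * x $ i)) (at 0)"
        by (simp add: numeral_2_eq_2)
      from has_vector_derivative_mult[OF 1 has_vector_derivative_of_real[OF this, where 'a = complex]]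
      show ?thesis unfolding wave_packet_def D_def by (simp add: algebra_simps)
    qed
    have "sobolev_norm_sq s (wave_packet N :: real^'n \<Rightarrow> complex)
        \<le> ennreal ((2 * pi) ^ CARD('n) * 18\<^sup>2 * (2 + real CARD('n)) * N powr (2 * s))
        * emeasure lborel S"
    proof (rule sobolev_norm_sq_le[OF dD])
      show "continuous_on UNIV (wave_packet N :: real^'n \<Rightarrow> complex)"
          by (rule tf_continuous[OF wave_packet_tf])
      show "continuous_on UNIV (D i)" for i
        unfolding D_def by (intro continuous_intros tf_continuous[OF tf_cut_packet])
      show "S \<in> sets lborel" "bounded S" by (auto simp: S_def intro: bounded_subset[OF bounded_cball])
      show "wave_packet N x = 0" if "x \<notin> S" for x
        using wave_packet_support(2)[of N 0 x] S[of x] N that by (auto simp: wave_packet_def h_def)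
      show "D i x = 0" if "x \<notin> S" for i x
        using wave_packet_support(2)[of N 0 x] wave_packet_support(2)[of N 2 x] S[of x] N that
            by (auto simp: D_def h_def)
      show "cmod (wave_packet N x) \<le> 18" for x :: "real^'n"
        using expk_le_fact[of 0 "1 - N * (x \<bullet> x - 1)\<^sup>2"] expk_nonneg[of 0 "1 - N * (x \<bullet> x - 1)\<^sup>2"]
            by (simp add: wave_packet_def norm_mult)
      \<comment> \<open>The coordinate contributes at most 2, the phase derivative \<open>N\<close>,
        and the cutoff derivative \<open>8 * N\<close>, that is \<open>4 * N\<close> times the bound
        \<open>fact 2\<close> for \<open>expk 2\<close>.\<close>
      show "cmod (D i x) \<le> 18 * N" for i x
      proof (cases "x \<in> S")
        case True
        define E0 where "E0 = expk 0 (1 - N * (x \<bullet> x - 1)\<^sup>2)"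
        define E2 where "E2 = expk 2 (1 - N * (x \<bullet> x - 1)\<^sup>2)"
        have xi: "\<bar>x $ i\<bar> \<le> 2" using True h component_le_norm_cart[of x i] by (auto simp: S_def)
        have e0: "norm (\<i> * of_real N * of_real E0) \<le> N * 1"
          using expk_le_fact[of 0 "1 - N * (x \<bullet> x - 1)\<^sup>2"] expk_nonneg[of 0 "1 - N * (x \<bullet> x - 1)\<^sup>2"] N
          unfolding norm_mult E0_def by (intro mult_mono) auto
        have e2: "norm (complex_of_real (4 * N * (x \<bullet> x - 1)) * of_real E2) \<le> 8 * N"
        proof (cases "E2 = 0")
          case False
          have "N * \<bar>x \<bullet> x - 1\<bar> \<le> N * (1 / sqrt N)" using wave_packet_support(1)[of N 2 x] False N
              unfolding E2_def by (intro mult_left_mono) auto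
          also have "\<dots> \<le> N * 1" using N by (intro mult_left_mono) auto
          finally have "4 * (N * \<bar>x \<bullet> x - 1\<bar>) \<le> 4 * N" by simp
          moreover have "0 \<le> E2" "E2 \<le> 2" using expk_le_fact[of 2 "1 - N * (x \<bullet> x - 1)\<^sup>2"] expk_nonneg
              unfolding E2_def by auto
          ultimately have "4 * (N * \<bar>x \<bullet> x - 1\<bar>) * E2 \<le> 4 * N * 2" using N by (intro mult_mono) auto
          then show ?thesis using N \<open>0 \<le> E2\<close> unfolding norm_mult norm_of_real
              by (simp add: abs_mult mult.assoc)
        qed (use N in simp)
        have "cmod (D i x) = \<bar>x $ i\<bar> * norm (\<i> * of_real N * of_real E0 - of_real (4 * N * (x \<bullet> x - 1))
            * of_real E2)"
          unfolding D_def E0_def[symmetric] E2_def[symmetric]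
              by (simp only: norm_mult norm_cis norm_of_real mult_1)
        also have "\<dots> \<le> 2 * (N * 1 + 8 * N)"
          using norm_triangle_ineq4[of "\<i> * of_real N * of_real E0" "of_real (4 * N * (x \<bullet> x - 1))
              * of_real E2"] e0 e2 xi
          by (intro mult_mono) auto
        finally show ?thesis by simp
      next
        case False
        then have "D i x = 0" using wave_packet_support(2)[of N 0 x] wave_packet_support(2)[of N 2 x]
            S[of x] N by (auto simp: D_def h_def)
        then show ?thesis using N by simp
      qed
    qed (use N s in auto)
    also have "emeasure lborel S = ennreal (V * ((1 + h) ^ n - (1 - h) ^ n))"
    proof -
      have "emeasure lborel S = emeasure lborel (cball (0::real^'n) (1 + h)) - emeasure lborel
          (ball (0::real^'n) (1 - h))"
        unfolding S_def using h by (intro emeasure_Diff) (auto simp: emeasure_ball intro: order_trans)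
      also have "\<dots> = ennreal (V * (1 + h) ^ n) - ennreal (V * (1 - h) ^ n)"
        using h by (simp add: emeasure_ball emeasure_cball V_def n_def)
      also have "\<dots> = ennreal (V * (1 + h) ^ n - V * (1 - h) ^ n)"
        using h V by (intro ennreal_minus) auto
      finally show ?thesis by (simp add: algebra_simps)
    qed
    also have "ennreal ((2 * pi) ^ CARD('n) * 18\<^sup>2 * (2 + real CARD('n)) * N powr (2 * s))
        * ennreal (V * ((1 + h) ^ n - (1 - h) ^ n))
        = ennreal (C0 * N powr (2 * s) * (V * ((1 + h) ^ n - (1 - h) ^ n)))"
      using C0 unfolding C0_def n_def by (subst ennreal_mult'[symmetric]) auto
    also have "\<dots> \<le> ennreal (C * N powr (2 * s) / sqrt N)"
    proof (rule ennreal_leI)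
      have "(1 + h) ^ n - (1 - h) ^ n \<le> real n * 2 ^ n * ((1 + h) - (1 - h))" using h by (intro pd) auto
      then have "C0 * N powr (2 * s) * (V * ((1 + h) ^ n - (1 - h) ^ n)) \<le> C0 * N powr (2 * s)
          * (V * (real n * 2 ^ n * (2 * h)))"
        using C0 V by (intro mult_left_mono mult_nonneg_nonneg) auto
      also have "\<dots> = C * N powr (2 * s) / sqrt N" by (simp add: C_def h_def)
      finally show "C0 * N powr (2 * s) * (V * ((1 + h) ^ n - (1 - h) ^ n)) \<le> C
          * N powr (2 * s) / sqrt N" .
    qed
    finally show ?thesis .
  qed
  have "C \<ge> 0" using C0 V by (simp add: C_def)
  then show ?thesis using main that by blast
qed

section \<open>The maximal function of a wave packet\<close>

lemma hom_poly_0_const: "hom_poly 0 (\<lambda>x :: real^'n::finite. 1)"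
  unfolding hom_poly_def by (intro exI[of _ "{\<lambda>_. 0}"] exI[of _ "\<lambda>_. 1"]) simp

lemma sph_harm_0_const:
  fixes Y :: "real^'n::finite \<Rightarrow> complex"
  assumes "sph_harm 0 Y" obtains c where "\<And>\<theta>. \<theta> \<in> sphere 0 1 \<Longrightarrow> Y \<theta> = c"
proof -
  obtain p where p: "hom_poly 0 p" "\<And>\<theta>. \<theta> \<in> sphere 0 1 \<Longrightarrow> Y \<theta> = p \<theta>"
    using assms unfolding sph_harm_def by blast
  have "p x = p 0" for x using hom_poly_scaleR[OF p(1), of 0 x] by simp
  then have "Y \<theta> = p 0" if "\<theta> \<in> sphere 0 1" for \<theta> using p(2)[OF that] by simp
  then show ?thesis by (rule that)
qed

text \<open>The encoding evaluates its argument at \<open>x /\<^sub>R norm x\<close>, which is off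
  the sphere exactly for \<open>x = 0\<close>. That null set is harmless for the integral, but
  measurability of \<open>f\<close> has to be recovered from \<open>g\<close> by changing one
  value.\<close>

lemma sph_int_cong_sphere:
  fixes f g :: "real^'n::finite \<Rightarrow> complex"
  assumes "\<And>\<theta>. \<theta> \<in> sphere 0 1 \<Longrightarrow> f \<theta> = g \<theta>" and m: "(\<lambda>x. g (x /\<^sub>R norm x)) \<in> borel_measurable borel"
  shows "sph_int f = sph_int g"
proof -
  have eq: "f (x /\<^sub>R norm x) = g (x /\<^sub>R norm x)" if "x \<noteq> 0" for x using that by (intro assms) simp
  have mg: "(\<lambda>x. indicator (ball 0 1) x *\<^sub>R g (x /\<^sub>R norm x)) \<in> borel_measurable lborel"
    using m by (intro borel_measurable_scaleR borel_measurable_indicator) auto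
  have "(\<lambda>x. if x \<in> {0} then indicator (ball 0 1) (0::real^'n)
      *\<^sub>R f (0 /\<^sub>R norm (0::real^'n)) else indicator (ball 0 1) x *\<^sub>R g (x /\<^sub>R norm x)) \<in>
      borel_measurable lborel"
    using mg by (intro measurable_If_set) auto
  moreover have "(\<lambda>x. if x \<in> {0} then indicator (ball 0 1) (0::real^'n)
      *\<^sub>R f (0 /\<^sub>R norm (0::real^'n)) else indicator (ball 0 1) x *\<^sub>R g (x /\<^sub>R norm x))
      = (\<lambda>x. indicator (ball 0 1) x *\<^sub>R f (x /\<^sub>R norm x))"
  proof
    fix x
    show "(if x \<in> {0} then indicator (ball 0 1) (0::real^'n)
        *\<^sub>R f (0 /\<^sub>R norm (0::real^'n)) else indicator (ball 0 1) x *\<^sub>R g (x /\<^sub>R norm x))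
        = indicator (ball 0 1) x *\<^sub>R f (x /\<^sub>R norm x)"
      by (cases "x = 0") (simp_all only: eq singleton_iff if_True if_False simp_thms)
  qed
  ultimately have mf: "(\<lambda>x. indicator (ball 0 1) x *\<^sub>R f (x /\<^sub>R norm x)) \<in> borel_measurable lborel"
      by (simp only:)
  have AE: "AE x in lborel. indicator (ball 0 1) x *\<^sub>R f (x /\<^sub>R norm x) = indicator (ball 0 1) x
      *\<^sub>R g (x /\<^sub>R norm x)"
    using AE_lborel_singleton[of "0::real^'n"] by eventually_elim (simp only: eq simp_thms)
  show ?thesis unfolding sph_int_def set_lebesgue_integral_def integral_cong_AE[OF mf mg AE] ..
qed

definition sphere_area :: "'n::finite itself \<Rightarrow> real" where
  "sphere_area _ = real CARD('n) * measure lborel (ball (0::real^'n) 1)"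

lemma sphere_area_pos: "sphere_area TYPE('n::finite) > 0"
  unfolding sphere_area_def using content_ball_pos[of 1 "0::real^'n"] by (simp add: zero_less_mult_iff)

lemma sph_int_const: "sph_int (\<lambda>_::real^'n::finite. c) = of_real (sphere_area TYPE('n)) * c"
proof -
  have "(LINT x|lborel. indicator (ball (0::real^'n) 1) x *\<^sub>R c)
      = (LINT x|lborel. indicator (ball (0::real^'n) 1) x) *\<^sub>R c"
    using emeasure_bounded_finite[OF bounded_ball, of "0::real^'n" 1]
    by (intro integral_scaleR_left integrable_real_indicator) auto
  then show ?thesis
    by (simp add: sph_int_def sphere_area_def set_lebesgue_integral_def scaleR_conv_of_real mult.assoc)
qed

text \<open>Spherical harmonics of degree zero are constants. Spanning the function 1 forces
  \<open>d > 0\<close>, and two orthogonal nonzero constants are impossible.\<close>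

lemma sph_onb_0:
  fixes Y :: "nat \<Rightarrow> real^'n::finite \<Rightarrow> complex"
  assumes "sph_onb 0 d Y"
  obtains c where "d = 1" "\<And>\<theta>. \<theta> \<in> sphere 0 1 \<Longrightarrow> Y 1 \<theta> = c" "of_real (sphere_area TYPE('n))
      * (c * cnj c) = 1"
proof -
  have harm: "sph_harm 0 (Y l)" if "l \<in> {1..d}" for l using assms that unfolding sph_onb_def by blast
  have orth: "sph_int (\<lambda>\<theta>. Y l \<theta> * cnj (Y l' \<theta>)) = (if l = l' then 1 else 0)"
      if "l \<in> {1..d}" "l' \<in> {1..d}" for l l'
    using assms that unfolding sph_onb_def by blast
  have "\<exists>c. \<forall>\<theta>\<in>sphere 0 1. Y l \<theta> = c" if "l \<in> {1..d}" for l
    by (rule sph_harm_0_const[OF harm[OF that]]) blast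
  then obtain k where k: "\<And>l \<theta>. l \<in> {1..d} \<Longrightarrow> \<theta> \<in> sphere 0 1 \<Longrightarrow> Y l \<theta> = k l" by metis
  have kk: "of_real (sphere_area TYPE('n)) * (k l * cnj (k l')) = (if l = l' then 1 else 0)"
      if "l \<in> {1..d}" "l' \<in> {1..d}" for l l'
  proof -
    have "sph_int (\<lambda>\<theta>. Y l \<theta> * cnj (Y l' \<theta>)) = sph_int (\<lambda>_::real^'n. k l * cnj (k l'))"
    proof (rule sph_int_cong_sphere)
      show "Y l \<theta> * cnj (Y l' \<theta>) = k l * cnj (k l')" if "\<theta> \<in> sphere 0 1" for \<theta>
        unfolding k[OF \<open>l \<in> {1..d}\<close> that] k[OF \<open>l' \<in> {1..d}\<close> that] ..
    qed simp
    then show ?thesis using orth[OF that] by (simp add: sph_int_const)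
  qed
  have "d \<noteq> 0"
  proof
    assume d: "d = 0"
    have "laplacian (\<lambda>x::real^'n. 1) x = 0" for x by (simp add: laplacian_def partial_deriv_def)
    then have "sph_harm 0 (\<lambda>x::real^'n. 1)" unfolding sph_harm_def using hom_poly_0_const by blast
    then obtain c where c: "\<forall>\<theta>\<in>sphere (0::real^'n) 1. (1::complex) = (\<Sum>l=1..d. c l * Y l \<theta>)"
      using assms unfolding sph_onb_def by blast
    have "axis undefined 1 \<in> sphere (0::real^'n) 1" by simp
    with c d show False by fastforce
  qed
  moreover have "\<not> d \<ge> 2"
  proof
    assume "d \<ge> 2"
    then have in12: "1 \<in> {1..d}" "2 \<in> {1..d}" by auto
    have "k 1 \<noteq> 0" "k 2 \<noteq> 0" using kk[OF in12(1,1)] kk[OF in12(2,2)] by auto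
    moreover have "k 1 * cnj (k 2) = 0" using kk[OF in12] sphere_area_pos[where 'n='n] by simp
    ultimately show False by simp
  qed
  ultimately have d: "d = 1" by simp
  show ?thesis
  proof (rule that[OF d])
    show "Y 1 \<theta> = k 1" if "\<theta> \<in> sphere 0 1" for \<theta> using k[of 1 \<theta>] that d by simp
    show "of_real (sphere_area TYPE('n)) * (k 1 * cnj (k 1)) = 1" using kk[of 1 1] d by simp
  qed
qed

lemma sph_coeff_radial_eq_0:
  fixes Y :: "real^'n::finite \<Rightarrow> complex"
  assumes "sph_harm k Y" "k \<ge> 1"
  shows "sph_coeff Y (\<lambda>x. g (norm x)) r = 0"
proof -
  obtain p where p: "hom_poly k p" and L: "\<And>x. laplacian p x = 0" and Yp: "\<And>\<theta>. \<theta> \<in> sphere 0 1 \<Longrightarrow> Y \<theta>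
      = p \<theta>"
    using assms(1) unfolding sph_harm_def by blast
  have 0: "(LINT x:ball 0 1|lborel. p (x /\<^sub>R norm x)) = 0"
    by (rule harmonic_ball_integral_eq_0[OF p assms(2) L])
  have [measurable]: "p \<in> borel_measurable borel"
    by (intro borel_measurable_continuous_onI tf_continuous hom_poly_tf[OF p])
  have "sph_coeff Y (\<lambda>x. g (norm x)) r = sph_int (\<lambda>\<theta>::real^'n. g \<bar>r\<bar> * cnj (p \<theta>))"
    unfolding sph_coeff_def by (rule sph_int_cong_sphere) (simp add: Yp, measurable)
  also have "\<dots> = real CARD('n) *\<^sub>R (LINT x|lborel. g \<bar>r\<bar>
      * cnj (indicator (ball 0 1) x *\<^sub>R p (x /\<^sub>R norm x)))"
    unfolding sph_int_def set_lebesgue_integral_def by (simp add: mult_ac)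
  also have "\<dots> = 0"
    unfolding integral_mult_right_zero Bochner_Integration.integral_cnj using 0
        by (simp add: set_lebesgue_integral_def)
  finally show ?thesis .
qed

text \<open>Radial data excite degree zero only. There the powers from the Hankel kernels cancel the
  Jacobians up to one power of \<open>norm x\<close>, leaving the situation of
  \<open>schroedinger_kernel\<close> and \<open>bessel_heat_imaginary\<close>.\<close>

lemma schr_sol_wave_packet:
  fixes Y :: "nat \<Rightarrow> nat \<Rightarrow> real^'n::finite \<Rightarrow> complex" and x :: "real^'n"
  assumes onb: "\<forall>k. sph_onb k (d k) (Y k)" and nu: "nu_k CARD('n) a 0 > 0"
    and N: "N \<ge> 6" and x: "x \<noteq> 0" and t: "t > 0"
  shows "cmod (schr_sol a d Y (wave_packet N) x t) = norm x powr (- (real CARD('n) - 1) / 2)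
      * sqrt (1 / (2 * t)) *
     norm (LINT s:{1/2..3/2}|lborel. of_real (bessel_w (nu_k CARD('n) a 0) (1 / (2 * t) * norm x * s))
         * cis (- (1 / (2 * t)) * s\<^sup>2 / 2) * profile ((real CARD('n) - 1) / 2) N s)"
proof -
  define n where "n = CARD('n)"
  define \<nu> where "\<nu> = nu_k n a 0"
  define p where "p = (real n - 1) / 2"
  define r where "r = norm x"
  define \<theta> where "\<theta> = x /\<^sub>R r"
  have nu': "\<nu> > 0" using nu by (simp add: \<nu>_def n_def)
  have r: "r > 0" using x by (simp add: r_def)
  have th: "\<theta> \<in> sphere 0 1" using x by (simp add: \<theta>_def r_def)
  have n1: "n \<ge> 1" unfolding n_def by (simp add: Suc_le_eq)
  have wp: "wave_packet N = (\<lambda>x::real^'n. ray_packet N (norm x))"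
      by (rule ext) (rule wave_packet_radial)
  obtain c where d0: "d 0 = 1" and c: "\<And>\<theta>. \<theta> \<in> sphere 0 1 \<Longrightarrow> Y 0 1 \<theta> = c"
      and cc: "of_real (sphere_area TYPE('n)) * (c * cnj c) = 1"
    by (rule sph_onb_0[OF onb[rule_format, of 0]]) (rule that)
  define I where "I k l = Lim at_top (\<lambda>R. LINT \<rho>:{0..R}|lborel. complex_of_real
      (hankel_kernel n (nu_k n a k) (r * \<rho>) * \<rho> ^ (n - 1))
            * cis (t * \<rho>\<^sup>2) * hankel n (nu_k n a k) (sph_coeff (Y k l) (wave_packet N)) \<rho>)" for k l
  have I0: "I k l = 0" if k: "k \<ge> 1" and l: "l \<in> {1..d k}" for k l
  proof -
    have "sph_harm k (Y k l)" using onb l unfolding sph_onb_def by blast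
    then have "sph_coeff (Y k l) (wave_packet N) = (\<lambda>_. 0)"
      unfolding wp using k by (intro ext sph_coeff_radial_eq_0)
    then have "I k l = Lim at_top (\<lambda>R::real. 0)" by (simp add: I_def hankel_def[abs_def])
    also have "\<dots> = 0" by (intro tendsto_Lim tendsto_const) simp
    finally show ?thesis .
  qed
  have sol: "schr_sol a d Y (wave_packet N) x t = c * I 0 1"
  proof -
    have "schr_sol a d Y (wave_packet N) x t = (\<Sum>k. \<Sum>l=1..d k. Y k l \<theta> * I k l)"
      unfolding schr_sol_def Let_def I_def \<theta>_def r_def n_def ..
    also have "\<dots> = (\<Sum>k\<in>{0}. \<Sum>l=1..d k. Y k l \<theta> * I k l)"
      by (rule suminf_finite) (auto simp: I0 intro!: sum.neutral)
    also have "\<dots> = c * I 0 1" using c[OF th] by (simp add: d0)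
    finally show ?thesis .
  qed
  define A where "A = complex_of_real (sphere_area TYPE('n)) * cnj c"
  have coeff: "sph_coeff (Y 0 1) (wave_packet N) \<rho> = A * ray_packet N \<rho>" if "\<rho> > 0" for \<rho>
  proof -
    have "sph_coeff (Y 0 1) (wave_packet N) \<rho> = sph_int (\<lambda>_::real^'n. ray_packet N \<rho> * cnj c)"
      unfolding sph_coeff_def wp
    proof (rule sph_int_cong_sphere)
      fix \<theta> :: "real^'n" assume th: "\<theta> \<in> sphere 0 1"
      then have "norm (\<rho> *\<^sub>R \<theta>) = \<rho>" using that by simp
      then show "ray_packet N (norm (\<rho> *\<^sub>R \<theta>)) * cnj (Y 0 1 \<theta>) = ray_packet N \<rho> * cnj c"
        unfolding c[OF th] by simp
    qed simp
    then show ?thesis by (simp add: sph_int_const A_def)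
  qed
  \<comment> \<open>One half of the Jacobian cancels against the kernel power, the other half is the
    factor \<open>s powr p\<close> in \<open>profile\<close>.\<close>
  have pw: "s ^ (n - 1) = s powr p * s powr p" if "s > 0" for s
  proof -
    have "s powr p * s powr p = s powr (real (n - 1))" unfolding powr_add[symmetric] p_def using n1
        by (simp add: of_nat_diff)
    then show ?thesis using that by (simp add: powr_realpow)
  qed
  have pm: "s powr p * s powr (- p) = 1" if "s > 0" for s :: real
    using that unfolding powr_add[symmetric] by simp
  have ker: "hankel_kernel n \<nu> (s * \<rho>) = s powr (- p) * \<rho> powr (- p) * bessel_w \<nu> (s * \<rho>)"
      if "s > 0" "\<rho> > 0" for s \<rho>
  proof -
    have "- (real n - 1) / 2 = - p" by (simp add: p_def field_simps)
    then show ?thesis using that by (simp add: hankel_kernel_eq powr_mult)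
  qed
  define B where "B \<rho> = (LINT s:{1/2..3/2}|lborel. of_real (bessel_w \<nu> (s * \<rho>)) * profile p N s)" for \<rho>
  have hank: "hankel n \<nu> (sph_coeff (Y 0 1) (wave_packet N)) \<rho> = A * of_real (\<rho> powr (- p)) * B \<rho>"
      if \<rho>: "\<rho> > 0" for \<rho>
  proof -
    have "hankel n \<nu> (sph_coeff (Y 0 1) (wave_packet N)) \<rho>
        = (LINT s|lborel. (A * of_real (\<rho> powr (- p)))
        * (indicator {1/2..3/2} s *\<^sub>R (of_real (bessel_w \<nu> (s * \<rho>)) * profile p N s)))"
      unfolding hankel_def set_lebesgue_integral_def
    proof (rule Bochner_Integration.integral_cong[OF refl])
      fix s :: real
      show "indicator {0<..} s *\<^sub>R (complex_of_real (hankel_kernel n \<nu> (s * \<rho>) * s ^ (n - 1))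
          * sph_coeff (Y 0 1) (wave_packet N) s) =
        (A * of_real (\<rho> powr (- p))) * (indicator {1/2..3/2} s
            *\<^sub>R (of_real (bessel_w \<nu> (s * \<rho>)) * profile p N s))"
      proof (cases "s > 0")
        case True
        have "hankel_kernel n \<nu> (s * \<rho>) * s ^ (n - 1) = (s powr p * s powr (- p))
            * (\<rho> powr (- p) * bessel_w \<nu> (s * \<rho>) * s powr p)"
          unfolding ker[OF True \<rho>] pw[OF True] by (simp only: mult_ac)
        then have k: "hankel_kernel n \<nu> (s * \<rho>) * s ^ (n - 1) = \<rho> powr (- p) * bessel_w \<nu> (s * \<rho>)
            * s powr p"
          unfolding pm[OF True] by simp
        have "profile p N s = 0" if "s \<notin> {1/2..3/2}"
          using cutoff_vanishes[OF N True, of 0] that by (auto simp: profile_def amplitude_def)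
        then have "indicator {1/2..3/2} s *\<^sub>R (of_real (bessel_w \<nu> (s * \<rho>)) * profile p N s)
            = of_real (bessel_w \<nu> (s * \<rho>)) * profile p N s"
          by (cases "s \<in> {1/2..3/2}") auto
        then show ?thesis using True unfolding coeff[OF True] k profile_eq by (simp add: mult_ac)
      qed simp
    qed
    also have "\<dots> = A * of_real (\<rho> powr (- p)) * B \<rho>"
      unfolding integral_mult_right_zero B_def set_lebesgue_integral_def ..
    finally show ?thesis .
  qed
  define V where "V = (LINT s:{1/2..3/2}|lborel. bessel_heat \<nu> (- (\<i> * of_real t)) r s * profile p N s)"
  obtain G1 G2 where G: "\<And>s. s > 0 \<Longrightarrow> (profile p N has_vector_derivative G1 s) (at s)"
    "\<And>s. s > 0 \<Longrightarrow> (G1 has_vector_derivative G2 s) (at s)" "continuous_on {0<..} G2"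
    "profile p N (1/2) = 0" "profile p N (3/2) = 0" "G1 (1/2) = 0" "G1 (3/2) = 0"
    by (rule profile_derivatives[OF N]) (rule that)
  have "((\<lambda>R. LINT \<rho>:{0..R}|lborel. of_real (bessel_w \<nu> (r * \<rho>)) * cis (t * \<rho>\<^sup>2) * B \<rho>) \<longlongrightarrow> V) at_top"
    unfolding B_def V_def by (rule schroedinger_kernel[where ?G1.0 = G1 and ?G2.0 = G2])
        (use nu' r t G in auto)
  then have "((\<lambda>R. (A * of_real (r powr (- p))) * (LINT \<rho>:{0..R}|lborel. of_real (bessel_w \<nu> (r * \<rho>))
      * cis (t * \<rho>\<^sup>2) * B \<rho>)) \<longlongrightarrow> (A * of_real (r powr (- p))) * V) at_top"
    by (rule tendsto_mult_left)
  moreover have "(LINT \<rho>:{0..R}|lborel. complex_of_real (hankel_kernel n \<nu> (r * \<rho>) * \<rho> ^ (n - 1))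
            * cis (t * \<rho>\<^sup>2) * hankel n \<nu> (sph_coeff (Y 0 1) (wave_packet N)) \<rho>) =
       (A * of_real (r powr (- p))) * (LINT \<rho>:{0..R}|lborel. of_real (bessel_w \<nu> (r * \<rho>))
           * cis (t * \<rho>\<^sup>2) * B \<rho>)" for R
    unfolding set_integral_mult_right[symmetric]
  proof (rule set_lebesgue_integral_cong)
    show "{0..R} \<in> sets lborel" by simp
    show "\<forall>\<rho>. \<rho> \<in> {0..R} \<longrightarrow> complex_of_real (hankel_kernel n \<nu> (r * \<rho>) * \<rho> ^ (n - 1))
            * cis (t * \<rho>\<^sup>2) * hankel n \<nu> (sph_coeff (Y 0 1) (wave_packet N)) \<rho>
                = (A * of_real (r powr (- p))) * (of_real (bessel_w \<nu> (r * \<rho>)) * cis (t * \<rho>\<^sup>2) * B \<rho>)"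
    proof (intro allI impI)
      fix \<rho> assume "\<rho> \<in> {0..R}"
      then consider "\<rho> = 0" | "\<rho> > 0" by fastforce
      then show "complex_of_real (hankel_kernel n \<nu> (r * \<rho>) * \<rho> ^ (n - 1))
            * cis (t * \<rho>\<^sup>2) * hankel n \<nu> (sph_coeff (Y 0 1) (wave_packet N)) \<rho>
                = (A * of_real (r powr (- p))) * (of_real (bessel_w \<nu> (r * \<rho>)) * cis (t * \<rho>\<^sup>2) * B \<rho>)"
      proof cases
        \<comment> \<open>At \<open>\<rho> = 0\<close> both sides vanish by the conventions
          \<open>0 powr _ = 0\<close> and \<open>sqrt 0 = 0\<close>.\<close>
        case 1
        then show ?thesis by (simp add: hankel_kernel_def bessel_w_def)
      next
        case 2
        have "hankel_kernel n \<nu> (r * \<rho>) * \<rho> ^ (n - 1) * \<rho> powr (- p) = r powr (- p)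
            * bessel_w \<nu> (r * \<rho>) * ((\<rho> powr p * \<rho> powr (- p)) * (\<rho> powr p * \<rho> powr (- p)))"
          unfolding ker[OF r 2] pw[OF 2] by (simp only: mult_ac)
        then have "complex_of_real (hankel_kernel n \<nu> (r * \<rho>) * \<rho> ^ (n - 1) * \<rho> powr (- p))
            = of_real (r powr (- p)) * of_real (bessel_w \<nu> (r * \<rho>))"
          unfolding pm[OF 2] by simp
        moreover have "complex_of_real (hankel_kernel n \<nu> (r * \<rho>) * \<rho> ^ (n - 1)) * cis (t * \<rho>\<^sup>2)
            * (A * of_real (\<rho> powr (- p)) * B \<rho>) =
            complex_of_real (hankel_kernel n \<nu> (r * \<rho>) * \<rho> ^ (n - 1) * \<rho> powr (- p))
                * (cis (t * \<rho>\<^sup>2) * A * B \<rho>)"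
          by (simp only: of_real_mult mult_ac)
        ultimately show ?thesis unfolding hank[OF 2] by (simp only: mult_ac)
      qed
    qed
  qed
  ultimately have "((\<lambda>R. LINT \<rho>:{0..R}|lborel. complex_of_real (hankel_kernel n \<nu> (r * \<rho>) * \<rho> ^ (n - 1))
            * cis (t * \<rho>\<^sup>2) * hankel n \<nu> (sph_coeff (Y 0 1) (wave_packet N)) \<rho>) \<longlongrightarrow>
                (A * of_real (r powr (- p))) * V) at_top"
    by simp
  then have "I 0 1 = (A * of_real (r powr (- p))) * V"
    unfolding I_def \<nu>_def[symmetric] by (intro tendsto_Lim) simp_all
  \<comment> \<open>The constant harmonic occurs once in the coefficient and once in the synthesis;
    the normalisation \<open>cc\<close> makes the product 1, so the choice of basis drops
    out.\<close>
  then have "schr_sol a d Y (wave_packet N) x t = (of_real (sphere_area TYPE('n)) * (c * cnj c))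
      * (of_real (r powr (- p)) * V)"
    unfolding sol A_def by (simp only: mult_ac)
  then have s1: "cmod (schr_sol a d Y (wave_packet N) x t) = r powr (- p) * norm V"
    unfolding cc by (simp add: norm_mult)
  obtain P where P: "norm P = 1" "\<And>s. s > 0 \<Longrightarrow> bessel_heat \<nu> (- (\<i> * of_real t)) r s =
       P * of_real (sqrt (1 / (2 * t)) * bessel_w \<nu> (1 / (2 * t) * r * s))
           * cis (- (1 / (2 * t)) * s\<^sup>2 / 2)"
    by (rule bessel_heat_imaginary[OF nu' r t]) (rule that)
  have "V = (P * of_real (sqrt (1 / (2 * t)))) * (LINT s:{1/2..3/2}|lborel. of_real
      (bessel_w \<nu> (1 / (2 * t) * r * s)) * cis (- (1 / (2 * t)) * s\<^sup>2 / 2) * profile p N s)"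
    unfolding V_def set_integral_mult_right[symmetric]
  proof (rule set_lebesgue_integral_cong)
    show "\<forall>s. s \<in> {1/2..3/2} \<longrightarrow> bessel_heat \<nu> (- (\<i> * of_real t)) r s * profile p N s = P
        * of_real (sqrt (1 / (2 * t))) * (of_real (bessel_w \<nu> (1 / (2 * t) * r * s))
        * cis (- (1 / (2 * t)) * s\<^sup>2 / 2) * profile p N s)"
    proof (intro allI impI)
      fix s :: real assume "s \<in> {1/2..3/2}"
      then have "s > 0" by simp
      from P(2)[OF this] show "bessel_heat \<nu> (- (\<i> * of_real t)) r s * profile p N s = P
          * of_real (sqrt (1 / (2 * t))) * (of_real (bessel_w \<nu> (1 / (2 * t) * r * s))
          * cis (- (1 / (2 * t)) * s\<^sup>2 / 2) * profile p N s)"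
        by (simp only: of_real_mult mult_ac)
    qed
  qed simp
  then have "norm V = sqrt (1 / (2 * t)) * norm (LINT s:{1/2..3/2}|lborel. of_real
      (bessel_w \<nu> (1 / (2 * t) * r * s)) * cis (- (1 / (2 * t)) * s\<^sup>2 / 2) * profile p N s)"
    using P(1) t by (simp only: norm_mult norm_of_real mult_1) simp
  moreover have "- p = - (real n - 1) / 2" by (simp add: p_def field_simps)
  ultimately show ?thesis unfolding s1 n_def[symmetric] \<nu>_def[symmetric] r_def[symmetric]
      p_def[symmetric] by (simp only: mult.assoc)
qed

lemma sobolev_norm_sq_mono:
  assumes "s \<le> s'" shows "sobolev_norm_sq s f \<le> sobolev_norm_sq s' f"
  unfolding sobolev_norm_sq_def
  by (intro nn_integral_mono ennreal_leI mult_right_mono powr_mono assms) auto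

lemma max_sol_wave_packet_ge:
  fixes Y :: "nat \<Rightarrow> nat \<Rightarrow> real^'n::finite \<Rightarrow> complex"
  assumes onb: "\<forall>k. sph_onb k (d k) (Y k)" and nu: "nu_k CARD('n) a 0 > 0"
  obtains c N0 :: real where "c > 0" "N0 \<ge> 6"
    "\<And>N x. N \<ge> N0 \<Longrightarrow> 1/4 \<le> norm x \<Longrightarrow> norm x \<le> 1/2 \<Longrightarrow> ennreal c \<le> max_sol a d Y (wave_packet N) x"
proof -
  define p where "p = (real CARD('n) - 1) / 2"
  have "CARD('n) \<ge> 1" by (simp add: Suc_le_eq)
  then have p: "p \<ge> 0" by (simp add: p_def)
  define \<nu> where "\<nu> = nu_k CARD('n) a 0"
  obtain c N0 :: real where c: "c > 0" and N0: "N0 \<ge> 6"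
    and low: "\<And>N r. N \<ge> N0 \<Longrightarrow> 1/4 \<le> r \<Longrightarrow> r \<le> 1/2 \<Longrightarrow>
       c \<le> sqrt (N / (1 - r)) * norm (LINT s:{1/2..3/2}|lborel. of_real
           (bessel_w \<nu> (N / (1 - r) * r * s)) * cis (- (N / (1 - r) * r * s\<^sup>2 / 2))
           * of_real (amplitude p N s))"
    by (rule propagated_wave_lower_bound[OF nu[folded \<nu>_def] p]) (rule that)
  have "ennreal c \<le> max_sol a d Y (wave_packet N) x" if N: "N \<ge> N0" and x: "1/4 \<le> norm x" "norm x
      \<le> 1/2" for N and x :: "real^'n"
  proof -
    define r where "r = norm x"
    \<comment> \<open>The time at which \<open>1 / (2 * t) = N / (1 - r)\<close>. Adding the phase
      \<open>N / 2 * s^2\<close> of the datum leaves the quadratic coefficient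
      \<open>- N / (1 - r) * r / 2\<close>.\<close>
    define t where "t = (1 - r) / (2 * N)"
    have r: "1/4 \<le> r" "r \<le> 1/2" using x by (simp_all add: r_def)
    have N6: "N \<ge> 6" using N N0 by simp
    have t: "t > 0" using r N6 by (simp add: t_def)
    have x0: "x \<noteq> 0" using x by auto
    have l: "1 / (2 * t) = N / (1 - r)" using r N6 by (simp add: t_def field_simps)
    have "cmod (schr_sol a d Y (wave_packet N) x t) = r powr (- (real CARD('n) - 1) / 2)
        * sqrt (N / (1 - r)) *
     norm (LINT s:{1/2..3/2}|lborel. of_real (bessel_w \<nu> (N / (1 - r) * r * s))
         * cis (- (N / (1 - r)) * s\<^sup>2 / 2) * profile p N s)"
      using schr_sol_wave_packet[OF onb nu N6 x0 t]
          unfolding l r_def[symmetric] \<nu>_def[symmetric] p_def[symmetric] .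
    also have "(LINT s:{1/2..3/2}|lborel. of_real (bessel_w \<nu> (N / (1 - r) * r * s))
        * cis (- (N / (1 - r)) * s\<^sup>2 / 2) * profile p N s)
      = (LINT s:{1/2..3/2}|lborel. of_real (bessel_w \<nu> (N / (1 - r) * r * s))
          * cis (- (N / (1 - r) * r * s\<^sup>2 / 2)) * of_real (amplitude p N s))"
    proof (rule arg_cong[of _ _ "set_lebesgue_integral lborel {1/2..3/2}"], rule ext)
      fix s
      have "- (N / (1 - r)) * s\<^sup>2 / 2 + N / 2 * s\<^sup>2 = - (N / (1 - r) * r * s\<^sup>2 / 2)" using r
          by (simp add: field_simps)
      then have "cis (- (N / (1 - r) * r * s\<^sup>2 / 2)) = cis (- (N / (1 - r)) * s\<^sup>2 / 2)
          * cis (N / 2 * s\<^sup>2)" by (simp only: cis_mult)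
      then show "of_real (bessel_w \<nu> (N / (1 - r) * r * s)) * cis (- (N / (1 - r)) * s\<^sup>2 / 2)
          * profile p N s
        = of_real (bessel_w \<nu> (N / (1 - r) * r * s)) * cis (- (N / (1 - r) * r * s\<^sup>2 / 2))
            * of_real (amplitude p N s)"
        unfolding profile_def by (simp only: mult_ac)
    qed
    finally have e: "cmod (schr_sol a d Y (wave_packet N) x t) = r powr (- (real CARD('n) - 1) / 2)
        * (sqrt (N / (1 - r)) *
      norm (LINT s:{1/2..3/2}|lborel. of_real (bessel_w \<nu> (N / (1 - r) * r * s))
          * cis (- (N / (1 - r) * r * s\<^sup>2 / 2)) * of_real (amplitude p N s)))"
      by (simp only: mult.assoc)
    have "r powr (- (real CARD('n) - 1) / 2) = 1 / r powr p"
      unfolding powr_minus_divide[symmetric] by (rule arg_cong[of _ _ "\<lambda>e. r powr e"])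
          (simp add: p_def field_simps)
    moreover have "r powr p \<le> 1" using r p by (intro powr_le1) auto
    ultimately have "r powr (- (real CARD('n) - 1) / 2) \<ge> 1" using r by simp
    then have "1 * c \<le> cmod (schr_sol a d Y (wave_packet N) x t)"
      unfolding e using low[OF N r] c by (intro mult_mono) auto
    then have "ennreal c \<le> ennreal (cmod (schr_sol a d Y (wave_packet N) x t))"
        by (intro ennreal_leI) simp
    also have "\<dots> \<le> max_sol a d Y (wave_packet N) x"
      unfolding max_sol_def by (rule SUP_upper) (use t in simp)
    finally show ?thesis .
  qed
  then show ?thesis by (rule that[OF c N0])
qed

theorem theorem1p3:
  fixes a s :: real
    and d :: "nat \<Rightarrow> nat"
    and Y :: "nat \<Rightarrow> nat \<Rightarrow> real^'n::finite \<Rightarrow> complex"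
  assumes "CARD('n) \<ge> 2"
    and "a > - ((real CARD('n) - 2)\<^sup>2) / 4"
    and "\<forall>k. sph_onb k (d k) (Y k)"
    and "\<exists>C::real. \<forall>u0 :: real^'n \<Rightarrow> complex. test_fun u0 \<longrightarrow>
           (\<integral>\<^sup>+ x \<in> ball 0 1. (max_sol a d Y u0 x)\<^sup>2 \<partial>lborel) \<le> ennreal C * sobolev_norm_sq s u0"
  shows "s \<ge> 1/4"
proof (rule ccontr)
  assume "\<not> s \<ge> 1/4"
  \<comment> \<open>The exponent \<open>s\<close> may be negative, while the interpolation bound
    covers \<open>[0, 1]\<close>; monotonicity of the norm in the exponent allows the
    replacement.\<close>
  define \<sigma> where "\<sigma> = max 0 s"
  have \<sigma>: "0 \<le> \<sigma>" "\<sigma> < 1/4" "s \<le> \<sigma>" using \<open>\<not> s \<ge> 1/4\<close> by (auto simp: \<sigma>_def)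
  \<comment> \<open>The lower bound on \<open>a\<close> says exactly that the square of the lowest
    order is positive.\<close>
  have nu: "nu_k CARD('n) a 0 > 0"
    using assms(2) by (simp add: nu_k_def mu_k_def power_divide)
  obtain C where C: "\<And>u0 :: real^'n \<Rightarrow> complex. test_fun u0 \<Longrightarrow>
           (\<integral>\<^sup>+ x \<in> ball 0 1. (max_sol a d Y u0 x)\<^sup>2 \<partial>lborel) \<le> ennreal C * sobolev_norm_sq s u0"
    using assms(4) by blast
  obtain c N0 :: real where c: "c > 0" and N0: "N0 \<ge> 6"
    and low: "\<And>N x. N \<ge> N0 \<Longrightarrow> 1/4 \<le> norm x \<Longrightarrow> norm x \<le> 1/2 \<Longrightarrow> ennreal c \<le> max_sol a d Y (wave_packet N) x"
    by (rule max_sol_wave_packet_ge[OF assms(3) nu]) (rule that)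
  obtain C1 where C1: "C1 \<ge> 0" and sob: "\<And>N s. N \<ge> 1 \<Longrightarrow> 0 \<le> s \<Longrightarrow> s \<le> 1 \<Longrightarrow>
     sobolev_norm_sq s (wave_packet N :: real^'n \<Rightarrow> complex) \<le> ennreal (C1 * N powr (2 * s) / sqrt N)"
    by (rule wave_packet_sobolev) (rule that)
  \<comment> \<open>The ball of radius 1/8 around a point of norm 3/8 lies in the region
    \<open>1/4 \<le> norm x \<le> 1/2\<close> where the lower bound holds, and has positive
    measure.\<close>
  define y where "y = (3/8 :: real) *\<^sub>R (axis undefined 1 :: real^'n)"
  have ny: "norm y = 3/8" by (simp add: y_def)
  define m where "m = measure lborel (ball y (1/8))"
  have m: "m > 0" unfolding m_def using content_ball_pos[of "1/8" y] by simp
  have em: "emeasure lborel (ball y (1/8)) = ennreal m"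
    unfolding m_def using emeasure_bounded_finite[OF bounded_ball, of y "1/8"]
        by (intro emeasure_eq_ennreal_measure) auto
  have T: "1/4 \<le> norm x" "norm x \<le> 1/2" "x \<in> ball 0 1" if "x \<in> ball y (1/8)" for x
  proof -
    have "norm (y - x) < 1/8" using that by (simp add: dist_norm)
    then show "1/4 \<le> norm x" "norm x \<le> 1/2" using ny norm_triangle_ineq2[of y x]
        norm_triangle_ineq2[of x y] by (auto simp: norm_minus_commute)
    then show "x \<in> ball 0 1" by simp
  qed
  have bound: "c\<^sup>2 * m \<le> \<bar>C\<bar> * C1 * N powr (2 * \<sigma> - 1/2)" if N: "N \<ge> N0" for N
  proof -
    have N1: "N \<ge> 1" using N N0 by simp
    have "ennreal (c\<^sup>2 * m) = (\<integral>\<^sup>+ x. ennreal (c\<^sup>2) * indicator (ball y (1/8)) x \<partial>lborel)"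
      using c m by (simp add: nn_integral_cmult_indicator em ennreal_mult)
    also have "\<dots> \<le> (\<integral>\<^sup>+ x \<in> ball 0 1. (max_sol a d Y (wave_packet N) x)\<^sup>2 \<partial>lborel)"
    proof (rule nn_integral_mono)
      fix x
      show "ennreal (c\<^sup>2) * indicator (ball y (1/8)) x \<le> (max_sol a d Y (wave_packet N) x)\<^sup>2
          * indicator (ball 0 1) x"
      proof (cases "x \<in> ball y (1/8)")
        case True
        have "(ennreal c)\<^sup>2 \<le> (max_sol a d Y (wave_packet N) x)\<^sup>2"
          by (intro power_mono low N T True) simp
        then show ?thesis using True T(3)[OF True] c by (simp add: ennreal_power)
      qed simp
    qed
    also have "\<dots> \<le> ennreal C * sobolev_norm_sq s (wave_packet N :: real^'n \<Rightarrow> complex)"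
      by (rule C[OF wave_packet_test_fun[OF N1]])
    also have "\<dots> \<le> ennreal \<bar>C\<bar> * ennreal (C1 * N powr (2 * \<sigma>) / sqrt N)"
      using \<sigma> by (intro mult_mono ennreal_leI order_trans[OF sobolev_norm_sq_mono[OF \<sigma>(3)] sob[OF N1]])
          auto
    also have "\<dots> = ennreal (\<bar>C\<bar> * (C1 * N powr (2 * \<sigma>) / sqrt N))"
      using C1 N1 by (intro ennreal_mult[symmetric]) auto
    finally have "c\<^sup>2 * m \<le> \<bar>C\<bar> * (C1 * N powr (2 * \<sigma>) / sqrt N)"
      using C1 N1 by (subst (asm) ennreal_le_iff) auto
    also have "N powr (2 * \<sigma>) / sqrt N = N powr (2 * \<sigma> - 1/2)"
      unfolding powr_diff using N1 by (simp add: powr_half_sqrt)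
    then have "\<bar>C\<bar> * (C1 * N powr (2 * \<sigma>) / sqrt N) = \<bar>C\<bar> * C1 * N powr (2 * \<sigma> - 1/2)"
      by (metis mult.assoc times_divide_eq_right)
    finally show ?thesis .
  qed
  \<comment> \<open>Since \<open>\<sigma> < 1/4\<close> the exponent
    \<open>2 * \<sigma> - 1/2\<close> is negative, so the upper bound tends to 0 while the left side
    of \<open>bound\<close> is a fixed positive number.\<close>
  have "((\<lambda>N. \<bar>C\<bar> * C1 * N powr (2 * \<sigma> - 1/2)) \<longlongrightarrow> \<bar>C\<bar> * C1 * 0) at_top"
    using \<sigma> by (intro tendsto_mult_left tendsto_neg_powr filterlim_ident) auto
  moreover have "\<forall>\<^sub>F N in at_top. c\<^sup>2 * m \<le> \<bar>C\<bar> * C1 * N powr (2 * \<sigma> - 1/2)"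
    using eventually_ge_at_top[of N0] by eventually_elim (rule bound)
  ultimately have "c\<^sup>2 * m \<le> \<bar>C\<bar> * C1 * 0" by (intro tendsto_lowerbound) auto
  then show False using c m by (simp add: mult_le_0_iff)
qed

end
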